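(* Every total function computed by a single-use Mealy machine is a composition of primes, i.e. it can be obtained by sequential and parallel composition from: (1) length-preserving homomorphisms $\Sigma^*\to\Gamma^*$ obtained by lifting letterwise an equivariant function $\Sigma\to\Gamma$ between polynomial orbit-finite sets; (2) functions computed by classical Mealy machines; (3) the atom propagation function.
   Context: Fix a countably infinite set $\mathbb A$ of atoms. A polynomial orbit-finite set is built from $\mathbb A$ and singleton sets by finite products and finite disjoint unions (finite sets are a special case); atom automorphisms (bijections of $\mathbb A$) act naturally; a function $f$ is equivariant if $f(\pi(x))=\pi(f(x))$ for every atom automorphism $\pi$. A single-use Mealy machine has polynomial orbit-finite input/output alphabets $\Sigma,\Gamma$, finitely many states with an initial state, finitely many registers holding an atom or $\bot$ (initially all $\bot$), and a deterministic transition function assigning to each state a question and, for each answer, a next state and an action. Questions: apply an equivariant function $\Sigma\to\{\mathrm{yes},\mathrm{no}\}$ to the current letter; or test equality of two registers (rejecting if either is $\bot$), after which both registers are set to $\bot$. Actions: store the value of an equivariant function $\Sigma\to\mathbb A+\bot$ of the current letter in a register; or output $f(r_1,\dots,r_k)$ for an equivariant $f:\mathbb A^k\to\Gamma$ and distinct registers $r_1,\dots,r_k$ (rejecting if one is $\bot$), setting these registers to $\bot$ and moving the head to the next position. There are no endmarkers; the run starts at the first position and succeeds when the head leaves the word to the right; the machine computes a length-preserving partial function $\Sigma^*\to\Gamma^*$. A classical Mealy machine has finite $\Sigma,\Gamma$, finite state set, initial state and transition function $Q\times\Sigma\to Q\times\Gamma$, computing the length-preserving function outputting one letter per transition. Atom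 propagation is the length-preserving function $(\mathbb A+\{\epsilon,\downarrow\})^*\to(\mathbb A+\bot)^*$ whose output at position $i$ is the atom at position $j$ if position $i$ has label $\downarrow$, $j<i$ has an atom label and all positions strictly between $j$ and $i$ have label $\epsilon$; otherwise the output is $\bot$. Sequential composition is $g\circ f$; parallel composition of length-preserving $f_i:\Sigma_i^*\to\Gamma_i^*$ is $f_1|f_2:(\Sigma_1\times\Sigma_2)^*\to(\Gamma_1\times\Gamma_2)^*$ applying $f_i$ to the $i$-th projection of the input. *)

theory Defs
  imports Main
begin

text \<open>Atoms are the natural numbers (a countably infinite set). Elements of
polynomial orbit-finite sets are represented in one universe of values.\<close>

datatype aval = Atm nat | Unt | Pr aval aval | VL aval | VR aval

datatype poly = PAtoms | PUnit | PProd poly poly | PSum poly poly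

fun inP :: "poly \<Rightarrow> aval \<Rightarrow> bool" where
  "inP PAtoms v = (\<exists>a. v = Atm a)"
| "inP PUnit v = (v = Unt)"
| "inP (PProd S T) v = (\<exists>x y. v = Pr x y \<and> inP S x \<and> inP T y)"
| "inP (PSum S T) v = ((\<exists>x. v = VL x \<and> inP S x) \<or> (\<exists>y. v = VR y \<and> inP T y))"

definition pset :: "poly \<Rightarrow> aval set" where
  "pset S = {v. inP S v}"

fun act :: "(nat \<Rightarrow> nat) \<Rightarrow> aval \<Rightarrow> aval" where
  "act \<pi> (Atm a) = Atm (\<pi> a)"
| "act \<pi> Unt = Unt"
| "act \<pi> (Pr x y) = Pr (act \<pi> x) (act \<pi> y)"
| "act \<pi> (VL x) = VL (act \<pi> x)"
| "act \<pi> (VR x) = VR (act \<pi> x)"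

definition equivariant :: "poly \<Rightarrow> poly \<Rightarrow> (aval \<Rightarrow> aval) \<Rightarrow> bool" where
  "equivariant S T f \<longleftrightarrow>
     (\<forall>x. inP S x \<longrightarrow> inP T (f x)) \<and>
     (\<forall>\<pi> x. bij \<pi> \<longrightarrow> inP S x \<longrightarrow> f (act \<pi> x) = act \<pi> (f x))"

definition PBool :: poly where "PBool = PSum PUnit PUnit"
definition yes :: aval where "yes = VL Unt"
definition PAtomBot :: poly where "PAtomBot = PSum PAtoms PUnit"
definition bot :: aval where "bot = VR Unt"

definition equivariant_tuple :: "nat \<Rightarrow> poly \<Rightarrow> (nat list \<Rightarrow> aval) \<Rightarrow> bool" where
  "equivariant_tuple k T f \<longleftrightarrow>
     (\<forall>as. length as = k \<longrightarrow> inP T (f as)) \<and>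
     (\<forall>\<pi> as. bij \<pi> \<longrightarrow> length as = k \<longrightarrow> f (map \<pi> as) = act \<pi> (f as))"

text \<open>Questions: an equivariant function \<Sigma> \<rightarrow> {yes,no} applied to the current
letter, or an equality test of two registers.\<close>
datatype question = QLetter "aval \<Rightarrow> aval" | QEq nat nat

text \<open>Actions: store (equivariant \<Sigma> \<rightarrow> A + bot) in a register, or output
f(r1,...,rk) for equivariant f : A^k \<rightarrow> \<Gamma> and distinct registers.\<close>
datatype action = Store nat "aval \<Rightarrow> aval" | Output "nat list" "nat list \<Rightarrow> aval"

text \<open>States are 0..<nQ, registers are 0..<nR; the transition function gives,
for each state, a question and, for answer yes / no, a next state and an action.\<close>
record su_machine =
  nQ :: nat
  nR :: nat
  init :: nat
  delta :: "nat \<Rightarrow> question \<times> (nat \<times> action) \<times> (nat \<times> action)"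

type_synonym regs = "nat \<Rightarrow> nat option"

fun wf_question :: "poly \<Rightarrow> nat \<Rightarrow> question \<Rightarrow> bool" where
  "wf_question \<Sigma> n (QLetter f) = equivariant \<Sigma> PBool f"
| "wf_question \<Sigma> n (QEq r1 r2) = (r1 < n \<and> r2 < n)"

fun wf_action :: "poly \<Rightarrow> poly \<Rightarrow> nat \<Rightarrow> action \<Rightarrow> bool" where
  "wf_action \<Sigma> \<Gamma> n (Store r g) = (r < n \<and> equivariant \<Sigma> PAtomBot g)"
| "wf_action \<Sigma> \<Gamma> n (Output rs f) =
     (distinct rs \<and> (\<forall>r\<in>set rs. r < n) \<and> equivariant_tuple (length rs) \<Gamma> f)"

definition su_mealy :: "poly \<Rightarrow> poly \<Rightarrow> su_machine \<Rightarrow> bool" where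
  "su_mealy \<Sigma> \<Gamma> M \<longleftrightarrow> init M < nQ M \<and>
     (\<forall>q < nQ M. case delta M q of (qu, (q1, a1), (q2, a2)) \<Rightarrow>
        wf_question \<Sigma> (nR M) qu \<and> q1 < nQ M \<and> q2 < nQ M \<and>
        wf_action \<Sigma> \<Gamma> (nR M) a1 \<and> wf_action \<Sigma> \<Gamma> (nR M) a2)"

text \<open>Answer to a question (None = reject); an equality test empties both registers.\<close>
fun answer :: "question \<Rightarrow> aval \<Rightarrow> regs \<Rightarrow> (bool \<times> regs) option" where
  "answer (QLetter f) a \<rho> = Some (f a = yes, \<rho>)"
| "answer (QEq r1 r2) a \<rho> =
     (case (\<rho> r1, \<rho> r2) of
        (Some x, Some y) \<Rightarrow> Some (x = y, \<rho>(r1 := None, r2 := None))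
      | _ \<Rightarrow> None)"

definition branch :: "su_machine \<Rightarrow> nat \<Rightarrow> bool \<Rightarrow> nat \<times> action" where
  "branch M q b = (if b then fst (snd (delta M q)) else snd (snd (delta M q)))"

definition to_reg :: "aval \<Rightarrow> nat option" where
  "to_reg v = (case v of VL (Atm x) \<Rightarrow> Some x | _ \<Rightarrow> None)"

text \<open>su_run M q \<rho> w out: started in state q with register valuation \<rho> and with
the head on the first letter of the remaining input w, the run succeeds (the head
leaves w to the right) producing output out.\<close>
inductive su_run :: "su_machine \<Rightarrow> nat \<Rightarrow> regs \<Rightarrow> aval list \<Rightarrow> aval list \<Rightarrow> bool"
  for M where
  finish: "su_run M q \<rho> [] []"
| store: "\<lbrakk> answer (fst (delta M q)) a \<rho> = Some (b, \<rho>1);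
            branch M q b = (q', Store r g);
            su_run M q' (\<rho>1(r := to_reg (g a))) (a # w) out \<rbrakk>
          \<Longrightarrow> su_run M q \<rho> (a # w) out"
| out: "\<lbrakk> answer (fst (delta M q)) a \<rho> = Some (b, \<rho>1);
             branch M q b = (q', Output rs f);
             \<forall>r\<in>set rs. \<rho>1 r \<noteq> None;
             su_run M q' (\<lambda>r. if r \<in> set rs then None else \<rho>1 r) w out \<rbrakk>
           \<Longrightarrow> su_run M q \<rho> (a # w) (f (map (\<lambda>r. the (\<rho>1 r)) rs) # out)"

definition su_fun :: "su_machine \<Rightarrow> aval list \<Rightarrow> aval list option" where
  "su_fun M w = (if \<exists>out. su_run M (init M) (\<lambda>_. None) w out
                 then Some (THE out. su_run M (init M) (\<lambda>_. None) w out) else None)"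

fun mealy_fun :: "(nat \<Rightarrow> aval \<Rightarrow> nat \<times> aval) \<Rightarrow> nat \<Rightarrow> aval list \<Rightarrow> aval list" where
  "mealy_fun \<delta> q [] = []"
| "mealy_fun \<delta> q (a # w) = snd (\<delta> q a) # mealy_fun \<delta> (fst (\<delta> q a)) w"

definition classical_mealy :: "poly \<Rightarrow> poly \<Rightarrow> nat \<Rightarrow> nat \<Rightarrow> (nat \<Rightarrow> aval \<Rightarrow> nat \<times> aval) \<Rightarrow> bool" where
  "classical_mealy \<Sigma> \<Gamma> n q0 \<delta> \<longleftrightarrow> finite (pset \<Sigma>) \<and> finite (pset \<Gamma>) \<and> q0 < n \<and>
     (\<forall>q < n. \<forall>a. inP \<Sigma> a \<longrightarrow> fst (\<delta> q a) < n \<and> inP \<Gamma> (snd (\<delta> q a)))"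

definition PPropIn :: poly where "PPropIn = PSum PAtoms (PSum PUnit PUnit)"
definition eps :: aval where "eps = VR (VL Unt)"
definition down :: aval where "down = VR (VR Unt)"

definition atom_propagation :: "aval list \<Rightarrow> aval list" where
  "atom_propagation w = map (\<lambda>i.
     if w ! i = down \<and>
        (\<exists>j a. j < i \<and> w ! j = VL (Atm a) \<and> (\<forall>k. j < k \<and> k < i \<longrightarrow> w ! k = eps))
     then w ! (GREATEST j. j < i \<and> (\<exists>a. w ! j = VL (Atm a)))
     else bot) [0..<length w]"

fun vfst :: "aval \<Rightarrow> aval" where "vfst (Pr x y) = x" | "vfst _ = Unt"
fun vsnd :: "aval \<Rightarrow> aval" where "vsnd (Pr x y) = y" | "vsnd _ = Unt"

definition par :: "(aval list \<Rightarrow> aval list) \<Rightarrow> (aval list \<Rightarrow> aval list) \<Rightarrow> aval list \<Rightarrow> aval list" where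
  "par f1 f2 w = map2 Pr (f1 (map vfst w)) (f2 (map vsnd w))"

inductive comp_primes :: "poly \<Rightarrow> poly \<Rightarrow> (aval list \<Rightarrow> aval list) \<Rightarrow> bool" where
  lift: "equivariant \<Sigma> \<Gamma> h \<Longrightarrow> comp_primes \<Sigma> \<Gamma> (map h)"
| mealy: "classical_mealy \<Sigma> \<Gamma> n q0 \<delta> \<Longrightarrow> comp_primes \<Sigma> \<Gamma> (mealy_fun \<delta> q0)"
| propagation: "comp_primes PPropIn PAtomBot atom_propagation"
| seq: "\<lbrakk> comp_primes \<Sigma> \<Delta> f; comp_primes \<Delta> \<Gamma> g \<rbrakk> \<Longrightarrow> comp_primes \<Sigma> \<Gamma> (g \<circ> f)"
| parallel: "\<lbrakk> comp_primes \<Sigma>1 \<Gamma>1 f1; comp_primes \<Sigma>2 \<Gamma>2 f2 \<rbrakk>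
             \<Longrightarrow> comp_primes (PProd \<Sigma>1 \<Sigma>2) (PProd \<Gamma>1 \<Gamma>2) (par f1 f2)"

end

theory Submission
  imports Defs "HOL-Library.Multiset_Order" "HOL-Library.Infinite_Set" "HOL-Library.FuncSet"
begin

text \<open>
  If the control flow of the machine were known at every position, each register would have a
  known life from its last write to its single use, and atom propagation would deliver its
  content. So it suffices to compute the control flow, that is, the outcomes of equality tests.

  A configuration space is a finite disjoint union of components \<open>\<A>\<^sup>V\<close>, and a letter acts on it
  by one decision tree per component; single use means that every test destroys the registers
  it looks at. The proof is by induction on the multiset of the dimensions \<open>card V\<close>. A letter
  that merely relabels components is a unit; runs of units are composed by a classical Mealy
  machine. For any other letter \<open>a\<close> the configurations possible right after \<open>a\<close> can be described,
  relative to \<open>a\<close>, in a space of smaller dimension multiset, because a test or a lost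
  register strictly lowers dimensions and a stored atom of \<open>a\<close> need not be remembered. Hence
  on the subsequence of non-unit letters, each paired with its predecessor by means of atom
  propagation, the machine acts on a smaller space.
\<close>

section \<open>Orbit-finiteness of polynomial sets\<close>

text \<open>The control flow contains no atoms, but deciding an equality test may require atoms
  stored arbitrarily far back, and the lives of the registers holding them depend on earlier tests.
  Counting registers does not break this circle, because one letter may refill everything that it
  destroys. What it refills with are its own atoms, however, and these can be substituted into the
  decision tree of the next breaking letter, where they become constants. Tests split a component
  into many pieces, each of smaller dimension; this is why the measure is a multiset in the
  well-founded multiset order and not a number. A letter that loses nothing but gains atoms need not
  shrink its source; it is compared with its target, so both sides carry a bound. Finiteness comes
  from one fact throughout: a renaming-invariant function on a polynomial orbit-finite set has
  finitely many values. It yields finite state spaces, a uniform bound on the steps spent on one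
  letter, and the maximum of the measures in the induction step.\<close>

fun atoms_of :: "aval \<Rightarrow> nat set" where
  "atoms_of (Atm a) = {a}"
| "atoms_of Unt = {}"
| "atoms_of (Pr x y) = atoms_of x \<union> atoms_of y"
| "atoms_of (VL x) = atoms_of x"
| "atoms_of (VR x) = atoms_of x"

fun poly_width :: "poly \<Rightarrow> nat" where
  "poly_width PAtoms = 1"
| "poly_width PUnit = 0"
| "poly_width (PProd S T) = poly_width S + poly_width T"
| "poly_width (PSum S T) = poly_width S + poly_width T"

lemma finite_atoms_of [simp]: "finite (atoms_of v)"
  by (induction v) auto

lemma card_atoms_of: "inP S v \<Longrightarrow> card (atoms_of v) \<le> poly_width S"
proof (induction S arbitrary: v)
  case (PProd S T)
  then obtain x y where "v = Pr x y" "inP S x" "inP T y" by auto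
  then show ?case using PProd.IH card_Un_le[of "atoms_of x" "atoms_of y"]
    by (metis add_mono atoms_of.simps(3) le_trans poly_width.simps(3))
next
  case (PSum S T)
  then show ?case by (auto simp: trans_le_add1 trans_le_add2)
qed auto

lemma atoms_of_act: "atoms_of (act \<pi> v) = \<pi> ` atoms_of v"
  by (induction v) auto

lemma inP_act [simp]: "inP S (act \<pi> v) \<longleftrightarrow> inP S v"
proof (induction S arbitrary: v)
  case PAtoms then show ?case by (cases v) auto
next
  case PUnit then show ?case by (cases v) auto
next
  case (PProd S T) then show ?case by (cases v) auto
next
  case (PSum S T) then show ?case by (cases v) auto
qed

lemma finite_pset_bounded: "finite {v. inP S v \<and> atoms_of v \<subseteq> {..<n}}"
proof (induction S)
  case PAtoms
  have "{v. inP PAtoms v \<and> atoms_of v \<subseteq> {..<n}} \<subseteq> Atm ` {..<n}" by auto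
  then show ?case by (rule finite_subset) auto
next
  case PUnit
  have "{v. inP PUnit v \<and> atoms_of v \<subseteq> {..<n}} \<subseteq> {Unt}" by auto
  then show ?case by (rule finite_subset) auto
next
  case (PProd S T)
  have "{v. inP (PProd S T) v \<and> atoms_of v \<subseteq> {..<n}} \<subseteq>
    (\<lambda>(x,y). Pr x y) ` ({v. inP S v \<and> atoms_of v \<subseteq> {..<n}} \<times> {v. inP T v \<and> atoms_of v \<subseteq> {..<n}})"
    by auto
  then show ?case by (rule finite_subset) (use PProd in auto)
next
  case (PSum S T)
  have "{v. inP (PSum S T) v \<and> atoms_of v \<subseteq> {..<n}} \<subseteq>
    VL ` {v. inP S v \<and> atoms_of v \<subseteq> {..<n}} \<union> VR ` {v. inP T v \<and> atoms_of v \<subseteq> {..<n}}"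
    by auto
  then show ?case by (rule finite_subset) (use PSum in auto)
qed

text \<open>Both complements are infinite subsets of the naturals, so a bijection between the finite
  sets extends to a permutation of all atoms.\<close>

lemma ex_bij_compressing:
  fixes A :: "nat set"
  assumes "finite A"
  shows "\<exists>\<pi>. bij \<pi> \<and> \<pi> ` A = {..<card A}"
proof -
  obtain f where f: "bij_betw f A {..<card A}"
    using assms by (metis atLeast0LessThan ex_bij_betw_finite_nat)
  have inf: "infinite (- A)" "infinite (- {..<card A})"
    using assms by (auto simp: Compl_eq_Diff_UNIV)
  obtain g where g: "bij_betw g (- A) (- {..<card A})"
    using bij_betw_trans[OF bij_betw_inv_into[OF bij_enumerate[OF inf(1)]] bij_enumerate[OF inf(2)]]
    by blast
  define h where "h x = (if x \<in> A then f x else g x)" for x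
  have "bij_betw h A {..<card A}" using f by (rule bij_betw_cong[THEN iffD1, rotated]) (auto simp: h_def)
  moreover have "bij_betw h (- A) (- {..<card A})"
    using g by (rule bij_betw_cong[THEN iffD1, rotated]) (auto simp: h_def)
  ultimately have "bij_betw h (A \<union> - A) ({..<card A} \<union> - {..<card A})" and "h ` A = {..<card A}"
    using bij_betw_combine[of h A "{..<card A}" "- A" "- {..<card A}"]
    by (simp_all only: Compl_disjoint bij_betw_imp_surj_on)
  then show ?thesis by (metis Compl_partition)
qed

definition invariant :: "poly \<Rightarrow> (aval \<Rightarrow> 'x) \<Rightarrow> bool" where
  "invariant S f \<longleftrightarrow> (\<forall>\<pi> x. bij \<pi> \<longrightarrow> inP S x \<longrightarrow> f (act \<pi> x) = f x)"

lemma invariantD: "invariant S f \<Longrightarrow> bij \<pi> \<Longrightarrow> inP S x \<Longrightarrow> f (act \<pi> x) = f x"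
  by (simp add: invariant_def)

text \<open>Every orbit contains an element whose atoms lie below \<open>poly_width S\<close>, and
  there are only finitely many such elements.\<close>

lemma finite_range_invariant:
  assumes "invariant S f"
  shows "finite (f ` pset S)"
proof -
  have "f ` pset S \<subseteq> f ` {v. inP S v \<and> atoms_of v \<subseteq> {..<poly_width S}}"
  proof
    fix y assume "y \<in> f ` pset S"
    then obtain v where v: "inP S v" "y = f v" by (auto simp: pset_def)
    obtain \<pi> where \<pi>: "bij \<pi>" "\<pi> ` atoms_of v = {..<card (atoms_of v)}"
      using ex_bij_compressing[of "atoms_of v"] by auto
    have "y = f (act \<pi> v)" using assms v \<pi> by (simp add: invariant_def)
    moreover have "atoms_of (act \<pi> v) \<subseteq> {..<poly_width S}"
      using card_atoms_of[OF v(1)] \<pi> by (simp add: atoms_of_act)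
    ultimately show "y \<in> f ` {v. inP S v \<and> atoms_of v \<subseteq> {..<poly_width S}}"
      using v by auto
  qed
  then show ?thesis by (rule finite_subset) (simp add: finite_pset_bounded)
qed

section \<open>Closure properties of compositions of primes\<close>

lemma comp_primes_preserves:
  assumes "comp_primes \<Sigma> \<Gamma> g" and "w \<in> lists (pset \<Sigma>)"
  shows "g w \<in> lists (pset \<Gamma>) \<and> length (g w) = length w"
  using assms
proof (induction arbitrary: w)
  case (lift \<Sigma> \<Gamma> h)
  then show ?case by (auto simp: equivariant_def pset_def)
next
  case (mealy \<Sigma> \<Gamma> n q0 \<delta>)
  have "q < n \<Longrightarrow> mealy_fun \<delta> q w \<in> lists (pset \<Gamma>) \<and> length (mealy_fun \<delta> q w) = length w" for q
    using mealy.prems mealy.hyps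
    by (induction w arbitrary: q) (auto simp: classical_mealy_def pset_def)
  then show ?case using mealy.hyps by (auto simp: classical_mealy_def)
next
  case propagation
  have "inP PAtomBot (atom_propagation w ! i)" if "i < length w" for i
  proof -
    let ?P = "\<lambda>j. j < i \<and> (\<exists>a. w ! j = VL (Atm a))"
    have "\<exists>a. w ! (GREATEST j. ?P j) = VL (Atm a)" if "\<exists>j a. j < i \<and> w ! j = VL (Atm a)"
      using GreatestI_ex_nat[of ?P i] that by auto
    then show ?thesis using that by (auto simp: atom_propagation_def PAtomBot_def bot_def)
  qed
  moreover have "length (atom_propagation w) = length w" by (simp add: atom_propagation_def)
  ultimately show ?case by (auto simp: in_set_conv_nth pset_def)
next
  case (seq \<Sigma> \<Delta> f \<Gamma> g)
  then show ?case by simp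
next
  case (parallel \<Sigma>1 \<Gamma>1 f1 \<Sigma>2 \<Gamma>2 f2)
  have "map vfst w \<in> lists (pset \<Sigma>1)" "map vsnd w \<in> lists (pset \<Sigma>2)"
    using parallel.prems by (force simp: pset_def)+
  then have *: "f1 (map vfst w) \<in> lists (pset \<Gamma>1)" "length (f1 (map vfst w)) = length w"
    "f2 (map vsnd w) \<in> lists (pset \<Gamma>2)" "length (f2 (map vsnd w)) = length w"
    using parallel.IH by fastforce+
  have "inP \<Gamma>1 x \<and> inP \<Gamma>2 y" if "(x, y) \<in> set (zip (f1 (map vfst w)) (f2 (map vsnd w)))" for x y
    using set_zip_leftD[OF that] set_zip_rightD[OF that] *(1,3) by (auto simp: pset_def)
  then show ?case using *(2,4) by (auto simp: par_def pset_def)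
qed

text \<open>\<open>comp_primes\<close> concerns functions on all lists, ill-formed words included,
  and is not closed under changing them there. Agreement on words over \<open>\<Sigma>\<close> is
  what later constructions can guarantee.\<close>

definition cprime :: "poly \<Rightarrow> poly \<Rightarrow> (aval list \<Rightarrow> aval list) \<Rightarrow> bool" where
  "cprime \<Sigma> \<Gamma> F \<longleftrightarrow> (\<exists>g. comp_primes \<Sigma> \<Gamma> g \<and> (\<forall>w \<in> lists (pset \<Sigma>). g w = F w))"

lemma cprime_preserves:
  "cprime \<Sigma> \<Gamma> F \<Longrightarrow> w \<in> lists (pset \<Sigma>) \<Longrightarrow> F w \<in> lists (pset \<Gamma>) \<and> length (F w) = length w"
  unfolding cprime_def using comp_primes_preserves by fastforce

lemma cprime_of_comp_primes: "comp_primes \<Sigma> \<Gamma> g \<Longrightarrow> cprime \<Sigma> \<Gamma> g"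
  by (auto simp: cprime_def)

lemma cprime_cong:
  "cprime \<Sigma> \<Gamma> F \<Longrightarrow> (\<And>w. w \<in> lists (pset \<Sigma>) \<Longrightarrow> F w = G w) \<Longrightarrow> cprime \<Sigma> \<Gamma> G"
  by (auto simp: cprime_def)

lemma cprime_map: "equivariant \<Sigma> \<Gamma> h \<Longrightarrow> cprime \<Sigma> \<Gamma> (map h)"
  by (rule cprime_of_comp_primes) (rule comp_primes.lift)

lemma cprime_comp:
  assumes "cprime \<Sigma> \<Delta> F" "cprime \<Delta> \<Gamma> G"
  shows "cprime \<Sigma> \<Gamma> (\<lambda>w. G (F w))"
proof -
  obtain f g where f: "comp_primes \<Sigma> \<Delta> f" "\<forall>w \<in> lists (pset \<Sigma>). f w = F w"
    and g: "comp_primes \<Delta> \<Gamma> g" "\<forall>w \<in> lists (pset \<Delta>). g w = G w"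
    using assms by (auto simp: cprime_def)
  have "(g \<circ> f) w = G (F w)" if "w \<in> lists (pset \<Sigma>)" for w
    using f g comp_primes_preserves[OF f(1) that] that by auto
  then show ?thesis unfolding cprime_def using comp_primes.seq[OF f(1) g(1)] by blast
qed

lemma cprime_pair:
  assumes "cprime \<Sigma> \<Gamma>1 F1" "cprime \<Sigma> \<Gamma>2 F2"
  shows "cprime \<Sigma> (PProd \<Gamma>1 \<Gamma>2) (\<lambda>w. map2 Pr (F1 w) (F2 w))"
proof -
  obtain f1 f2 where f: "comp_primes \<Sigma> \<Gamma>1 f1" "\<forall>w \<in> lists (pset \<Sigma>). f1 w = F1 w"
    "comp_primes \<Sigma> \<Gamma>2 f2" "\<forall>w \<in> lists (pset \<Sigma>). f2 w = F2 w"
    using assms by (auto simp: cprime_def)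
  have "equivariant \<Sigma> (PProd \<Sigma> \<Sigma>) (\<lambda>x. Pr x x)" by (auto simp: equivariant_def)
  then have "comp_primes \<Sigma> (PProd \<Gamma>1 \<Gamma>2) (par f1 f2 \<circ> map (\<lambda>x. Pr x x))"
    using comp_primes.seq[OF comp_primes.lift comp_primes.parallel[OF f(1,3)]] by blast
  moreover have "(par f1 f2 \<circ> map (\<lambda>x. Pr x x)) w = map2 Pr (F1 w) (F2 w)"
    if "w \<in> lists (pset \<Sigma>)" for w
    using f that by (simp add: par_def comp_def)
  ultimately show ?thesis unfolding cprime_def by blast
qed

lemma equivariant_id: "equivariant \<Sigma> \<Sigma> (\<lambda>x. x)"
  by (auto simp: equivariant_def)

lemma cprime_id: "cprime \<Sigma> \<Sigma> (\<lambda>w. w)"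
  using cprime_map[OF equivariant_id] by simp

lemma cprime_pair_map:
  assumes "cprime \<Sigma> \<Gamma>1 F1" "cprime \<Sigma> \<Gamma>2 F2" "equivariant (PProd \<Gamma>1 \<Gamma>2) \<Gamma> h"
  shows "cprime \<Sigma> \<Gamma> (\<lambda>w. map2 (\<lambda>x y. h (Pr x y)) (F1 w) (F2 w))"
  using cprime_comp[OF cprime_pair[OF assms(1,2)] cprime_map[OF assms(3)]]
  by (rule cprime_cong) (simp add: comp_def case_prod_beta)

section \<open>Finite-state machines reading orbit-finite letters\<close>

text \<open>A set with \<open>n + 1\<close> elements, in unary; the codes \<open>fin_enc n i\<close>
  with \<open>i \<le> n\<close> are pairwise distinct.\<close>

fun finP :: "nat \<Rightarrow> poly" where
  "finP 0 = PUnit"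
| "finP (Suc n) = PSum PUnit (finP n)"

fun fin_enc :: "nat \<Rightarrow> nat \<Rightarrow> aval" where
  "fin_enc 0 i = Unt"
| "fin_enc (Suc n) 0 = VL Unt"
| "fin_enc (Suc n) (Suc i) = VR (fin_enc n i)"

fun fin_dec :: "aval \<Rightarrow> nat" where
  "fin_dec (VR v) = Suc (fin_dec v)"
| "fin_dec _ = 0"

lemma fin_enc_inP [simp]: "inP (finP n) (fin_enc n i)"
  by (induction n i rule: fin_enc.induct) auto

lemma fin_dec_enc [simp]: "i \<le> n \<Longrightarrow> fin_dec (fin_enc n i) = i"
  by (induction n i rule: fin_enc.induct) auto

lemma act_fin_enc [simp]: "act \<pi> (fin_enc n i) = fin_enc n i"
  by (induction n i rule: fin_enc.induct) auto

lemma fin_dec_act [simp]: "fin_dec (act \<pi> v) = fin_dec v"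
  by (induction v) auto

lemma finite_pset_finP [simp]: "finite (pset (finP n))"
proof (induction n)
  case 0 show ?case by (simp add: pset_def)
next
  case (Suc n)
  have "pset (finP (Suc n)) \<subseteq> insert (VL Unt) (VR ` pset (finP n))" by (auto simp: pset_def)
  then show ?case by (rule finite_subset) (use Suc in auto)
qed

fun states :: "('q \<Rightarrow> aval \<Rightarrow> 'q) \<Rightarrow> 'q \<Rightarrow> aval list \<Rightarrow> 'q list" where
  "states step q [] = []"
| "states step q (a # w) = q # states step (step q a) w"

text \<open>A word function with values in an arbitrary set counts as computable when it is read
  off letterwise, in a renaming-invariant way, from a composition of primes.\<close>

definition computes_info :: "poly \<Rightarrow> aval list set \<Rightarrow> (aval list \<Rightarrow> 'x list) \<Rightarrow> bool" where
  "computes_info \<Sigma> W F \<longleftrightarrow> (\<exists>P d G. cprime \<Sigma> P G \<and> invariant P d \<and>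
     (\<forall>w \<in> lists (pset \<Sigma>) \<inter> W. map d (G w) = F w))"

text \<open>A letter matters only through the function that it induces on the finite set
  \<open>Q\<close>. Renaming does not change this function, so mapping a letter to its code is
  equivariant into a finite alphabet, and a classical Mealy machine does the rest.\<close>

lemma computes_info_states:
  assumes Q: "finite Q" "q0 \<in> Q"
    and closed: "\<And>q a. q \<in> Q \<Longrightarrow> inP \<Sigma> a \<Longrightarrow> step q a \<in> Q"
    and inv: "\<And>q. q \<in> Q \<Longrightarrow> invariant \<Sigma> (step q)"
  shows "computes_info \<Sigma> UNIV (states step q0)"
proof -
  define n where "n = card Q"
  obtain idx where idx: "bij_betw idx Q {0..<n}"
    using ex_bij_betw_finite_nat[OF Q(1)] n_def by auto
  define qof where "qof = inv_into Q idx"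
  have qof: "idx q < n" "qof (idx q) = q" if "q \<in> Q" for q
    using idx that by (auto simp: qof_def bij_betw_def dest: inv_into_f_f)
  define F where "F = Q \<rightarrow>\<^sub>E Q"
  have "finite F" unfolding F_def using Q by (simp add: finite_PiE)
  then obtain fx where fx: "bij_betw fx F {0..<card F}" using ex_bij_betw_finite_nat by blast
  define fof where "fof = inv_into F fx"
  have fof: "fx f < card F" "fof (fx f) = f" if "f \<in> F" for f
    using fx that by (auto simp: fof_def bij_betw_def dest: inv_into_f_f)
  define h where "h a = fin_enc (card F) (fx (restrict (\<lambda>q. step q a) Q))" for a
  have resF: "restrict (\<lambda>q. step q a) Q \<in> F" if "inP \<Sigma> a" for a
    using closed that by (auto simp: F_def)
  have eq_h: "equivariant \<Sigma> (finP (card F)) h"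
  proof -
    have "restrict (\<lambda>q. step q (act \<pi> a)) Q = restrict (\<lambda>q. step q a) Q" if "bij \<pi>" "inP \<Sigma> a" for \<pi> a
      using inv that by (auto simp: invariant_def restrict_def fun_eq_iff)
    then show ?thesis by (auto simp: equivariant_def h_def)
  qed
  \<comment> \<open>\<open>finP (card F)\<close> has one code more than \<open>F\<close> has
    elements, and \<open>fof\<close> is arbitrary on it; the fallback 0 keeps the machine inside its
    state set.\<close>
  define \<delta> where "\<delta> i v = (let j = idx (fof (fin_dec v) (qof i)) in (if j < n then j else 0, fin_enc n i))" for i v
  have "n > 0" using Q by (auto simp: n_def card_gt_0_iff)
  then have "classical_mealy (finP (card F)) (finP n) n (idx q0) \<delta>"
    using qof Q by (auto simp: classical_mealy_def \<delta>_def Let_def)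
  then have c: "cprime \<Sigma> (finP n) (\<lambda>w. mealy_fun \<delta> (idx q0) (map h w))"
    by (intro cprime_comp[OF cprime_map[OF eq_h]] cprime_of_comp_primes comp_primes.mealy)
  have *: "map (\<lambda>v. qof (fin_dec v)) (mealy_fun \<delta> (idx q) (map h w)) = states step q w"
    if "w \<in> lists (pset \<Sigma>)" "q \<in> Q" for q w
    using that(2,1)
  proof (induction w arbitrary: q)
    case (Cons a w)
    have a: "inP \<Sigma> a" using Cons.prems by (auto simp: pset_def)
    have "fof (fin_dec (h a)) (qof (idx q)) = step q a"
      using fof[OF resF[OF a]] qof Cons.prems by (simp add: h_def)
    moreover have "step q a \<in> Q" using closed a Cons.prems by auto
    ultimately have "fst (\<delta> (idx q) (h a)) = idx (step q a)" using qof by (simp add: \<delta>_def)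
    moreover have "qof (fin_dec (snd (\<delta> (idx q) (h a)))) = q"
      using qof Cons.prems by (simp add: \<delta>_def Let_def less_imp_le)
    ultimately show ?case using Cons closed a by auto
  qed simp
  have "invariant (finP n) (\<lambda>v. qof (fin_dec v))" by (simp add: invariant_def)
  then show ?thesis unfolding computes_info_def using c * Q(2) by blast
qed

lemma computes_infoE:
  assumes "computes_info \<Sigma> W F"
  obtains P d G where "cprime \<Sigma> P G" "invariant P d"
    "\<And>w. w \<in> lists (pset \<Sigma>) \<Longrightarrow> w \<in> W \<Longrightarrow> map d (G w) = F w"
  using assms unfolding computes_info_def by blast

lemma computes_info_UNIV_E:
  assumes "computes_info \<Sigma> UNIV F"
  obtains P d G where "cprime \<Sigma> P G" "invariant P d"
    "\<And>w. w \<in> lists (pset \<Sigma>) \<Longrightarrow> map d (G w) = F w"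
  using assms unfolding computes_info_def by blast

fun omealy :: "('q \<Rightarrow> aval \<Rightarrow> 'q) \<Rightarrow> ('q \<Rightarrow> aval \<Rightarrow> 'x) \<Rightarrow> 'q \<Rightarrow> aval list \<Rightarrow> 'x list" where
  "omealy step out q [] = []"
| "omealy step out q (a # w) = out q a # omealy step out (step q a) w"

lemma omealy_states: "omealy step out q w = map2 out (states step q w) w"
  by (induction w arbitrary: q) auto

lemma computes_info_omealy:
  assumes Q: "finite Q" "q0 \<in> Q"
    and closed: "\<And>q a. q \<in> Q \<Longrightarrow> inP \<Sigma> a \<Longrightarrow> step q a \<in> Q"
    and inv: "\<And>q. q \<in> Q \<Longrightarrow> invariant \<Sigma> (step q)"
    and inv': "\<And>q. invariant \<Sigma> (out q)"
  shows "computes_info \<Sigma> UNIV (omealy step out q0)"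
proof -
  have st: "computes_info \<Sigma> UNIV (states step q0)"
    using closed inv by (rule computes_info_states[OF Q])
  obtain P d G where g: "cprime \<Sigma> P G" "invariant P d"
    "\<And>w. w \<in> lists (pset \<Sigma>) \<Longrightarrow> map d (G w) = states step q0 w"
    by (rule computes_info_UNIV_E[OF st], rule that)
  have "map (\<lambda>v. out (d (vfst v)) (vsnd v)) (map2 Pr (G w) w) = omealy step out q0 w"
    if "w \<in> lists (pset \<Sigma>)" for w
    unfolding omealy_states g(3)[OF that, symmetric]
    by (simp add: zip_map1 case_prod_beta comp_def)
  moreover have "invariant (PProd P \<Sigma>) (\<lambda>v. out (d (vfst v)) (vsnd v))"
    using g(2) inv' by (auto simp: invariant_def)
  ultimately show ?thesis
    unfolding computes_info_def using cprime_pair[OF g(1) cprime_id] by blast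
qed

lemma cprime_omealy:
  assumes Q: "finite Q" "q0 \<in> Q"
    and closed: "\<And>q a. q \<in> Q \<Longrightarrow> inP \<Sigma> a \<Longrightarrow> step q a \<in> Q"
    and inv: "\<And>q. q \<in> Q \<Longrightarrow> invariant \<Sigma> (step q)"
    and out: "\<And>q. q \<in> Q \<Longrightarrow> equivariant \<Sigma> \<Gamma> (out q)"
  shows "cprime \<Sigma> \<Gamma> (omealy step out q0)"
proof -
  have st: "computes_info \<Sigma> UNIV (states step q0)"
    using closed inv by (rule computes_info_states[OF Q])
  obtain P d G where g: "cprime \<Sigma> P G" "invariant P d"
    "\<And>w. w \<in> lists (pset \<Sigma>) \<Longrightarrow> map d (G w) = states step q0 w"
    by (rule computes_info_UNIV_E[OF st], rule that)
  \<comment> \<open>Elements of \<open>P\<close> that arise from no word may decode outside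
    \<open>Q\<close>, where \<open>out\<close> is not known to be equivariant; \<open>q0\<close>
    replaces such states.\<close>
  define h where "h v = out (if d (vfst v) \<in> Q then d (vfst v) else q0) (vsnd v)" for v
  have inQ: "set (states step q w) \<subseteq> Q" if "w \<in> lists (pset \<Sigma>)" "q \<in> Q" for q w
    using that by (induction w arbitrary: q) (auto simp: pset_def closed)
  have "equivariant (PProd P \<Sigma>) \<Gamma> h"
    using g(2) out Q(2) by (auto simp: equivariant_def h_def invariant_def)
  then have "cprime \<Sigma> \<Gamma> (\<lambda>w. map2 (\<lambda>x y. h (Pr x y)) (G w) w)"
    by (rule cprime_pair_map[OF g(1) cprime_id])
  then show ?thesis
  proof (rule cprime_cong)
    fix w assume w: "w \<in> lists (pset \<Sigma>)"
    have "map2 (\<lambda>x y. h (Pr x y)) (G w) w = map2 (\<lambda>q a. out (if q \<in> Q then q else q0) a) (map d (G w)) w"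
      by (simp add: zip_map1 case_prod_beta comp_def h_def)
    also have "\<dots> = omealy step out q0 w"
      unfolding omealy_states g(3)[OF w] using inQ[OF w Q(2)]
      by (auto dest: set_zip_leftD)
    finally show "map2 (\<lambda>x y. h (Pr x y)) (G w) w = omealy step out q0 w" .
  qed
qed

lemma computes_info_after:
  assumes "cprime \<Sigma> \<Delta> G" "computes_info \<Delta> W F"
  shows "computes_info \<Sigma> {w. G w \<in> W} (\<lambda>w. F (G w))"
proof -
  obtain P d H where "cprime \<Delta> P H" "invariant P d"
    "\<And>w. w \<in> lists (pset \<Delta>) \<Longrightarrow> w \<in> W \<Longrightarrow> map d (H w) = F w"
    by (rule computes_infoE[OF assms(2)], rule that)
  then show ?thesis
    unfolding computes_info_def using cprime_preserves[OF assms(1)]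
    by (intro exI[of _ P] exI[of _ d] exI[of _ "\<lambda>w. H (G w)"]) (auto intro: cprime_comp[OF assms(1)])
qed

lemma computes_info_cong:
  assumes "computes_info \<Sigma> W F" "W' \<subseteq> W" "\<And>w. w \<in> lists (pset \<Sigma>) \<Longrightarrow> w \<in> W' \<Longrightarrow> F w = G w"
  shows "computes_info \<Sigma> W' G"
proof -
  obtain P d H where H: "cprime \<Sigma> P H" "invariant P d"
    "\<And>w. w \<in> lists (pset \<Sigma>) \<Longrightarrow> w \<in> W \<Longrightarrow> map d (H w) = F w"
    by (rule computes_infoE[OF assms(1)], rule that)
  have "\<forall>w \<in> lists (pset \<Sigma>) \<inter> W'. map d (H w) = G w"
    using H(3) assms(2,3) by (metis IntD1 IntD2 subsetD)
  then show ?thesis unfolding computes_info_def using H by blast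
qed

section \<open>Propagation of orbit-finite values\<close>

text \<open>Propagation as a machine with an unbounded state space: \<open>st\<close> is the value
  still available. A \<open>down\<close> empties it, since only \<open>eps\<close> may stand between
  a source and its use.\<close>

definition pstep :: "aval \<Rightarrow> aval \<Rightarrow> aval" where
  "pstep st a = (if a = down then Defs.bot else if a = eps then st else a)"

definition pout :: "aval \<Rightarrow> aval \<Rightarrow> aval" where
  "pout st a = (if a = down then st else Defs.bot)"

abbreviation propagate :: "aval \<Rightarrow> aval list \<Rightarrow> aval list" where
  "propagate \<equiv> omealy pstep pout"

definition propP :: "poly \<Rightarrow> poly" where
  "propP S = PSum S (PSum PUnit PUnit)"

definition optP :: "poly \<Rightarrow> poly" where
  "optP S = PSum S PUnit"

lemma down_simps [simp]: "down \<noteq> eps" "eps \<noteq> down" "VL x \<noteq> down" "VL x \<noteq> eps" "VL x \<noteq> Defs.bot"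
  "down \<noteq> VL x" "eps \<noteq> VL x" "Defs.bot \<noteq> VL x"
  by (auto simp: down_def eps_def bot_def)

lemma act_special [simp]: "act \<pi> down = down" "act \<pi> eps = eps" "act \<pi> Defs.bot = Defs.bot"
  by (auto simp: down_def eps_def bot_def)

lemma act_eq_special [simp]: "act \<pi> v = down \<longleftrightarrow> v = down" "act \<pi> v = eps \<longleftrightarrow> v = eps"
  "act \<pi> v = Defs.bot \<longleftrightarrow> v = Defs.bot"
proof -
  have u: "act \<pi> x = Unt \<longleftrightarrow> x = Unt" for x by (cases x) auto
  have r: "act \<pi> x = VR y \<longleftrightarrow> (\<exists>z. x = VR z \<and> act \<pi> z = y)" for x y by (cases x) auto
  have l: "act \<pi> x = VL y \<longleftrightarrow> (\<exists>z. x = VL z \<and> act \<pi> z = y)" for x y by (cases x) auto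
  show "act \<pi> v = down \<longleftrightarrow> v = down" "act \<pi> v = eps \<longleftrightarrow> v = eps" "act \<pi> v = Defs.bot \<longleftrightarrow> v = Defs.bot"
    by (auto simp: down_def eps_def bot_def u r l)
qed

lemma inP_propP: "inP (propP S) v \<longleftrightarrow> (\<exists>x. v = VL x \<and> inP S x) \<or> v = eps \<or> v = down"
  by (auto simp: propP_def eps_def down_def)

lemma inP_optP: "inP (optP S) v \<longleftrightarrow> (\<exists>x. v = VL x \<and> inP S x) \<or> v = Defs.bot"
  by (auto simp: optP_def bot_def)

lemma length_omealy [simp]: "length (omealy step out q w) = length w"
  by (induction w arbitrary: q) auto

lemma omealy_nth:
  "i < length w \<Longrightarrow> omealy step out q w ! i = out (foldl step q (take i w)) (w ! i)"
  by (induction w arbitrary: q i) (auto simp: nth_Cons split: nat.split)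

text \<open>The state before position \<open>i\<close> is the atom found by walking back from
  \<open>i\<close> over \<open>eps\<close> letters, and \<open>bot\<close> if the walk meets a
  \<open>down\<close> or the beginning of the word.\<close>

lemma atom_propagation_eq_prop:
  assumes "w \<in> lists (pset PPropIn)"
  shows "atom_propagation w = propagate Defs.bot w"
proof (rule nth_equalityI)
  show "length (atom_propagation w) = length (propagate Defs.bot w)" by (simp add: atom_propagation_def)
  fix i assume "i < length (atom_propagation w)"
  then have i: "i < length w" by (simp add: atom_propagation_def)
  define S where "S j = foldl pstep Defs.bot (take j w)" for j
  define R where "R i j a \<longleftrightarrow> j < i \<and> w ! j = VL (Atm a) \<and> (\<forall>k. j < k \<and> k < i \<longrightarrow> w ! k = eps)" for i j a
  have SS: "S (Suc j) = pstep (S j) (w ! j)" if "j < length w" for j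
    using that by (simp add: S_def take_Suc_conv_app_nth)
  have inv: "i \<le> length w \<Longrightarrow> (S i = Defs.bot \<and> (\<forall>j a. \<not> R i j a)) \<or> (\<exists>j a. R i j a \<and> S i = w ! j)" for i
  proof (induction i)
    case 0 show ?case by (simp add: S_def R_def)
  next
    case (Suc i)
    have "w ! i \<in> pset PPropIn" using assms Suc.prems by (auto simp: Suc_le_eq)
    then consider "w ! i = eps" | "w ! i = down" | a where "w ! i = VL (Atm a)"
      by (auto simp: pset_def PPropIn_def eps_def down_def)
    then show ?case
    proof cases
      case 1
      then have "R (Suc i) j a \<longleftrightarrow> R i j a" for j a by (auto simp: R_def less_Suc_eq)
      then show ?thesis using Suc SS[of i] 1 by (auto simp: pstep_def)
    next
      case 2
      then have "\<not> R (Suc i) j a" for j a by (auto simp: R_def less_Suc_eq)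
      then show ?thesis using Suc SS[of i] 2 by (auto simp: pstep_def)
    next
      case 3
      then have "R (Suc i) i a" by (auto simp: R_def)
      moreover have "S (Suc i) = w ! i" using Suc SS[of i] 3 by (auto simp: pstep_def)
      ultimately show ?thesis by blast
    qed
  qed
  \<comment> \<open>Only \<open>eps\<close> stands between \<open>j\<close> and \<open>i\<close>, so
    no later position before \<open>i\<close> holds an atom.\<close>
  have gr: "(GREATEST j. j < i \<and> (\<exists>a. w ! j = VL (Atm a))) = j" if "R i j a" for j a
  proof (rule Greatest_equality)
    fix y assume y: "y < i \<and> (\<exists>a. w ! y = VL (Atm a))"
    show "y \<le> j"
    proof (rule ccontr)
      assume "\<not> y \<le> j"
      then have "w ! y = eps" using that y by (auto simp: R_def)
      then show False using y by auto
    qed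
  qed (use that in \<open>auto simp: R_def\<close>)
  have "propagate Defs.bot w ! i = pout (S i) (w ! i)" using i by (simp add: omealy_nth S_def)
  moreover have "atom_propagation w ! i =
    (if w ! i = down \<and> (\<exists>j a. R i j a) then w ! (GREATEST j. j < i \<and> (\<exists>a. w ! j = VL (Atm a))) else Defs.bot)"
    using i unfolding atom_propagation_def R_def by (subst nth_map) auto
  ultimately show "atom_propagation w ! i = propagate Defs.bot w ! i"
    using inv[of i] i gr by (auto simp: pout_def)
qed

definition on_VL :: "(aval \<Rightarrow> aval) \<Rightarrow> aval \<Rightarrow> aval" where
  "on_VL f v = (case v of VL x \<Rightarrow> f x | _ \<Rightarrow> v)"

lemma on_VL_simps [simp]: "on_VL f (VL x) = f x" "on_VL f eps = eps" "on_VL f down = down"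
  "on_VL f Defs.bot = Defs.bot"
  by (auto simp: on_VL_def eps_def down_def bot_def)

lemma equivariant_on_VL:
  assumes "\<And>x. inP S x \<Longrightarrow> inP (propP T) (f x)"
    and "\<And>\<pi> x. bij \<pi> \<Longrightarrow> inP S x \<Longrightarrow> f (act \<pi> x) = act \<pi> (f x)"
  shows "equivariant (propP S) (propP T) (on_VL f)"
proof -
  have "inP (propP T) (on_VL f v) \<and> (bij \<pi> \<longrightarrow> on_VL f (act \<pi> v) = act \<pi> (on_VL f v))"
    if "inP (propP S) v" for v \<pi>
    using that[unfolded inP_propP] assms by (auto simp: inP_propP[of T eps] inP_propP[of T down])
  then show ?thesis by (simp add: equivariant_def)
qed

lemma cprime_prop_on_VL:
  assumes "cprime (propP T) (optP T) (propagate Defs.bot)"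
    and "\<And>x. inP S x \<Longrightarrow> inP (propP T) (f x)"
    and "\<And>\<pi> x. bij \<pi> \<Longrightarrow> inP S x \<Longrightarrow> f (act \<pi> x) = act \<pi> (f x)"
  shows "cprime (propP S) (optP T) (\<lambda>w. propagate Defs.bot (map (on_VL f) w))"
  using cprime_comp[OF cprime_map[OF equivariant_on_VL] assms(1)] assms(2,3) by blast

fun zip_opt :: "aval \<Rightarrow> aval" where
  "zip_opt (Pr (VL x) (VL y)) = VL (Pr x y)"
| "zip_opt _ = Defs.bot"

text \<open>Both components travel under the same commands, so they arrive together or not at all,
  and zipping restores the pair.\<close>

lemma cprime_prop_prod:
  assumes "cprime (propP S) (optP S) (propagate Defs.bot)" "cprime (propP T) (optP T) (propagate Defs.bot)"
  shows "cprime (propP (PProd S T)) (optP (PProd S T)) (propagate Defs.bot)"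
proof -
  let ?f = "\<lambda>p. VL (vfst p)" and ?g = "\<lambda>p. VL (vsnd p)"
  have f: "cprime (propP (PProd S T)) (optP S) (\<lambda>w. propagate Defs.bot (map (on_VL ?f) w))"
    by (rule cprime_prop_on_VL[OF assms(1)]) (auto simp: inP_propP)
  have g: "cprime (propP (PProd S T)) (optP T) (\<lambda>w. propagate Defs.bot (map (on_VL ?g) w))"
    by (rule cprime_prop_on_VL[OF assms(2)]) (auto simp: inP_propP)
  have h: "equivariant (PProd (optP S) (optP T)) (optP (PProd S T)) zip_opt"
    by (auto simp: equivariant_def inP_optP bot_def)
  show ?thesis
  proof (rule cprime_cong[OF cprime_pair_map[OF f g h]])
    fix w assume "w \<in> lists (pset (propP (PProd S T)))"
    moreover have "map2 (\<lambda>x y. zip_opt (Pr x y)) (propagate (on_VL ?f st) (map (on_VL ?f) w)) (propagate (on_VL ?g st) (map (on_VL ?g) w))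
      = propagate st w" if "w \<in> lists (pset (propP (PProd S T)))" "inP (optP (PProd S T)) st" for st w
      using that(2,1)
    proof (induction w arbitrary: st)
      case (Cons a w)
      have a: "inP (propP (PProd S T)) a" "w \<in> lists (pset (propP (PProd S T)))"
        using Cons.prems by (auto simp: pset_def)
      have st: "inP (optP (PProd S T)) (pstep st a)"
        using a Cons.prems by (auto simp: inP_optP inP_propP pstep_def)
      have 1: "pstep (on_VL ?f st) (on_VL ?f a) = on_VL ?f (pstep st a)"
        "pstep (on_VL ?g st) (on_VL ?g a) = on_VL ?g (pstep st a)"
        using a Cons.prems by (auto simp: inP_optP inP_propP pstep_def)
      have 2: "zip_opt (Pr (pout (on_VL ?f st) (on_VL ?f a)) (pout (on_VL ?g st) (on_VL ?g a))) = pout st a"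
        using a Cons.prems by (auto simp: inP_optP inP_propP pout_def) (auto simp: bot_def)
      show ?case using Cons.IH[OF st a(2)] by (simp add: 1 2)
    qed simp
    ultimately show "map2 (\<lambda>x y. zip_opt (Pr x y)) (propagate Defs.bot (map (on_VL ?f) w)) (propagate Defs.bot (map (on_VL ?g) w))
      = propagate Defs.bot w" by (force simp: inP_optP)
  qed
qed

text \<open>A value of the other summand must erase what this channel holds, and \<open>down\<close>
  does so. The value released by this artificial \<open>down\<close> is discarded by
  \<open>sum_opt\<close>, which also sees the original letter.\<close>

fun sum_fst :: "aval \<Rightarrow> aval" where
  "sum_fst (VL x) = VL x"
| "sum_fst _ = down"

fun sum_snd :: "aval \<Rightarrow> aval" where
  "sum_snd (VR x) = VL x"
| "sum_snd _ = down"

fun sum_opt :: "aval \<Rightarrow> aval" where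
  "sum_opt (Pr (Pr (VL x) _) (VR (VR _))) = VL (VL x)"
| "sum_opt (Pr (Pr _ (VL y)) (VR (VR _))) = VL (VR y)"
| "sum_opt _ = Defs.bot"

lemma sum_opt_simps [simp]:
  "sum_opt (Pr (Pr (VL x) z) down) = VL (VL x)"
  "sum_opt (Pr (Pr Defs.bot (VL y)) down) = VL (VR y)"
  "sum_opt (Pr (Pr Defs.bot Defs.bot) down) = Defs.bot"
  "sum_opt (Pr p (VL z)) = Defs.bot"
  "sum_opt (Pr p eps) = Defs.bot"
  by (auto simp: down_def bot_def eps_def elim: sum_opt.elims)

lemma cprime_prop_sum:
  assumes "cprime (propP S) (optP S) (propagate Defs.bot)" "cprime (propP T) (optP T) (propagate Defs.bot)"
  shows "cprime (propP (PSum S T)) (optP (PSum S T)) (propagate Defs.bot)"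
proof -
  let ?U = "propP (PSum S T)"
  have f: "cprime ?U (optP S) (\<lambda>w. propagate Defs.bot (map (on_VL sum_fst) w))"
    by (rule cprime_prop_on_VL[OF assms(1)]) (auto simp: inP_propP)
  have g: "cprime ?U (optP T) (\<lambda>w. propagate Defs.bot (map (on_VL sum_snd) w))"
    by (rule cprime_prop_on_VL[OF assms(2)]) (auto simp: inP_propP)
  have "inP (optP (PSum S T)) (sum_opt (Pr (Pr x y) a)) \<and>
      sum_opt (act \<pi> (Pr (Pr x y) a)) = act \<pi> (sum_opt (Pr (Pr x y) a))"
    if "inP (optP S) x" "inP (optP T) y" "inP ?U a" for x y a \<pi>
    using that unfolding inP_optP inP_propP by auto
  then have h: "equivariant (PProd (PProd (optP S) (optP T)) ?U) (optP (PSum S T)) sum_opt"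
    unfolding equivariant_def by (auto simp del: act.simps)
  \<comment> \<open>\<open>s1\<close> and \<open>s2\<close> are the contents of the two channels
    expressed by the common state; at most one of them is filled.\<close>
  define s1 where "s1 st = (case st of VL (VL x) \<Rightarrow> VL x | _ \<Rightarrow> Defs.bot)" for st
  define s2 where "s2 st = (case st of VL (VR x) \<Rightarrow> VL x | _ \<Rightarrow> Defs.bot)" for st
  have s: "s1 (VL (VL x)) = VL x" "s1 (VL (VR x)) = Defs.bot" "s1 Defs.bot = Defs.bot"
    "s2 (VL (VR x)) = VL x" "s2 (VL (VL x)) = Defs.bot" "s2 Defs.bot = Defs.bot" for x
    by (auto simp: s1_def s2_def bot_def)
  show ?thesis
  proof (rule cprime_cong[OF cprime_pair_map[OF cprime_pair[OF f g] cprime_id h]])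
    fix w assume w: "w \<in> lists (pset ?U)"
    have "map2 (\<lambda>x y. sum_opt (Pr x y)) (map2 Pr (propagate (s1 st) (map (on_VL sum_fst) w)) (propagate (s2 st) (map (on_VL sum_snd) w))) w
      = propagate st w" if "w \<in> lists (pset ?U)" "inP (optP (PSum S T)) st" for st w
      using that(2,1)
    proof (induction w arbitrary: st)
      case (Cons a w)
      have a: "inP ?U a" "w \<in> lists (pset ?U)"
        using Cons.prems by (auto simp: pset_def)
      have st: "inP (optP (PSum S T)) (pstep st a)"
        using a Cons.prems by (auto simp: inP_optP inP_propP pstep_def)
      have 1: "pstep (s1 st) (on_VL sum_fst a) = s1 (pstep st a)"
        "pstep (s2 st) (on_VL sum_snd a) = s2 (pstep st a)"
        using a Cons.prems by (auto simp: inP_optP inP_propP pstep_def s)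
      have 2: "sum_opt (Pr (Pr (pout (s1 st) (on_VL sum_fst a)) (pout (s2 st) (on_VL sum_snd a))) a) = pout st a"
        using a Cons.prems by (auto simp: inP_optP inP_propP pout_def s)
      show ?case using Cons.IH[OF st a(2)] by (simp add: 1 2)
    qed simp
    from this[OF w, of Defs.bot]
    show "map2 (\<lambda>x y. sum_opt (Pr x y)) (map2 Pr (propagate Defs.bot (map (on_VL sum_fst) w)) (propagate Defs.bot (map (on_VL sum_snd) w))) w
      = propagate Defs.bot w" by (simp add: s inP_optP)
  qed
qed

text \<open>Only \<open>PAtoms\<close> appeals to the prime itself. Over \<open>PUnit\<close> the
  state takes two values, so a finite-state machine suffices.\<close>

lemma cprime_prop: "cprime (propP S) (optP S) (propagate Defs.bot)"
proof (induction S)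
  case PAtoms
  have "cprime PPropIn PAtomBot (propagate Defs.bot)"
    using cprime_of_comp_primes[OF comp_primes.propagation] atom_propagation_eq_prop
    by (rule cprime_cong)
  then show ?case by (simp add: PPropIn_def PAtomBot_def propP_def optP_def)
next
  case PUnit
  have "invariant (propP PUnit) (pstep q)" "inP (optP PUnit) q \<Longrightarrow> equivariant (propP PUnit) (optP PUnit) (pout q)" for q
    by (auto simp: invariant_def inP_propP equivariant_def inP_optP pout_def)
  then show ?case
    by (intro cprime_omealy[of "{Defs.bot, VL Unt}"]) (auto simp: inP_propP inP_optP, auto simp: pstep_def)
next
  case (PProd S T) then show ?case by (rule cprime_prop_prod)
next
  case (PSum S T) then show ?case by (rule cprime_prop_sum)
qed

section \<open>Single-use registers with known control\<close>

fun reg_run :: "(aval \<Rightarrow> bool) \<Rightarrow> (aval \<Rightarrow> aval) \<Rightarrow> aval \<Rightarrow> aval list \<Rightarrow> aval list" where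
  "reg_run rd wr st [] = []"
| "reg_run rd wr st (a # w) = (if rd a then st else Defs.bot) #
     reg_run rd wr (if wr a \<noteq> Defs.bot then wr a else if rd a then Defs.bot else st) w"

text \<open>Propagation cannot read and write at the same position, so consecutive writes alternate
  between two channels.\<close>

lemma cprime_reg_run:
  assumes rd: "invariant \<Sigma> rd" and wr: "equivariant \<Sigma> (optP S) wr"
  shows "cprime \<Sigma> (optP S) (reg_run rd wr Defs.bot)"
proof -
  \<comment> \<open>\<open>p\<close> is the channel with the current content. A write goes to the
    other channel and switches. A value left unread on the old channel stays there, but that channel
    becomes current again only through a write that replaces it; hence the contents
    \<open>x\<close>, \<open>y\<close> in the induction below may be arbitrary.\<close>
  define step where "step p a = (if wr a \<noteq> Defs.bot then \<not> p else p)" for p a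
  define cmd where "cmd c p a = (if wr a \<noteq> Defs.bot \<and> p \<noteq> c then wr a else if rd a \<and> p = c then down else eps)"
    for c p :: bool and a
  have ch: "cprime \<Sigma> (optP S) (\<lambda>w. propagate Defs.bot (omealy step (cmd c) True w))" for c
  proof (rule cprime_comp[OF cprime_omealy cprime_prop])
    show "finite (UNIV :: bool set)" by simp
    show "invariant \<Sigma> (step q)" for q
      using wr by (auto simp: invariant_def step_def equivariant_def)
    show "equivariant \<Sigma> (propP S) (cmd c q)" for q
      using wr rd by (auto simp: equivariant_def invariant_def cmd_def inP_propP inP_optP)
  qed auto
  define comb where "comb v = (case v of Pr x y \<Rightarrow> if x = Defs.bot then y else x | _ \<Rightarrow> Defs.bot)" for v
  have comb: "equivariant (PProd (optP S) (optP S)) (optP S) comb"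
    by (auto simp: equivariant_def comb_def)
  have "map2 (\<lambda>x y. comb (Pr x y)) (propagate x (omealy step (cmd True) p w)) (propagate y (omealy step (cmd False) p w))
      = reg_run rd wr (if p then x else y) w" if "w \<in> lists (pset \<Sigma>)" for x y p w
    using that
  proof (induction w arbitrary: x y p rule: list.induct)
    case (Cons a w)
    have "inP (optP S) (wr a)" "w \<in> lists (pset \<Sigma>)" using Cons.prems wr by (auto simp: equivariant_def pset_def)
    then show ?case using Cons.IH
      by (cases p) (auto simp: inP_optP pstep_def pout_def step_def cmd_def comb_def)
  qed simp
  from this[of _ Defs.bot True Defs.bot] show ?thesis
    by (intro cprime_cong[OF cprime_pair_map[OF ch ch comb]]) simp
qed

fun tupP :: "poly \<Rightarrow> nat \<Rightarrow> poly" where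
  "tupP S 0 = PUnit"
| "tupP S (Suc n) = PProd (tupP S n) S"

fun tup :: "nat \<Rightarrow> (nat \<Rightarrow> aval) \<Rightarrow> aval" where
  "tup 0 f = Unt"
| "tup (Suc n) f = Pr (tup n f) (f n)"

fun proj :: "nat \<Rightarrow> aval \<Rightarrow> nat \<Rightarrow> aval" where
  "proj 0 v r = Defs.bot"
| "proj (Suc n) v r = (if r = n then vsnd v else proj n (vfst v) r)"

lemma proj_tup: "r < n \<Longrightarrow> proj n (tup n f) r = f r"
  by (induction n) auto

lemma inP_tup: "(\<And>r. r < n \<Longrightarrow> inP S (f r)) \<Longrightarrow> inP (tupP S n) (tup n f)"
  by (induction n) auto

lemma proj_act: "inP (tupP S n) v \<Longrightarrow> proj n (act \<pi> v) r = act \<pi> (proj n v r)"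
  by (induction n arbitrary: v) auto

definition reg_next :: "(nat \<Rightarrow> aval \<Rightarrow> bool) \<Rightarrow> (nat \<Rightarrow> aval \<Rightarrow> aval) \<Rightarrow> aval \<Rightarrow> (nat \<Rightarrow> aval) \<Rightarrow> nat \<Rightarrow> aval" where
  "reg_next rd wr a st r = (if wr r a \<noteq> Defs.bot then wr r a else if rd r a then Defs.bot else st r)"

definition reg_read :: "(nat \<Rightarrow> aval \<Rightarrow> bool) \<Rightarrow> aval \<Rightarrow> (nat \<Rightarrow> aval) \<Rightarrow> nat \<Rightarrow> aval" where
  "reg_read rd a st r = (if rd r a then st r else Defs.bot)"

fun regs_run :: "(nat \<Rightarrow> aval \<Rightarrow> bool) \<Rightarrow> (nat \<Rightarrow> aval \<Rightarrow> aval) \<Rightarrow> (aval \<Rightarrow> (nat \<Rightarrow> aval) \<Rightarrow> 'x) \<Rightarrow>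
    (nat \<Rightarrow> aval) \<Rightarrow> aval list \<Rightarrow> 'x list" where
  "regs_run rd wr out st [] = []"
| "regs_run rd wr out st (a # w) = out a (reg_read rd a st) # regs_run rd wr out (reg_next rd wr a st) w"

text \<open>Registers do not interact, so they run in parallel, one more in each induction step; the
  output is then a letterwise function of the tuple of released values and the letter.
  \<open>cong\<close> lets \<open>out\<close> be applied to the decoded tuple, which agrees with the
  true function only below \<open>n\<close>.\<close>

lemma cprime_regs_run:
  assumes rd: "\<And>r. r < n \<Longrightarrow> invariant \<Sigma> (rd r)"
    and wr: "\<And>r. r < n \<Longrightarrow> equivariant \<Sigma> PAtomBot (wr r)"
    and out: "equivariant (PProd (tupP PAtomBot n) \<Sigma>) \<Gamma> (\<lambda>v. out (vsnd v) (proj n (vfst v)))"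
    and cong: "\<And>a f g. (\<And>r. r < n \<Longrightarrow> f r = g r) \<Longrightarrow> out a f = out a g"
  shows "cprime \<Sigma> \<Gamma> (regs_run rd wr out (\<lambda>_. Defs.bot))"
proof -
  have sw: "PAtomBot = optP PAtoms" by (simp add: PAtomBot_def optP_def)
  have tup: "cprime \<Sigma> (tupP PAtomBot m) (regs_run rd wr (\<lambda>_. tup m) (\<lambda>_. Defs.bot))" if "m \<le> n" for m
    using that
  proof (induction m)
    case 0
    have "map (\<lambda>_. Unt) w = regs_run rd wr (\<lambda>_. tup 0) st w" for st w
      by (induction w arbitrary: st) auto
    moreover have "equivariant \<Sigma> PUnit (\<lambda>_. Unt)" by (auto simp: equivariant_def)
    ultimately show ?case
      by (intro cprime_cong[OF cprime_map[of \<Sigma> "tupP PAtomBot 0" "\<lambda>_. Unt"]]) (simp, blast)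
  next
    case (Suc m)
    have r: "cprime \<Sigma> PAtomBot (reg_run (rd m) (wr m) Defs.bot)"
      using cprime_reg_run[of \<Sigma> "rd m" PAtoms "wr m"] rd[of m] wr[of m] Suc.prems by (simp add: sw)
    have "map2 Pr (regs_run rd wr (\<lambda>_. tup m) st w) (reg_run (rd m) (wr m) (st m) w) = regs_run rd wr (\<lambda>_. tup (Suc m)) st w" for st w
    proof (induction w arbitrary: st)
      case (Cons a w)
      show ?case using Cons.IH[of "reg_next rd wr a st"] reg_next_def[of rd wr a st m]
        by (simp add: reg_read_def)
    qed simp
    from this[of "\<lambda>_. Defs.bot"] show ?case using cprime_pair[OF Suc.IH r] Suc.prems
      by (simp del: tup.simps)
  qed
  have "map2 (\<lambda>v a. out a (proj n v)) (regs_run rd wr (\<lambda>_. tup n) st w) w = regs_run rd wr out st w" for st w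
  proof (induction w arbitrary: st)
    case (Cons a w)
    show ?case using Cons by (auto intro!: cong simp: proj_tup)
  qed simp
  then show ?thesis using cprime_pair_map[OF tup[OF order_refl] cprime_id out] by simp
qed

section \<open>Decision trees over single-use registers\<close>

text \<open>A constant \<open>C c\<close> is an atom of the letter; in a reduced system the letter
  also contains the previous breaking letter.\<close>

datatype src = R nat | C nat

datatype (lvs: 'l) dtree = Leaf 'l | Test nat src "'l dtree" "'l dtree"

fun sval :: "src \<Rightarrow> regs \<Rightarrow> nat option" where
  "sval (R r) \<rho> = \<rho> r"
| "sval (C c) \<rho> = Some c"

fun sregs :: "src \<Rightarrow> nat set" where
  "sregs (R r) = {r}"
| "sregs (C c) = {}"

fun sact :: "(nat \<Rightarrow> nat) \<Rightarrow> src \<Rightarrow> src" where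
  "sact \<pi> (R r) = R r"
| "sact \<pi> (C c) = C (\<pi> c)"

fun eval_tree :: "'l dtree \<Rightarrow> regs \<Rightarrow> 'l" where
  "eval_tree (Leaf l) \<rho> = l"
| "eval_tree (Test r s t u) \<rho> = (if \<rho> r = sval s \<rho> then eval_tree t \<rho> else eval_tree u \<rho>)"

fun path_of :: "'l dtree \<Rightarrow> regs \<Rightarrow> bool list" where
  "path_of (Leaf l) \<rho> = []"
| "path_of (Test r s t u) \<rho> = (if \<rho> r = sval s \<rho> then True # path_of t \<rho> else False # path_of u \<rho>)"

text \<open>Paths that stop at an inner node are continued to the left, so that the function is total.\<close>

fun leaf_at :: "'l dtree \<Rightarrow> bool list \<Rightarrow> 'l" where
  "leaf_at (Leaf l) p = l"
| "leaf_at (Test r s t u) [] = leaf_at t []"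
| "leaf_at (Test r s t u) (b # p) = (if b then leaf_at t p else leaf_at u p)"

fun paths :: "'l dtree \<Rightarrow> bool list set" where
  "paths (Leaf l) = {[]}"
| "paths (Test r s t u) = Cons True ` paths t \<union> Cons False ` paths u"

fun tact :: "(nat \<Rightarrow> nat) \<Rightarrow> ('l \<Rightarrow> 'k) \<Rightarrow> 'l dtree \<Rightarrow> 'k dtree" where
  "tact \<pi> f (Leaf l) = Leaf (f l)"
| "tact \<pi> f (Test r s t u) = Test r (sact \<pi> s) (tact \<pi> f t) (tact \<pi> f u)"

fun map_path :: "(bool list \<Rightarrow> 'l \<Rightarrow> 'k) \<Rightarrow> 'l dtree \<Rightarrow> 'k dtree" where
  "map_path f (Leaf l) = Leaf (f [] l)"
| "map_path f (Test r s t u) = Test r s (map_path (\<lambda>p. f (True # p)) t) (map_path (\<lambda>p. f (False # p)) u)"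

lemma leaf_at_pth [simp]: "leaf_at t (path_of t \<rho>) = eval_tree t \<rho>"
  by (induction t) auto

lemma finite_paths [simp]: "finite (paths t)"
  by (induction t) auto

lemma leaf_at_in_lvs: "leaf_at t p \<in> lvs t"
  by (induction t p rule: leaf_at.induct) auto

lemma eval_tree_in_lvs: "eval_tree t \<rho> \<in> lvs t"
  by (induction t) auto

lemma eval_tree_map_path [simp]: "eval_tree (map_path f t) \<rho> = f (path_of t \<rho>) (eval_tree t \<rho>)"
  by (induction t arbitrary: f) auto

lemma lvs_map_path: "lvs (map_path f t) = (\<lambda>p. f p (leaf_at t p)) ` paths t"
  by (induction t arbitrary: f) (simp_all add: image_Un image_image)

lemma leaf_at_tact [simp]: "leaf_at (tact \<pi> f t) p = f (leaf_at t p)"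
  by (induction t p rule: leaf_at.induct) auto

lemma paths_tact [simp]: "paths (tact \<pi> f t) = paths t"
  by (induction t) auto

lemma tact_map_path:
  assumes "\<And>p l. h (g p l) = g' p (f l)"
  shows "tact \<pi> h (map_path g t) = map_path g' (tact \<pi> f t)"
  using assms by (induction t arbitrary: g g') auto

lemma tact_eq_Leaf: "tact \<pi> f t = Leaf l \<longleftrightarrow> (\<exists>l'. t = Leaf l' \<and> l = f l')"
  by (cases t) auto

text \<open>\<open>Base q\<close> stands for a control state. \<open>Ext n V p\<close> names a
  component of a reduced system by a component \<open>(n, V)\<close> of the system before reduction
  and a path \<open>p\<close> through the tree of the breaking letter there; repeated reduction
  nests these names.\<close>

datatype name = Base nat | Ext name "nat set" "bool list"

type_synonym comp = "name \<times> nat set"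

text \<open>At a leaf \<open>(n, K, m)\<close> the new component is named \<open>n\<close>; the registers in \<open>K\<close> keep their
  contents and those in \<open>dom m\<close> receive atoms of the letter.\<close>

type_synonym leaf = "name \<times> nat set \<times> (nat \<rightharpoonup> nat)"

definition ract :: "(nat \<Rightarrow> nat) \<Rightarrow> (nat \<rightharpoonup> nat) \<Rightarrow> (nat \<rightharpoonup> nat)" where
  "ract \<pi> m = map_option \<pi> \<circ> m"

fun lact :: "(nat \<Rightarrow> nat) \<Rightarrow> leaf \<Rightarrow> leaf" where
  "lact \<pi> (n, K, m) = (n, K, ract \<pi> m)"

fun leaf_comp :: "leaf \<Rightarrow> comp" where
  "leaf_comp (n, K, m) = (n, K \<union> dom m)"

lemma dom_ract [simp]: "dom (ract \<pi> m) = dom m"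
  by (auto simp: ract_def dom_def)

lemma ract_empty [simp]: "ract \<pi> Map.empty = Map.empty"
  by (auto simp: ract_def)

lemma ract_eq_empty [simp]: "ract \<pi> m = Map.empty \<longleftrightarrow> m = Map.empty"
  by (metis dom_eq_empty_conv dom_ract)

lemma leaf_comp_lact [simp]: "leaf_comp (lact \<pi> l) = leaf_comp l"
  by (cases l) auto

lemma lact_simps [simp]: "fst (lact \<pi> l) = fst l" "fst (snd (lact \<pi> l)) = fst (snd l)"
  "snd (snd (lact \<pi> l)) = ract \<pi> (snd (snd l))"
  by (cases l; auto)+

lemma lact_eq_empty [simp]: "(n, K, Map.empty) = lact \<pi> l \<longleftrightarrow> l = (n, K, Map.empty)"
  by (cases l) (auto simp: eq_commute[of Map.empty])

text \<open>The single-use condition: below a test the registers that it looked at are gone, so they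
  can be neither tested again nor kept.\<close>

fun tree_ok :: "nat set \<Rightarrow> leaf dtree \<Rightarrow> bool" where
  "tree_ok V (Leaf (n, K, m)) \<longleftrightarrow> K \<subseteq> V \<and> finite (dom m) \<and> K \<inter> dom m = {}"
| "tree_ok V (Test r s t u) \<longleftrightarrow> r \<in> V \<and> sregs s \<subseteq> V - {r} \<and> tree_ok (V - {r} - sregs s) t \<and> tree_ok (V - {r} - sregs s) u"

lemma tree_ok_mono: "tree_ok V t \<Longrightarrow> V \<subseteq> V' \<Longrightarrow> tree_ok V' t"
proof (induction V t arbitrary: V' rule: tree_ok.induct)
  case (2 V r s t u)
  have "V - {r} - sregs s \<subseteq> V' - {r} - sregs s" using 2 by auto
  then show ?case using 2 by auto
qed auto

lemma tree_ok_leaf: "tree_ok V t \<Longrightarrow> (n, K, m) \<in> lvs t \<Longrightarrow> K \<subseteq> V \<and> finite (dom m) \<and> K \<inter> dom m = {}"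
proof (induction V t rule: tree_ok.induct)
  case (2 V r s t u)
  then show ?case by auto
qed auto

lemma tree_ok_leaf_strict:
  assumes "tree_ok V (Test r s t u)" "l \<in> lvs (Test r s t u)"
  shows "fst (snd l) \<subset> V"
proof -
  obtain n K m where l: "l = (n, K, m)" by (cases l)
  have "(n, K, m) \<in> lvs t \<or> (n, K, m) \<in> lvs u" using assms l by auto
  then have "K \<subseteq> V - {r} - sregs s"
    using assms(1) by (metis tree_ok.simps(2) tree_ok_leaf)
  moreover have "r \<in> V" using assms by simp
  ultimately show ?thesis using l by auto
qed

lemma tree_ok_map_path:
  assumes "tree_ok V t" "\<And>p n K m. f p (n, K, m) = (g p, K, Map.empty)"
  shows "tree_ok V (map_path f t)"
  using assms by (induction V t arbitrary: f g rule: tree_ok.induct) auto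

lemma tree_ok_empty: "tree_ok {} t \<Longrightarrow> \<exists>n m. t = Leaf (n, {}, m)"
  by (cases t) (auto elim: tree_ok.elims)

text \<open>Partial evaluation when the contents of the registers in \<open>dom M\<close> are known:
  a test between known atoms disappears, a test with one known side becomes a test against a
  constant, and a known content that would be kept is written by the leaf instead.\<close>

fun subst :: "(nat \<rightharpoonup> nat) \<Rightarrow> leaf dtree \<Rightarrow> leaf dtree" where
  "subst M (Leaf (n, K, m)) = Leaf (n, K - dom M, (M |` K) ++ m)"
| "subst M (Test r s t u) =
    (case M r of
       None \<Rightarrow> Test r (case s of C c \<Rightarrow> C c | R r' \<Rightarrow> (case M r' of None \<Rightarrow> R r' | Some c \<Rightarrow> C c)) (subst M t) (subst M u)
     | Some c \<Rightarrow>
       (case s of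
          C c' \<Rightarrow> if c = c' then subst M t else subst M u
        | R r' \<Rightarrow> (case M r' of None \<Rightarrow> Test r' (C c) (subst M t) (subst M u)
                 | Some c' \<Rightarrow> if c = c' then subst M t else subst M u)))"

lemma eval_tree_subst: "eval_tree (subst M t) \<rho> = (case eval_tree t (\<rho> ++ M) of (n, K, m) \<Rightarrow> (n, K - dom M, (M |` K) ++ m))"
proof (induction t)
  case (Leaf l) then show ?case by (cases l) auto
next
  case (Test r s t u)
  then show ?case
    by (cases s) (auto split: option.splits simp: map_add_def)
qed

lemma subst_config: "\<rho> |` (K - dom M) ++ ((M |` K) ++ m) = (\<rho> ++ M) |` K ++ m"
  by (rule ext) (auto simp: map_add_def restrict_map_def split: option.splits)

lemma tree_ok_subst: "tree_ok V t \<Longrightarrow> finite (dom M) \<Longrightarrow> tree_ok (V - dom M) (subst M t)"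
proof (induction V t rule: tree_ok.induct)
  case (1 V n K m) then show ?case by auto
next
  case (2 V r s t u)
  have IH: "tree_ok (V - {r} - sregs s - dom M) (subst M t)" "tree_ok (V - {r} - sregs s - dom M) (subst M u)"
    using 2 by auto
  then have IH': "tree_ok V' (subst M t) \<and> tree_ok V' (subst M u)" if "V - {r} - sregs s - dom M \<subseteq> V'" for V'
    using tree_ok_mono that by blast
  show ?case using 2
    by (auto split: option.splits src.splits simp: domIff intro!: IH'[THEN conjunct1] IH'[THEN conjunct2])
qed

lemma leaf_comp_subst: "leaf_comp ` lvs (subst M t) \<subseteq> leaf_comp ` lvs t"
proof (induction t)
  case (Leaf l)
  obtain n K m where "l = (n, K, m)" by (cases l)
  moreover have "K - dom M \<union> dom ((M |` K) ++ m) = K \<union> dom m" by auto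
  ultimately show ?case by simp
next
  case (Test r s t u)
  then show ?case by (cases s) (auto split: option.splits)
qed

lemma subst_tact:
  assumes "inj \<pi>"
  shows "subst (ract \<pi> M) (tact \<pi> (lact \<pi>) t) = tact \<pi> (lact \<pi>) (subst M t)"
proof (induction t)
  case (Leaf l)
  obtain n K m where l: "l = (n, K, m)" by (cases l)
  have "(ract \<pi> M |` K) ++ ract \<pi> m = ract \<pi> ((M |` K) ++ m)"
    by (rule ext) (auto simp: ract_def map_add_def restrict_map_def split: option.splits)
  then show ?case by (simp add: l)
next
  case (Test r s t u)
  then show ?case using assms
    by (cases s) (auto split: option.splits simp: ract_def inj_eq)
qed

section \<open>Size of configuration spaces\<close>

definition dims :: "comp set \<Rightarrow> nat multiset" where
  "dims X = (\<Sum>c\<in>X. {#card (snd c)#})"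

text \<open>In the multiset order one element outweighs any number of smaller ones.\<close>

lemma sum_singletons_less:
  assumes "\<And>x. x \<in> A \<Longrightarrow> f x < (k::nat)"
  shows "(\<Sum>x\<in>A. {#f x#}) < {#k#}"
proof (rule ex_gt_imp_less_multiset)
  have "x < k" if "x \<in># (\<Sum>x\<in>A. {#f x#})" for x
    using that assms by (cases "finite A") (auto simp: set_mset_sum)
  then show "\<exists>y. y \<in># {#k#} \<and> (\<forall>x. x \<in># (\<Sum>x\<in>A. {#f x#}) \<longrightarrow> x < y)" by auto
qed

text \<open>A test removes its register from every leaf below it, and a tree without tests must drop
  a register here. So every piece into which the component splits has smaller dimension.\<close>

lemma leaf_sum_less:
  assumes "finite V" "tree_ok V t" "\<not> (\<exists>n m. t = Leaf (n, V, m))"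
  shows "(\<Sum>p\<in>paths t. {#card (fst (snd (leaf_at t p)))#}) < {#card V#}"
proof (rule sum_singletons_less)
  fix p assume "p \<in> paths t"
  have "fst (snd (leaf_at t p)) \<subset> V"
  proof (cases t)
    case (Leaf l)
    then obtain n K m where "l = (n, K, m)" by (cases l)
    then show ?thesis using Leaf assms by auto
  next
    case (Test r s t1 t2)
    then show ?thesis using tree_ok_leaf_strict[of V r s t1 t2] assms leaf_at_in_lvs[of t p] by blast
  qed
  then show "card (fst (snd (leaf_at t p))) < card V" using assms(1) by (rule psubset_card_mono[rotated])
qed

lemma leaf_sum_le:
  assumes "finite V" "tree_ok V t"
  shows "(\<Sum>p\<in>paths t. {#card (fst (snd (leaf_at t p)))#}) \<le> {#card V#}"
proof (cases "\<exists>n m. t = Leaf (n, V, m)")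
  case False then show ?thesis using leaf_sum_less[OF assms] by simp
qed auto

lemma dims_mono: "finite img_comps \<Longrightarrow> X \<subseteq> img_comps \<Longrightarrow> dims X \<le> dims img_comps"
  unfolding dims_def by (rule sum_mono2) auto

lemma dims_strict_mono: "finite img_comps \<Longrightarrow> X \<subset> img_comps \<Longrightarrow> dims X < dims img_comps"
  unfolding dims_def by (auto intro!: sum_strict_mono2)

text \<open>\<open>{#0#}\<close> is the measure of one component without registers; any further
  component or any register would exceed it.\<close>

lemma dims_le_zero:
  assumes "finite X" "c \<in> X" "finite (snd c)" "dims X \<le> {#0#}"
  shows "X = {c}" "snd c = {}"
proof -
  have "{#card (snd c)#} = dims {c}" by (simp add: dims_def)
  also have "\<dots> \<le> dims X" using assms by (intro dims_mono) auto
  also have "\<dots> \<le> {#0#}" by (rule assms(4))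
  finally have "\<not> {#0#} < {#card (snd c)#}" by (rule leD)
  then have "card (snd c) = 0" using ex_gt_imp_less_multiset[of "{#card (snd c)#}" "{#0#}"] by auto
  then show s: "snd c = {}" using assms by simp
  show "X = {c}"
  proof (rule ccontr)
    assume "X \<noteq> {c}"
    then have "dims {c} < dims X" using assms by (intro dims_strict_mono) auto
    moreover have "dims {c} = {#0#}" using s by (simp add: dims_def)
    ultimately show False using assms(4) by (metis leD)
  qed
qed

section \<open>Systems of decision trees\<close>

text \<open>Compositions of primes preserve length, so a subsequence of the input cannot be split
  off; the letters to be left out stay in place and are marked by \<open>skips\<close>. The
  component sets depend on the letter because after a reduction different letters come with
  different images, and the measure bounds each of these sets separately, not their union.\<close>

record sys =
  skips :: "aval \<Rightarrow> bool"
  dom_comps :: "aval \<Rightarrow> comp set"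
  cod_comps :: "aval \<Rightarrow> comp set"
  trees :: "aval \<Rightarrow> comp \<Rightarrow> leaf dtree"

text \<open>The bound on \<open>cod_comps\<close> serves letters that lose nothing: their image may
  be as large as the source and is then compared with the target.\<close>

definition good :: "nat multiset \<Rightarrow> sys \<Rightarrow> aval \<Rightarrow> bool" where
  "good m S a \<longleftrightarrow> finite (dom_comps S a) \<and> finite (cod_comps S a) \<and>
     (\<forall>c \<in> dom_comps S a. finite (snd c) \<and> tree_ok (snd c) (trees S a c) \<and> leaf_comp ` lvs (trees S a c) \<subseteq> cod_comps S a) \<and>
     dims (dom_comps S a) \<le> m \<and> dims (cod_comps S a) \<le> m"

definition sys_ok :: "poly \<Rightarrow> nat multiset \<Rightarrow> sys \<Rightarrow> bool" where
  "sys_ok \<Sigma> m S \<longleftrightarrow> invariant \<Sigma> (skips S) \<and> invariant \<Sigma> (dom_comps S) \<and> invariant \<Sigma> (cod_comps S) \<and>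
     (\<forall>a \<pi> c. inP \<Sigma> a \<longrightarrow> bij \<pi> \<longrightarrow> trees S (act \<pi> a) c = tact \<pi> (lact \<pi>) (trees S a c)) \<and>
     (\<forall>a. inP \<Sigma> a \<longrightarrow> \<not> skips S a \<longrightarrow> good m S a)"

text \<open>The atom-free part of a run. Together with the letter, an entry determines the leaf that
  was reached.\<close>

fun trace :: "sys \<Rightarrow> name \<Rightarrow> regs \<Rightarrow> aval list \<Rightarrow> (name \<times> nat set \<times> bool list) option list" where
  "trace S n \<rho> [] = []"
| "trace S n \<rho> (a # w) = (if skips S a then None # trace S n \<rho> w
     else Some (n, dom \<rho>, path_of (trees S a (n, dom \<rho>)) \<rho>) #
       (case eval_tree (trees S a (n, dom \<rho>)) \<rho> of (n', K, m) \<Rightarrow> trace S n' (\<rho> |` K ++ m) w))"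

fun inside :: "sys \<Rightarrow> name \<Rightarrow> regs \<Rightarrow> aval list \<Rightarrow> bool" where
  "inside S n \<rho> [] \<longleftrightarrow> True"
| "inside S n \<rho> (a # w) \<longleftrightarrow> (if skips S a then inside S n \<rho> w
     else (n, dom \<rho>) \<in> dom_comps S a \<and>
       (case eval_tree (trees S a (n, dom \<rho>)) \<rho> of (n', K, m) \<Rightarrow> inside S n' (\<rho> |` K ++ m) w))"

text \<open>With one component and no registers every tree is a leaf, so each letter determines its
  own trace entry.\<close>

lemma computes_info_trace_trivial:
  assumes sys: "sys_ok \<Sigma> m S" and m: "m \<le> {#0#}"
  shows "computes_info \<Sigma> {w. inside S n0 \<rho>0 w} (trace S n0 \<rho>0)"
proof -
  define d where "d a = (if skips S a then None else Some (case the_elem (dom_comps S a) of (n, V) \<Rightarrow> (n, V, [] :: bool list)))" for a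
  have inv: "invariant \<Sigma> d" using sys by (auto simp: sys_ok_def invariant_def d_def)
  have "map d w = trace S n \<rho> w" if "w \<in> lists (pset \<Sigma>)" "inside S n \<rho> w" for n \<rho> w
    using that(2,1)
  proof (induction w arbitrary: n \<rho>)
    case (Cons a w)
    have a: "inP \<Sigma> a" "w \<in> lists (pset \<Sigma>)" using Cons.prems by (auto simp: pset_def)
    show ?case
    proof (cases "skips S a")
      case True
      then show ?thesis using Cons a by (simp add: d_def)
    next
      case False
      then have g: "good m S a" using sys a by (simp add: sys_ok_def)
      have c: "(n, dom \<rho>) \<in> dom_comps S a" using Cons.prems False by simp
      have "dims (dom_comps S a) \<le> {#0#}" using g m unfolding good_def by (blast intro: order_trans)
      then have s: "dom_comps S a = {(n, dom \<rho>)}" "dom \<rho> = {}"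
        using dims_le_zero[of "dom_comps S a" "(n, dom \<rho>)"] c g by (auto simp: good_def)
      then obtain n' m' where t: "trees S a (n, dom \<rho>) = Leaf (n', {}, m')"
        using tree_ok_empty[of "trees S a (n, dom \<rho>)"] g by (auto simp: good_def)
      have "inside S n' (\<rho> |` {} ++ m') w" using Cons.prems False t by simp
      from Cons.IH[OF this a(2)] show ?thesis using False t s by (simp add: d_def)
    qed
  qed simp
  then show ?thesis unfolding computes_info_def using inv cprime_id by blast
qed

locale reduction =
  fixes \<Sigma> :: poly and m :: "nat multiset" and S :: sys and n0 :: name
  assumes sys: "sys_ok \<Sigma> m S"
begin

lemma skips_inv: "inP \<Sigma> a \<Longrightarrow> bij \<pi> \<Longrightarrow> skips S (act \<pi> a) = skips S a"
  and dom_comps_inv: "inP \<Sigma> a \<Longrightarrow> bij \<pi> \<Longrightarrow> dom_comps S (act \<pi> a) = dom_comps S a"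
  and cod_comps_inv: "inP \<Sigma> a \<Longrightarrow> bij \<pi> \<Longrightarrow> cod_comps S (act \<pi> a) = cod_comps S a"
  and trees_act: "inP \<Sigma> a \<Longrightarrow> bij \<pi> \<Longrightarrow> trees S (act \<pi> a) c = tact \<pi> (lact \<pi>) (trees S a c)"
  and goodD: "inP \<Sigma> a \<Longrightarrow> \<not> skips S a \<Longrightarrow> good m S a"
  using sys unfolding sys_ok_def invariant_def by blast+

section \<open>Unit letters, breaking letters and representatives of components\<close>

definition is_unit :: "aval \<Rightarrow> bool" where
  "is_unit a \<longleftrightarrow> (\<forall>c \<in> dom_comps S a. \<exists>n'. trees S a c = Leaf (n', snd c, Map.empty))"

definition breaks :: "aval \<Rightarrow> bool" where
  "breaks a \<longleftrightarrow> \<not> skips S a \<and> \<not> is_unit a"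

definition lossy :: "aval \<Rightarrow> bool" where
  "lossy a \<longleftrightarrow> (\<exists>c \<in> dom_comps S a. \<not> (\<exists>n' M. trees S a c = Leaf (n', snd c, M)))"

text \<open>Meant for letters that are not lossy: their trees are single leaves, reached by the path
  \<open>[]\<close>.\<close>

definition tgt :: "aval \<Rightarrow> comp \<Rightarrow> comp" where
  "tgt a c = leaf_comp (leaf_at (trees S a c) [])"

definition full :: "aval \<Rightarrow> comp \<Rightarrow> comp \<Rightarrow> bool" where
  "full a t c \<longleftrightarrow> c \<in> dom_comps S a \<and> tgt a c = t \<and> snd c = snd t"

text \<open>If some component already has all registers of the target, its image contains the images
  of the components that merely fill up the same target with atoms of \<open>a\<close>. One such
  component per target is then enough. The choice depends on the target alone, which makes
  \<open>rep a\<close> idempotent.\<close>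

definition rep :: "aval \<Rightarrow> comp \<Rightarrow> comp" where
  "rep a c = (if \<not> lossy a \<and> (\<exists>c'. full a (tgt a c) c') then SOME c'. full a (tgt a c) c' else c)"

lemma rep_full: "\<not> lossy a \<Longrightarrow> full a (tgt a c) c' \<Longrightarrow> rep a c = (SOME c'. full a (tgt a c) c')"
  by (cases c') (auto simp: rep_def)

definition keep :: "aval \<Rightarrow> comp \<Rightarrow> bool list \<Rightarrow> nat set" where
  "keep a c p = fst (snd (leaf_at (trees S a c) p))"

text \<open>The components needed to describe the configurations that are possible right after \<open>a\<close>,
  when the letter \<open>a\<close> itself is known.\<close>

definition img_comps :: "aval \<Rightarrow> comp set" where
  "img_comps a = (\<lambda>(c, p). (Ext (fst c) (snd c) p, keep a c p)) `
     (SIGMA c:{c \<in> dom_comps S a. rep a c = c}. paths (trees S a c))"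

lemma is_unit_inv: "inP \<Sigma> a \<Longrightarrow> bij \<pi> \<Longrightarrow> is_unit (act \<pi> a) = is_unit a"
  by (simp add: is_unit_def dom_comps_inv trees_act tact_eq_Leaf)

lemma breaks_inv: "inP \<Sigma> a \<Longrightarrow> bij \<pi> \<Longrightarrow> breaks (act \<pi> a) = breaks a"
  by (simp add: breaks_def is_unit_inv skips_inv)

lemma lossy_inv: "inP \<Sigma> a \<Longrightarrow> bij \<pi> \<Longrightarrow> lossy (act \<pi> a) = lossy a"
  by (simp add: lossy_def dom_comps_inv trees_act tact_eq_Leaf)

lemma tgt_inv: "inP \<Sigma> a \<Longrightarrow> bij \<pi> \<Longrightarrow> tgt (act \<pi> a) = tgt a"
  by (rule ext) (simp add: tgt_def trees_act)

lemma full_inv: "inP \<Sigma> a \<Longrightarrow> bij \<pi> \<Longrightarrow> full (act \<pi> a) = full a"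
  by (intro ext) (simp add: full_def tgt_inv dom_comps_inv)

lemma rep_inv: "inP \<Sigma> a \<Longrightarrow> bij \<pi> \<Longrightarrow> rep (act \<pi> a) = rep a"
  by (rule ext) (simp add: rep_def lossy_inv tgt_inv full_inv)

lemma img_comps_inv: "inP \<Sigma> a \<Longrightarrow> bij \<pi> \<Longrightarrow> img_comps (act \<pi> a) = img_comps a"
  by (simp add: img_comps_def keep_def rep_inv trees_act dom_comps_inv)

lemma non_lossy_leaf:
  assumes "\<not> lossy a" "c \<in> dom_comps S a"
  obtains n' M where "trees S a c = Leaf (n', snd c, M)" "tgt a c = (n', snd c \<union> dom M)"
  using assms by (auto simp: lossy_def tgt_def)

lemma rep_props:
  assumes "c \<in> dom_comps S a" "rep a c \<noteq> c"
  shows "\<not> lossy a" "full a (tgt a c) (rep a c)" "rep a (rep a c) = rep a c"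
proof -
  have *: "\<not> lossy a \<and> (\<exists>c'. full a (tgt a c) c')" using assms by (auto simp: rep_def split: if_splits)
  then have **: "rep a c = (SOME c'. full a (tgt a c) c')" by (simp add: rep_def)
  show "\<not> lossy a" using * by simp
  show f: "full a (tgt a c) (rep a c)" unfolding ** using * someI_ex by fast
  then have "tgt a (rep a c) = tgt a c" by (simp add: full_def)
  then show "rep a (rep a c) = rep a c" using * ** rep_def[of a "rep a c"] by simp
qed

section \<open>The measure drops at a breaking letter\<close>

lemma img_comps_finite:
  assumes "inP \<Sigma> a" "\<not> skips S a"
  shows "finite (img_comps a)" "\<And>y. y \<in> img_comps a \<Longrightarrow> finite (snd y)"
proof -
  note g = goodD[OF assms, unfolded good_def]
  show "finite (img_comps a)" using g by (auto simp: img_comps_def)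
  fix y assume "y \<in> img_comps a"
  then obtain c p where "c \<in> dom_comps S a" "snd y = keep a c p" by (auto simp: img_comps_def)
  moreover have "keep a c p \<subseteq> snd c" if "c \<in> dom_comps S a"
    using tree_ok_leaf[of "snd c" "trees S a c"] g that leaf_at_in_lvs[of "trees S a c" p]
    unfolding keep_def by (metis prod.collapse)
  ultimately show "finite (snd y)" using g finite_subset by metis
qed

text \<open>The names \<open>Ext\<close> record both component and path, so different leaves give
  different components and the dimensions can be summed leaf by leaf.\<close>

lemma dims_img_comps:
  assumes "inP \<Sigma> a" "\<not> skips S a"
  shows "dims (img_comps a) = (\<Sum>c | c \<in> dom_comps S a \<and> rep a c = c. \<Sum>p\<in>paths (trees S a c). {#card (keep a c p)#})"
proof -
  have fin: "finite (dom_comps S a)" using goodD[OF assms] by (simp add: good_def)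
  have "inj_on (\<lambda>(c, p). (Ext (fst c) (snd c) p, keep a c p)) X" for X
    by (auto simp: inj_on_def)
  then have "dims (img_comps a) = (\<Sum>(c, p)\<in>(SIGMA c:{c \<in> dom_comps S a. rep a c = c}. paths (trees S a c)). {#card (keep a c p)#})"
    unfolding dims_def img_comps_def by (subst sum.reindex) (auto intro!: sum.cong)
  also have "\<dots> = (\<Sum>c | c \<in> dom_comps S a \<and> rep a c = c. \<Sum>p\<in>paths (trees S a c). {#card (keep a c p)#})"
    using fin by (subst sum.Sigma) auto
  finally show ?thesis .
qed

text \<open>Every component represents itself here. Its leaves never outweigh it, and a component
  that witnesses the loss splits into strictly smaller pieces.\<close>

lemma dims_img_comps_lossy:
  assumes "inP \<Sigma> a" "\<not> skips S a" "lossy a"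
  shows "dims (img_comps a) < dims (dom_comps S a)"
proof -
  note g = goodD[OF assms(1,2), unfolded good_def]
  have "dims (img_comps a) = (\<Sum>c\<in>dom_comps S a. \<Sum>p\<in>paths (trees S a c). {#card (keep a c p)#})"
    using dims_img_comps[OF assms(1,2)] assms(3) by (simp add: rep_def)
  also have "\<dots> < dims (dom_comps S a)"
    unfolding dims_def
  proof (rule sum_strict_mono_ex1)
    show "finite (dom_comps S a)" using g by simp
    show "\<forall>c\<in>dom_comps S a. (\<Sum>p\<in>paths (trees S a c). {#card (keep a c p)#}) \<le> {#card (snd c)#}"
      unfolding keep_def using g leaf_sum_le by blast
    show "\<exists>c\<in>dom_comps S a. (\<Sum>p\<in>paths (trees S a c). {#card (keep a c p)#}) < {#card (snd c)#}"
      unfolding keep_def using g leaf_sum_less assms(3) unfolding lossy_def by blast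
  qed
  finally show ?thesis .
qed

text \<open>If nothing is lost, some component only acquires atoms of the letter. Either another
  component already covers its target, and then it is redundant, or some target strictly
  dominates all components mapped to it.\<close>

lemma dims_img_comps_non_lossy:
  assumes "inP \<Sigma> a" "breaks a" "\<not> lossy a"
  shows "dims (img_comps a) < m"
proof -
  have nsk: "\<not> skips S a" using assms by (simp add: breaks_def)
  note g = goodD[OF assms(1) nsk, unfolded good_def]
  let ?X = "dom_comps S a" let ?Z = "{c \<in> ?X. rep a c = c}"
  have fin: "finite ?X" "finite ?Z" using g by auto
  have leaf: "\<exists>n' M. trees S a c = Leaf (n', snd c, M) \<and> tgt a c = (n', snd c \<union> dom M) \<and> finite (dom M) \<and> snd c \<inter> dom M = {} \<and> finite (snd c)"
    if "c \<in> ?X" for c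
    using non_lossy_leaf[OF assms(3) that] g that by (metis tree_ok.simps(1))
  have Yeq: "dims (img_comps a) = dims ?Z"
    unfolding dims_img_comps[OF assms(1) nsk] unfolding dims_def
  proof (rule sum.cong)
    fix c assume "c \<in> ?Z"
    then obtain n' M where "trees S a c = Leaf (n', snd c, M)" using leaf by blast
    then show "(\<Sum>p\<in>paths (trees S a c). {#card (keep a c p)#}) = {#card (snd c)#}"
      by (simp add: keep_def)
  qed simp
  have cod_comps: "tgt a ` ?X \<subseteq> cod_comps S a" using g leaf_at_in_lvs unfolding tgt_def by blast
  \<comment> \<open>\<open>c0\<close> witnesses that \<open>a\<close> is not a unit. As
    \<open>a\<close> loses nothing, \<open>c0\<close> must receive an atom of \<open>a\<close>, so
    it is not full.\<close>
  obtain c0 where c0: "c0 \<in> ?X" "\<not> (\<exists>n'. trees S a c0 = Leaf (n', snd c0, Map.empty))"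
    using assms(2) by (auto simp: breaks_def is_unit_def)
  have c0full: "\<not> full a (tgt a c0) c0"
  proof
    assume f: "full a (tgt a c0) c0"
    obtain n' M where M: "trees S a c0 = Leaf (n', snd c0, M)" "tgt a c0 = (n', snd c0 \<union> dom M)" "snd c0 \<inter> dom M = {}"
      using leaf[OF c0(1)] by blast
    then have "snd c0 = snd c0 \<union> dom M" using f by (simp add: full_def)
    then have "dom M = {}" using M(3) by blast
    then show False using c0(2) M(1) by simp
  qed
  have card_le: "card (snd c) \<le> card (snd (tgt a c))" "full a (tgt a c) c \<or> card (snd c) < card (snd (tgt a c))"
    if cX: "c \<in> ?X" for c
  proof -
    obtain n' and M :: "nat \<rightharpoonup> nat" where M: "tgt a c = (n', snd c \<union> dom M)" "finite (dom M)" "finite (snd c)"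
      using leaf[OF cX] by metis
    then show "card (snd c) \<le> card (snd (tgt a c))" by (auto intro: card_mono)
    show "full a (tgt a c) c \<or> card (snd c) < card (snd (tgt a c))"
    proof (cases "dom M \<subseteq> snd c")
      case True
      then have "snd c \<union> dom M = snd c" by blast
      then show ?thesis using cX M by (auto simp: full_def)
    next
      case False
      then have "snd c \<subset> snd c \<union> dom M" by blast
      then show ?thesis using M by (auto intro!: psubset_card_mono)
    qed
  qed
  show ?thesis
  proof (cases "\<exists>c'. full a (tgt a c0) c'")
    case True
    then have "rep a c0 \<noteq> c0" using c0full assms(3) someI_ex[OF True] by (auto simp: rep_def)
    then have "?Z \<subset> ?X" using c0 by auto
    then have "dims ?Z < dims ?X" using fin by (intro dims_strict_mono) auto
    then show ?thesis using g Yeq by auto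
  next
    case False
    \<comment> \<open>Representatives grouped by target. A target with a full component has at most
      one representative, of its own dimension; over any other target all components are strictly
      smaller, and the target of \<open>c0\<close> is of this kind.\<close>
    let ?fib = "\<lambda>t. {c \<in> ?Z. tgt a c = t}"
    have le: "dims (?fib t) \<le> {#card (snd t)#}" for t
    proof (cases "\<exists>c'. full a t c'")
      case True
      have "c = (SOME c'. full a t c')" if "c \<in> ?fib t" for c
        using that True assms(3) rep_full[of a c] by (metis (mono_tags, lifting) mem_Collect_eq)
      then have "?fib t \<subseteq> {SOME c'. full a t c'}" by blast
      moreover have "snd (SOME c'. full a t c') = snd t" using someI_ex[OF True] by (simp add: full_def)
      ultimately show ?thesis using dims_mono[of "{SOME c'. full a t c'}" "?fib t"] by (simp add: dims_def)
    next
      case False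
      then show ?thesis unfolding dims_def
        by (intro less_imp_le sum_singletons_less) (use card_le in blast)
    qed
    have less: "dims (?fib (tgt a c0)) < {#card (snd (tgt a c0))#}"
      unfolding dims_def using False card_le by (intro sum_singletons_less) fastforce
    have "dims ?Z = (\<Sum>t\<in>tgt a ` ?X. dims (?fib t))"
      unfolding dims_def using fin by (subst sum.group) auto
    also have "\<dots> < (\<Sum>t\<in>tgt a ` ?X. {#card (snd t)#})"
      using fin le less c0 by (intro sum_strict_mono_ex1) auto
    also have "\<dots> = dims (tgt a ` ?X)" by (simp add: dims_def)
    also have "\<dots> \<le> dims (cod_comps S a)" using g cod_comps by (intro dims_mono) auto
    also have "\<dots> \<le> m" using g by simp
    finally show ?thesis using Yeq by simp
  qed
qed

lemma dims_img_comps_less: "inP \<Sigma> a \<Longrightarrow> breaks a \<Longrightarrow> dims (img_comps a) < m"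
  using dims_img_comps_lossy[of a] dims_img_comps_non_lossy[of a] goodD[of a]
  by (cases "lossy a") (auto simp: breaks_def good_def)

text \<open>The tree of \<open>a\<close>, redirected into \<open>img_comps a\<close>. A
  representative stores no atom of \<open>a\<close>, since these can be recovered from
  \<open>a\<close> and the path in the name. Any other component does store them, because it has to
  fill the registers of its representative.\<close>

definition enc_tree :: "aval \<Rightarrow> comp \<Rightarrow> leaf dtree" where
  "enc_tree a c = (if rep a c = c
     then map_path (\<lambda>p l. (Ext (fst c) (snd c) p, fst (snd l), Map.empty)) (trees S a c)
     else Leaf (Ext (fst (rep a c)) (snd (rep a c)) [], snd c, snd (snd (leaf_at (trees S a c) []))))"

lemma enc_tree_act: "inP \<Sigma> a \<Longrightarrow> bij \<pi> \<Longrightarrow> enc_tree (act \<pi> a) c = tact \<pi> (lact \<pi>) (enc_tree a c)"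
  by (auto simp: enc_tree_def rep_inv trees_act intro!: tact_map_path[symmetric])

text \<open>The representative writes nothing: what it would write is disjoint from its own
  registers, yet lies in the target, which has no further ones.\<close>

lemma rep_leaves:
  assumes "inP \<Sigma> a" "\<not> skips S a" "c \<in> dom_comps S a" "rep a c \<noteq> c"
  obtains n' M where "trees S a c = Leaf (n', snd c, M)" "finite (dom M)" "snd c \<inter> dom M = {}"
    "rep a c \<in> dom_comps S a" "rep a (rep a c) = rep a c" "snd (rep a c) = snd c \<union> dom M"
    "trees S a (rep a c) = Leaf (n', snd c \<union> dom M, Map.empty)"
proof -
  note g = goodD[OF assms(1,2), unfolded good_def]
  note rp = rep_props[OF assms(3,4)]
  obtain n' M where M: "trees S a c = Leaf (n', snd c, M)" "tgt a c = (n', snd c \<union> dom M)"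
    using non_lossy_leaf[OF rp(1) assms(3)] .
  have r: "rep a c \<in> dom_comps S a" "tgt a (rep a c) = tgt a c" "snd (rep a c) = snd c \<union> dom M"
    using rp(2) M by (auto simp: full_def)
  obtain n2 M2 where M2: "trees S a (rep a c) = Leaf (n2, snd (rep a c), M2)" "tgt a (rep a c) = (n2, snd (rep a c) \<union> dom M2)"
    using non_lossy_leaf[OF rp(1) r(1)] .
  have "tree_ok (snd (rep a c)) (trees S a (rep a c))" "tree_ok (snd c) (trees S a c)" using g r assms by auto
  then have d: "snd (rep a c) \<inter> dom M2 = {}" "snd c \<inter> dom M = {}" "finite (dom M)" using M M2 by auto
  have "snd (rep a c) \<union> dom M2 = snd c \<union> dom M" using r M M2 by simp
  then have "dom M2 \<subseteq> snd (rep a c)" using r(3) by blast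
  then have "dom M2 = {}" using d(1) by blast
  then have "trees S a (rep a c) = Leaf (n', snd c \<union> dom M, Map.empty)"
    using M2 r M by simp
  then show thesis using that M d r rp by blast
qed

lemma enc_tree_good:
  assumes "inP \<Sigma> a" "\<not> skips S a" "c \<in> dom_comps S a"
  shows "tree_ok (snd c) (enc_tree a c)" "leaf_comp ` lvs (enc_tree a c) \<subseteq> img_comps a"
proof -
  note g = goodD[OF assms(1,2), unfolded good_def]
  have "tree_ok (snd c) (enc_tree a c) \<and> leaf_comp ` lvs (enc_tree a c) \<subseteq> img_comps a"
  proof (cases "rep a c = c")
    case True
    have "tree_ok (snd c) (enc_tree a c)"
      using g assms True unfolding enc_tree_def by (auto intro!: tree_ok_map_path)
    moreover have "leaf_comp ` lvs (enc_tree a c) \<subseteq> img_comps a"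
      using assms True by (auto simp: enc_tree_def lvs_map_path img_comps_def keep_def image_iff intro!: bexI)
    ultimately show ?thesis by simp
  next
    case False
    obtain n' M where M: "trees S a c = Leaf (n', snd c, M)" "finite (dom M)" "snd c \<inter> dom M = {}"
      "rep a c \<in> dom_comps S a" "rep a (rep a c) = rep a c" "snd (rep a c) = snd c \<union> dom M"
      "trees S a (rep a c) = Leaf (n', snd c \<union> dom M, Map.empty)"
      using rep_leaves[OF assms False] .
    have n: "enc_tree a c = Leaf (Ext (fst (rep a c)) (snd (rep a c)) [], snd c, M)"
      using M False by (simp add: enc_tree_def)
    have "(Ext (fst (rep a c)) (snd (rep a c)) [], snd c \<union> dom M) \<in> img_comps a"
      unfolding img_comps_def using M by (intro image_eqI[of _ _ "(rep a c, [])"]) (auto simp: keep_def)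
    then show ?thesis using n M by simp
  qed
  then show "tree_ok (snd c) (enc_tree a c)" "leaf_comp ` lvs (enc_tree a c) \<subseteq> img_comps a" by auto
qed

text \<open>Undoes the encoding: a configuration over \<open>img_comps a\<close> becomes one over the target of \<open>a\<close> by
  adding the atoms of \<open>a\<close> recorded at the leaf.\<close>

lemma enc_tree_correct:
  assumes "inP \<Sigma> a" "\<not> skips S a" "(n, dom \<rho>) \<in> dom_comps S a"
    and "eval_tree (trees S a (n, dom \<rho>)) \<rho> = (n', K, M)"
    and "eval_tree (enc_tree a (n, dom \<rho>)) \<rho> = (y, K', M')"
  obtains nn VV K'' M'' where
    "y = Ext nn VV (path_of (trees S a (n, dom \<rho>)) \<rho>)"
    "leaf_at (trees S a (nn, VV)) (path_of (trees S a (n, dom \<rho>)) \<rho>) = (n', K'', M'')"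
    "\<rho> |` K ++ M = (\<rho> |` K' ++ M') ++ M''"
    "dom (\<rho> |` K' ++ M') \<inter> dom M'' = {}" "finite (dom M'')"
    "(y, dom (\<rho> |` K' ++ M')) \<in> img_comps a"
proof -
  note g = goodD[OF assms(1,2), unfolded good_def]
  let ?c = "(n, dom \<rho>)" let ?p = "path_of (trees S a ?c) \<rho>"
  have "tree_ok (dom \<rho>) (trees S a ?c)" using g assms(3) by fastforce
  then have tree_ok: "K \<subseteq> dom \<rho>" "K \<inter> dom M = {}" "finite (dom M)"
    using tree_ok_leaf[of "dom \<rho>" "trees S a ?c" n' K M] eval_tree_in_lvs[of "trees S a ?c" \<rho>] assms(4) by auto
  have "(y, K' \<union> dom M') \<in> img_comps a"
    using enc_tree_good(2)[OF assms(1-3)] eval_tree_in_lvs[of "enc_tree a ?c" \<rho>] assms(5) by force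
  moreover have "K' \<subseteq> dom \<rho>"
    using enc_tree_good(1)[OF assms(1-3)] eval_tree_in_lvs[of "enc_tree a ?c" \<rho>] assms(5) tree_ok_leaf by fastforce
  then have dom: "dom (\<rho> |` K' ++ M') = K' \<union> dom M'" by auto
  ultimately have img_comps: "(y, dom (\<rho> |` K' ++ M')) \<in> img_comps a" by simp
  show thesis
  proof (cases "rep a ?c = ?c")
    case True
    then have "y = Ext n (dom \<rho>) ?p" "K' = K" "M' = Map.empty"
      using assms(4,5) by (auto simp: enc_tree_def)
    moreover have "dom (\<rho> |` K) \<inter> dom M = {}" using tree_ok by auto
    ultimately show ?thesis using that[of n "dom \<rho>" K M] img_comps tree_ok assms(4) by auto
  next
    case False
    obtain n2 M2 where M: "trees S a ?c = Leaf (n2, snd ?c, M2)"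
      "trees S a (rep a ?c) = Leaf (n2, snd ?c \<union> dom M2, Map.empty)"
      using rep_leaves[OF assms(1-3) False] .
    have e: "n2 = n'" "K = dom \<rho>" "M2 = M" "?p = []" using M(1) assms(4) by auto
    have "y = Ext (fst (rep a ?c)) (snd (rep a ?c)) ?p" "K' = dom \<rho>" "M' = M"
      using assms(5) M False e by (auto simp: enc_tree_def)
    then show ?thesis using that[of "fst (rep a ?c)" "snd (rep a ?c)" "dom \<rho> \<union> dom M" Map.empty] img_comps M(2) e by simp
  qed
qed

text \<open>Reads a component of the reduced system back. The name tells which leaf of the tree of
  the previous breaking letter was reached, hence which of its atoms to add; \<open>\<Theta>\<close>
  accounts for the unit letters since then. With \<open>pv = bot\<close> no breaking letter has
  occurred and the component is still one of \<open>S\<close>.\<close>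

definition dec_comp :: "aval \<Rightarrow> (comp \<Rightarrow> comp) \<Rightarrow> comp \<Rightarrow> comp \<times> (nat \<rightharpoonup> nat)" where
  "dec_comp pv \<Theta> y = (case pv of
     VL a \<Rightarrow> (case fst y of
        Ext n V p \<Rightarrow> (case leaf_at (trees S a (n, V)) p of (n', _, M) \<Rightarrow> (\<Theta> (n', snd y \<union> dom M), M))
      | Base _ \<Rightarrow> (\<Theta> y, Map.empty))
   | _ \<Rightarrow> (\<Theta> y, Map.empty))"

lemma dec_comp_act:
  assumes "inP (optP \<Sigma>) pv" "bij \<pi>"
  shows "dec_comp (act \<pi> pv) \<Theta> y = (fst (dec_comp pv \<Theta> y), ract \<pi> (snd (dec_comp pv \<Theta> y)))"
  using assms by (auto simp: inP_optP dec_comp_def bot_def trees_act split: name.splits prod.splits)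

text \<open>The components that may occur between \<open>pv\<close> and the next breaking letter.
  Before any breaking letter this is only the initial one, whose measure is
  \<open>{#0#}\<close>.\<close>

definition prev_comps :: "aval \<Rightarrow> comp set" where
  "prev_comps pv = (case pv of VL a \<Rightarrow> if breaks a then img_comps a else {} | _ \<Rightarrow> {(n0, {})})"

lemma prev_comps_simps [simp]: "prev_comps (VL a) = (if breaks a then img_comps a else {})" "prev_comps Defs.bot = {(n0, {})}"
  by (auto simp: prev_comps_def bot_def)

definition theta :: "aval \<Rightarrow> comp \<Rightarrow> comp" where
  "theta a c = (if c \<in> dom_comps S a then (fst (leaf_at (trees S a c) []), snd c) else c)"

text \<open>A breaking letter resets the action to \<open>id\<close>, because decoding starts afresh
  from that letter.\<close>

definition tstep :: "(comp \<Rightarrow> comp) \<Rightarrow> aval \<Rightarrow> comp \<Rightarrow> comp" where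
  "tstep \<Theta> a = (if breaks a then id else if skips S a then \<Theta> else theta a \<circ> \<Theta>)"

text \<open>Letters of the reduced system are pairs of the accumulated action \<open>\<Theta>\<close> of the unit letters
  together with the previous breaking letter, and the current letter.\<close>

definition new_sys :: "(aval \<Rightarrow> comp \<Rightarrow> comp) \<Rightarrow> sys" where
  "new_sys d = \<lparr>
     skips = \<lambda>b. \<not> breaks (vsnd b),
     dom_comps = \<lambda>b. {y \<in> prev_comps (vsnd (vfst b)).
        fst (dec_comp (vsnd (vfst b)) (d (vfst (vfst b))) y) \<in> dom_comps S (vsnd b) \<and>
        snd (fst (dec_comp (vsnd (vfst b)) (d (vfst (vfst b))) y)) = snd y \<union> dom (snd (dec_comp (vsnd (vfst b)) (d (vfst (vfst b))) y)) \<and>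
        snd y \<inter> dom (snd (dec_comp (vsnd (vfst b)) (d (vfst (vfst b))) y)) = {} \<and>
        finite (dom (snd (dec_comp (vsnd (vfst b)) (d (vfst (vfst b))) y)))},
     cod_comps = \<lambda>b. img_comps (vsnd b),
     trees = \<lambda>b y. subst (snd (dec_comp (vsnd (vfst b)) (d (vfst (vfst b))) y))
        (enc_tree (vsnd b) (fst (dec_comp (vsnd (vfst b)) (d (vfst (vfst b))) y))) \<rparr>"

definition new_poly :: "poly \<Rightarrow> poly" where
  "new_poly P = PProd (PProd P (optP \<Sigma>)) \<Sigma>"

lemma new_poly_cases:
  assumes "inP (new_poly P) b"
  obtains x pv a where "b = Pr (Pr x pv) a" "inP P x" "inP (optP \<Sigma>) pv" "inP \<Sigma> a"
  using assms by (auto simp: new_poly_def)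

lemma prev_comps_finite:
  assumes "inP (optP \<Sigma>) pv"
  shows "finite (prev_comps pv)" "y \<in> prev_comps pv \<Longrightarrow> finite (snd y)"
proof -
  consider x where "pv = VL x" "inP \<Sigma> x" | "pv = Defs.bot" using assms by (auto simp: inP_optP)
  then have "finite (prev_comps pv) \<and> (y \<in> prev_comps pv \<longrightarrow> finite (snd y))"
  proof cases
    case 1 then show ?thesis using img_comps_finite[of x] by (simp add: breaks_def)
  qed auto
  then show "finite (prev_comps pv)" "y \<in> prev_comps pv \<Longrightarrow> finite (snd y)" by auto
qed

lemma prev_comps_inv: "inP (optP \<Sigma>) pv \<Longrightarrow> bij \<pi> \<Longrightarrow> prev_comps (act \<pi> pv) = prev_comps pv"
  by (auto simp: inP_optP breaks_inv img_comps_inv split: if_splits)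

lemma new_tre_act:
  assumes "invariant P d" "inP (new_poly P) b" "bij \<pi>"
  shows "trees (new_sys d) (act \<pi> b) c = tact \<pi> (lact \<pi>) (trees (new_sys d) b c)"
  using assms
  by (auto simp: new_sys_def dec_comp_act enc_tree_act invariant_def subst_tact bij_is_inj elim!: new_poly_cases)

text \<open>Letters of \<open>new_poly P\<close> may carry annotations that no word produces. The
  filter in \<open>dom_comps\<close> removes the components whose decoding does not fit the letter,
  which makes \<open>good\<close> hold for these letters as well. For the measure, the source lies
  in the image of the previous breaking letter, or is the initial component, and the target is the
  image of the current letter.\<close>

lemma new_sys_ok:
  assumes d: "invariant P d"
    and bound: "\<And>a. inP \<Sigma> a \<Longrightarrow> breaks a \<Longrightarrow> dims (img_comps a) \<le> m'" "{#0#} \<le> m'"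
  shows "sys_ok (new_poly P) m' (new_sys d)"
proof -
  have 1: "invariant (new_poly P) (skips (new_sys d))"
    by (auto simp: invariant_def new_sys_def breaks_inv elim: new_poly_cases)
  have "dom_comps (new_sys d) (act \<pi> b) = dom_comps (new_sys d) b" if \<pi>: "bij \<pi>" and b: "inP (new_poly P) b" for \<pi> b
  proof -
    obtain x pv a where "b = Pr (Pr x pv) a" "inP P x" "inP (optP \<Sigma>) pv" "inP \<Sigma> a"
      using new_poly_cases[OF b] .
    then show ?thesis using \<pi> invariantD[OF d \<pi>] by (simp add: new_sys_def dec_comp_act prev_comps_inv dom_comps_inv)
  qed
  then have 2: "invariant (new_poly P) (dom_comps (new_sys d))" by (simp add: invariant_def)
  have 3: "invariant (new_poly P) (cod_comps (new_sys d))"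
    by (auto simp: invariant_def new_sys_def img_comps_inv elim!: new_poly_cases)
  have 5: "good m' (new_sys d) b" if b0: "inP (new_poly P) b" "\<not> skips (new_sys d) b" for b
  proof -
    obtain x pv a where b: "b = Pr (Pr x pv) a" "inP P x" "inP (optP \<Sigma>) pv" "inP \<Sigma> a"
      using new_poly_cases[OF b0(1)] .
    have br: "breaks a" "\<not> skips S a" using b0 b by (auto simp: new_sys_def breaks_def)
    have sub: "dom_comps (new_sys d) b \<subseteq> prev_comps pv" using b by (auto simp: new_sys_def)
    have prev_comps: "finite (prev_comps pv)" "dims (prev_comps pv) \<le> m'"
    proof -
      show "finite (prev_comps pv)" using prev_comps_finite b by blast
      show "dims (prev_comps pv) \<le> m'" using b(3) bound by (auto simp: inP_optP dims_def)
    qed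
    have "finite (snd y) \<and> tree_ok (snd y) (trees (new_sys d) b y) \<and> leaf_comp ` lvs (trees (new_sys d) b y) \<subseteq> img_comps a"
      if "y \<in> dom_comps (new_sys d) b" for y
    proof -
      obtain c M where cM: "dec_comp pv (d x) y = (c, M)" by fastforce
      then have c: "c \<in> dom_comps S a" "snd c = snd y \<union> dom M" "snd y \<inter> dom M = {}" "finite (dom M)"
        using that b by (simp_all add: new_sys_def)
      have t: "trees (new_sys d) b y = subst M (enc_tree a c)" using cM b by (simp add: new_sys_def)
      have "snd c - dom M = snd y" using c by auto
      then have "tree_ok (snd y) (subst M (enc_tree a c))"
        using tree_ok_subst[OF enc_tree_good(1)[OF b(4) br(2) c(1)] c(4)] by simp
      moreover have "leaf_comp ` lvs (subst M (enc_tree a c)) \<subseteq> img_comps a"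
        using leaf_comp_subst enc_tree_good(2)[OF b(4) br(2) c(1)] by blast
      moreover have "finite (snd y)" using prev_comps_finite(2)[OF b(3)] sub that by blast
      ultimately show ?thesis using t by simp
    qed
    moreover have "cod_comps (new_sys d) b = img_comps a" using b by (simp add: new_sys_def)
    moreover have "dims (dom_comps (new_sys d) b) \<le> m'" using dims_mono[OF prev_comps(1) sub] prev_comps(2) by (rule order_trans)
    ultimately show ?thesis
      using img_comps_finite[OF b(4) br(2)] bound(1)[OF b(4) br(1)] finite_subset[OF sub prev_comps(1)]
      by (simp add: good_def)
  qed
  show ?thesis unfolding sys_ok_def using 1 2 3 5 new_tre_act[OF d] by blast
qed

section \<open>Simulation of a system by its reduced system\<close>

definition encodes :: "(comp \<Rightarrow> comp) \<Rightarrow> aval \<Rightarrow> name \<Rightarrow> regs \<Rightarrow> name \<Rightarrow> regs \<Rightarrow> bool" where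
  "encodes \<Theta> pv n' \<rho>' n \<rho> \<longleftrightarrow> (n', dom \<rho>') \<in> prev_comps pv \<and>
     (\<exists>M. dec_comp pv \<Theta> (n', dom \<rho>') = ((n, dom \<rho>), M) \<and> \<rho> = \<rho>' ++ M \<and> dom \<rho>' \<inter> dom M = {} \<and> finite (dom M))"

lemma encodes_init: "encodes id Defs.bot n0 Map.empty n0 Map.empty"
  by (auto simp: encodes_def dec_comp_def bot_def prev_comps_def)

text \<open>A unit letter moves no atoms, so the reduced configuration stays as it is and the
  accumulated action absorbs the new name.\<close>

lemma encodes_unit:
  assumes "encodes \<Theta> pv n' \<rho>' n \<rho>" "\<not> breaks a" "\<not> skips S a" "(n, dom \<rho>) \<in> dom_comps S a"
  obtains n2 where "trees S a (n, dom \<rho>) = Leaf (n2, dom \<rho>, Map.empty)" "encodes (tstep \<Theta> a) pv n' \<rho>' n2 \<rho>"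
proof -
  obtain n2 where t: "trees S a (n, dom \<rho>) = Leaf (n2, dom \<rho>, Map.empty)"
    using assms by (auto simp: breaks_def is_unit_def)
  obtain M where M: "dec_comp pv \<Theta> (n', dom \<rho>') = ((n, dom \<rho>), M)" using assms by (auto simp: encodes_def)
  have "dec_comp pv (\<lambda>c. f (\<Theta> c)) y = (f (fst (dec_comp pv \<Theta> y)), snd (dec_comp pv \<Theta> y))" for f y
    by (auto simp: dec_comp_def split: aval.splits name.splits prod.splits)
  then have "dec_comp pv (tstep \<Theta> a) (n', dom \<rho>') = (theta a (n, dom \<rho>), M)"
    using M assms by (simp add: tstep_def comp_def)
  also have "theta a (n, dom \<rho>) = (n2, dom \<rho>)" using t assms by (simp add: theta_def)
  finally have "encodes (tstep \<Theta> a) pv n' \<rho>' n2 \<rho>" using assms(1) M by (auto simp: encodes_def)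
  then show thesis using that t by blast
qed

text \<open>The atoms of the previous letter enter the tree by substitution, and the result is
  encoded anew relative to \<open>a\<close>. The trace of \<open>S\<close> can be recovered because
  the new name carries the path taken through the original tree.\<close>

lemma encodes_breaks:
  assumes r: "encodes \<Theta> pv n' \<rho>' n \<rho>" and a: "inP \<Sigma> a" "breaks a" "(n, dom \<rho>) \<in> dom_comps S a"
    and b: "d (vfst (vfst b)) = \<Theta>" "vsnd (vfst b) = pv" "vsnd b = a"
    and e: "eval_tree (trees S a (n, dom \<rho>)) \<rho> = (n2, K, M)"
    and e': "eval_tree (trees (new_sys d) b (n', dom \<rho>')) \<rho>' = (n2', K', M')"
  shows "(n', dom \<rho>') \<in> dom_comps (new_sys d) b"
    and "\<exists>nn VV. n2' = Ext nn VV (path_of (trees S a (n, dom \<rho>)) \<rho>)"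
    and "encodes (tstep \<Theta> a) (VL a) n2' (\<rho>' |` K' ++ M') n2 (\<rho> |` K ++ M)"
proof -
  obtain M0 where M0: "dec_comp pv \<Theta> (n', dom \<rho>') = ((n, dom \<rho>), M0)" "\<rho> = \<rho>' ++ M0" "dom \<rho>' \<inter> dom M0 = {}" "finite (dom M0)"
    and img_comps: "(n', dom \<rho>') \<in> prev_comps pv" using r by (auto simp: encodes_def)
  show "(n', dom \<rho>') \<in> dom_comps (new_sys d) b"
    using M0 img_comps a b by (simp add: new_sys_def Un_commute)
  have t: "trees (new_sys d) b (n', dom \<rho>') = subst M0 (enc_tree a (n, dom \<rho>))"
    using M0 b by (simp add: new_sys_def)
  obtain K1 M1 where e1: "eval_tree (enc_tree a (n, dom \<rho>)) \<rho> = (n2', K1, M1)" "K' = K1 - dom M0" "M' = (M0 |` K1) ++ M1"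
    using e' unfolding t eval_tree_subst M0(2)[symmetric] by (auto split: prod.splits)
  have cfg: "\<rho>' |` K' ++ M' = \<rho> |` K1 ++ M1"
    unfolding e1(2,3) M0(2) by (rule subst_config)
  have nsk: "\<not> skips S a" using a by (simp add: breaks_def)
  let ?p = "path_of (trees S a (n, dom \<rho>)) \<rho>"
  obtain nn VV K'' M'' where N: "n2' = Ext nn VV ?p" "leaf_at (trees S a (nn, VV)) ?p = (n2, K'', M'')"
    "\<rho> |` K ++ M = (\<rho> |` K1 ++ M1) ++ M''" "dom (\<rho> |` K1 ++ M1) \<inter> dom M'' = {}" "finite (dom M'')"
    "(n2', dom (\<rho> |` K1 ++ M1)) \<in> img_comps a"
    using enc_tree_correct[OF a(1) nsk a(3) e e1(1)] .
  show "\<exists>nn VV. n2' = Ext nn VV ?p" using N(1) by blast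
  have "dec_comp (VL a) id (n2', dom (\<rho> |` K1 ++ M1)) = ((n2, dom (\<rho> |` K1 ++ M1) \<union> dom M''), M'')"
    unfolding dec_comp_def N(1) using N(2) by simp
  also have "dom (\<rho> |` K1 ++ M1) \<union> dom M'' = dom (\<rho> |` K ++ M)" unfolding N(3) by auto
  finally have Deq: "dec_comp (VL a) id (n2', dom (\<rho> |` K1 ++ M1)) = ((n2, dom (\<rho> |` K ++ M)), M'')" .
  have "tstep \<Theta> a = id" using a(2) by (simp add: tstep_def)
  then show "encodes (tstep \<Theta> a) (VL a) n2' (\<rho>' |` K' ++ M') n2 (\<rho> |` K ++ M)"
    unfolding encodes_def cfg using N(3-6) a(2) Deq by (metis prev_comps_simps(1))
qed

end

lemma restrict_map_dom [simp]: "\<rho> |` dom \<rho> = \<rho>"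
  by (auto simp: restrict_map_def fun_eq_iff domIff)

context reduction
begin

section \<open>Annotated words and recovery of the trace\<close>

fun annotates :: "(aval \<Rightarrow> comp \<Rightarrow> comp) \<Rightarrow> (comp \<Rightarrow> comp) \<Rightarrow> aval \<Rightarrow> aval list \<Rightarrow> aval list \<Rightarrow> bool" where
  "annotates d \<Theta> pv [] [] \<longleftrightarrow> True"
| "annotates d \<Theta> pv (a # w) (b # v) \<longleftrightarrow> d (vfst (vfst b)) = \<Theta> \<and> (breaks a \<longrightarrow> vsnd (vfst b) = pv) \<and> vsnd b = a \<and>
     annotates d (tstep \<Theta> a) (if breaks a then VL a else pv) w v"
| "annotates d \<Theta> pv _ _ \<longleftrightarrow> False"

lemma skp_new_sys [simp]: "skips (new_sys d) b \<longleftrightarrow> \<not> breaks (vsnd b)"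
  by (simp add: new_sys_def)

lemma annotates_inside:
  assumes "annotates d \<Theta> pv w v" "w \<in> lists (pset \<Sigma>)" "encodes \<Theta> pv n' \<rho>' n \<rho>" "inside S n \<rho> w"
  shows "inside (new_sys d) n' \<rho>' v"
  using assms
proof (induction d \<Theta> pv w v arbitrary: n' \<rho>' n \<rho> rule: annotates.induct)
  case (2 d \<Theta> pv a w b v)
  have a: "inP \<Sigma> a" "w \<in> lists (pset \<Sigma>)" using 2 by (auto simp: pset_def)
  have b: "d (vfst (vfst b)) = \<Theta>" "breaks a \<Longrightarrow> vsnd (vfst b) = pv" "vsnd b = a"
    and l: "annotates d (tstep \<Theta> a) (if breaks a then VL a else pv) w v"
    using 2 by auto
  consider "skips S a" | "\<not> skips S a" "\<not> breaks a" | "breaks a" "\<not> skips S a" by (auto simp: breaks_def)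
  then show ?case
  proof cases
    case 1
    then show ?thesis using 2 b by (auto simp: tstep_def breaks_def)
  next
    case 2
    then have c: "(n, dom \<rho>) \<in> dom_comps S a" using "2.prems" by simp
    obtain n2 where n2: "trees S a (n, dom \<rho>) = Leaf (n2, dom \<rho>, Map.empty)" "encodes (tstep \<Theta> a) pv n' \<rho>' n2 \<rho>"
      using encodes_unit[OF "2.prems"(3) 2(2,1) c] .
    then show ?thesis using "2.IH"[OF l a(2), of n' \<rho>' n2 \<rho>] 2 "2.prems" b by simp
  next
    case 3
    then have c: "(n, dom \<rho>) \<in> dom_comps S a" using "2.prems" by simp
    obtain n2 K M n2' K' M' where e: "eval_tree (trees S a (n, dom \<rho>)) \<rho> = (n2, K, M)"
      "eval_tree (trees (new_sys d) b (n', dom \<rho>')) \<rho>' = (n2', K', M')" by (metis prod_cases3)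
    note R = encodes_breaks[OF "2.prems"(3) a(1) 3(1) c b(1) b(2)[OF 3(1)] b(3) e]
    have "inside S n2 (\<rho> |` K ++ M) w" using "2.prems" 3 e by simp
    then show ?thesis using "2.IH"[OF l a(2), of n2' "\<rho>' |` K' ++ M'" n2 "\<rho> |` K ++ M"] R(1,3) 3 b e by simp
  qed
qed auto

text \<open>At a breaking letter, the entry of the reduced trace leads to a leaf of the reduced
  tree, and the name at that leaf contains the path of the original tree. The tree of a unit letter
  is a leaf, hence the path \<open>[]\<close>.\<close>

definition fpath :: "(aval \<Rightarrow> comp \<Rightarrow> comp) \<Rightarrow> (aval \<Rightarrow> (name \<times> nat set \<times> bool list) option) \<Rightarrow> aval \<Rightarrow> bool list" where
  "fpath d e z = (if breaks (vsnd (vsnd z))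
     then (case e (vfst z) of
         Some (n, V, p) \<Rightarrow> (case fst (leaf_at (trees (new_sys d) (vsnd z) (n, V)) p) of Ext _ _ q \<Rightarrow> q | Base _ \<Rightarrow> [])
       | None \<Rightarrow> [])
     else [])"

definition fout :: "(aval \<Rightarrow> comp \<Rightarrow> comp) \<Rightarrow> (aval \<Rightarrow> (name \<times> nat set \<times> bool list) option) \<Rightarrow> comp \<Rightarrow> aval \<Rightarrow>
    (name \<times> nat set \<times> bool list) option" where
  "fout d e c z = (if skips S (vsnd (vsnd z)) then None else Some (fst c, snd c, fpath d e z))"

definition ftarget :: "(aval \<Rightarrow> comp \<Rightarrow> comp) \<Rightarrow> (aval \<Rightarrow> (name \<times> nat set \<times> bool list) option) \<Rightarrow> comp \<Rightarrow> aval \<Rightarrow> comp" where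
  "ftarget d e c z = (if skips S (vsnd (vsnd z)) then c else leaf_comp (leaf_at (trees S (vsnd (vsnd z)) c) (fpath d e z)))"

text \<open>Inconsistent annotations could lead out of \<open>Q\<close>; staying put keeps the state
  space finite.\<close>

definition fstep :: "comp set \<Rightarrow> (aval \<Rightarrow> comp \<Rightarrow> comp) \<Rightarrow> (aval \<Rightarrow> (name \<times> nat set \<times> bool list) option) \<Rightarrow> comp \<Rightarrow> aval \<Rightarrow> comp" where
  "fstep Q d e c z = (if ftarget d e c z \<in> Q then ftarget d e c z else c)"

lemma next_dom:
  assumes "inP \<Sigma> a" "\<not> skips S a" "(n, dom \<rho>) \<in> dom_comps S a" "eval_tree (trees S a (n, dom \<rho>)) \<rho> = (n2, K, M)"
  shows "dom (\<rho> |` K ++ M) = K \<union> dom M" "(n2, K \<union> dom M) \<in> cod_comps S a"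
proof -
  note g = goodD[OF assms(1,2), unfolded good_def]
  have "tree_ok (dom \<rho>) (trees S a (n, dom \<rho>))" using g assms(3) by fastforce
  then have "K \<subseteq> dom \<rho>"
    using tree_ok_leaf[of "dom \<rho>" "trees S a (n, dom \<rho>)" n2 K M] eval_tree_in_lvs[of "trees S a (n, dom \<rho>)" \<rho>] assms(4) by auto
  then show "dom (\<rho> |` K ++ M) = K \<union> dom M" by auto
  have "(n2, K, M) \<in> lvs (trees S a (n, dom \<rho>))" using eval_tree_in_lvs[of "trees S a (n, dom \<rho>)" \<rho>] assms(4) by simp
  then have "leaf_comp (n2, K, M) \<in> cod_comps S a" using g assms(3) by blast
  then show "(n2, K \<union> dom M) \<in> cod_comps S a" by simp
qed

text \<open>Once the paths are known, only the current component remains to be tracked. It ranges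
  over a finite set, so a finite-state machine expands the reduced trace to the trace of
  \<open>S\<close>, unit letters included.\<close>

lemma annotates_trace:
  assumes "annotates d \<Theta> pv w v" "w \<in> lists (pset \<Sigma>)" "encodes \<Theta> pv n' \<rho>' n \<rho>" "inside S n \<rho> w"
    and "length es = length v" "map e es = trace (new_sys d) n' \<rho>' v"
    and Q: "\<And>a. inP \<Sigma> a \<Longrightarrow> \<not> skips S a \<Longrightarrow> cod_comps S a \<subseteq> Q"
  shows "omealy (fstep Q d e) (fout d e) (n, dom \<rho>) (map2 Pr es v) = trace S n \<rho> w"
  using assms(1-6)
proof (induction d \<Theta> pv w v arbitrary: n' \<rho>' n \<rho> es rule: annotates.induct)
  case (2 d \<Theta> pv a w b v)
  have a: "inP \<Sigma> a" "w \<in> lists (pset \<Sigma>)" using 2 by (auto simp: pset_def)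
  have b: "d (vfst (vfst b)) = \<Theta>" "breaks a \<Longrightarrow> vsnd (vfst b) = pv" "vsnd b = a"
    and l: "annotates d (tstep \<Theta> a) (if breaks a then VL a else pv) w v"
    using 2 by auto
  obtain x es' where es: "es = x # es'" "length es' = length v" using "2.prems"(5) by (cases es) auto
  let ?z = "Pr x b"
  consider "skips S a" | "\<not> skips S a" "\<not> breaks a" | "breaks a" "\<not> skips S a" by (auto simp: breaks_def)
  then show ?case
  proof cases
    case 1
    then have nb: "\<not> breaks a" "tstep \<Theta> a = \<Theta>" by (auto simp: tstep_def breaks_def)
    have "fstep Q d e c ?z = c" "fout d e c ?z = None" for c
      using 1 b by (auto simp: fstep_def ftarget_def fout_def)
    then show ?thesis using "2.IH"[OF l a(2), of n' \<rho>' n \<rho> es'] 1 nb "2.prems" b es by simp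
  next
    case 2
    then have c: "(n, dom \<rho>) \<in> dom_comps S a" using "2.prems" by simp
    obtain n2 where n2: "trees S a (n, dom \<rho>) = Leaf (n2, dom \<rho>, Map.empty)" "encodes (tstep \<Theta> a) pv n' \<rho>' n2 \<rho>"
      using encodes_unit[OF "2.prems"(3) 2(2,1) c] .
    have "(n2, dom \<rho>) \<in> Q" using next_dom(2)[OF a(1) 2(1) c] n2(1) Q[OF a(1) 2(1)] by auto
    then have "fstep Q d e (n, dom \<rho>) ?z = (n2, dom \<rho>)" "fout d e (n, dom \<rho>) ?z = Some (n, dom \<rho>, [])"
      using 2 b n2 by (auto simp: fstep_def ftarget_def fout_def fpath_def)
    then show ?thesis using "2.IH"[OF l a(2), of n' \<rho>' n2 \<rho> es'] 2 "2.prems" b es n2 by simp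
  next
    case 3
    then have c: "(n, dom \<rho>) \<in> dom_comps S a" using "2.prems" by simp
    obtain n2 K M n2' K' M' where e: "eval_tree (trees S a (n, dom \<rho>)) \<rho> = (n2, K, M)"
      "eval_tree (trees (new_sys d) b (n', dom \<rho>')) \<rho>' = (n2', K', M')" by (metis prod_cases3)
    let ?p = "path_of (trees S a (n, dom \<rho>)) \<rho>"
    note R = encodes_breaks[OF "2.prems"(3) a(1) 3(1) c b(1) b(2)[OF 3(1)] b(3) e]
    obtain nn VV where n2': "n2' = Ext nn VV ?p" using R(2) by blast
    have ex: "e x = Some (n', dom \<rho>', path_of (trees (new_sys d) b (n', dom \<rho>')) \<rho>')"
      using "2.prems"(6) es 3 b by simp
    have fp: "fpath d e ?z = ?p" using 3 b ex e(2) n2' by (simp add: fpath_def)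
    have "ftarget d e (n, dom \<rho>) ?z = (n2, dom (\<rho> |` K ++ M))"
      using next_dom(1)[OF a(1) 3(2) c e(1)] e(1) b 3 by (simp add: ftarget_def fp)
    moreover have "(n2, dom (\<rho> |` K ++ M)) \<in> Q"
      using next_dom[OF a(1) 3(2) c e(1)] Q[OF a(1) 3(2)] by auto
    ultimately have "fstep Q d e (n, dom \<rho>) ?z = (n2, dom (\<rho> |` K ++ M))" by (simp add: fstep_def)
    moreover have "fout d e (n, dom \<rho>) ?z = Some (n, dom \<rho>, ?p)" using 3 b fp by (simp add: fout_def)
    moreover have "inside S n2 (\<rho> |` K ++ M) w" using "2.prems" 3 e by simp
    ultimately show ?thesis
      using "2.IH"[OF l a(2), of n2' "\<rho>' |` K' ++ M'" n2 "\<rho> |` K ++ M" es'] R(3) 3 b e es "2.prems"(6)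
      by (simp del: dom_map_add)
  qed
qed auto

text \<open>The register releases its content at breaking letters only, which is why
  \<open>annotates\<close> prescribes the previous letter only there.\<close>

lemma annotates_build:
  assumes "length u = length w" "map d u = states tstep \<Theta> w"
  shows "annotates d \<Theta> pv w (map2 Pr (map2 Pr u (reg_run breaks (\<lambda>a. if breaks a then VL a else Defs.bot) pv w)) w)"
  using assms
proof (induction w arbitrary: u \<Theta> pv)
  case (Cons a w)
  then obtain x u' where u: "u = x # u'" by (cases u) auto
  show ?case using Cons.prems Cons.IH[of u' "tstep \<Theta> a" "if breaks a then VL a else pv"] u
    by (cases "breaks a") auto
qed simp

lemma theta_inv: "inP \<Sigma> a \<Longrightarrow> bij \<pi> \<Longrightarrow> theta (act \<pi> a) = theta a"
  by (rule ext) (simp add: theta_def dom_comps_inv trees_act)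

lemma tstep_inv: "invariant \<Sigma> (tstep \<Theta>)"
  unfolding invariant_def by (simp add: tstep_def breaks_inv skips_inv theta_inv)

section \<open>Finiteness of the components and of the accumulated actions\<close>

definition comps :: "comp set" where
  "comps = insert (n0, {}) (\<Union>a\<in>{a \<in> pset \<Sigma>. \<not> skips S a}. dom_comps S a \<union> cod_comps S a)"

lemma comps_sub: "inP \<Sigma> a \<Longrightarrow> \<not> skips S a \<Longrightarrow> dom_comps S a \<subseteq> comps \<and> cod_comps S a \<subseteq> comps"
  by (auto simp: comps_def pset_def)

text \<open>The component sets depend only on the orbit of the letter, so the union ranges over
  finitely many finite sets.\<close>

lemma finite_comps: "finite comps"
proof -
  let ?f = "\<lambda>a. if skips S a then {} else dom_comps S a \<union> cod_comps S a"
  have "invariant \<Sigma> ?f" by (simp add: invariant_def skips_inv dom_comps_inv cod_comps_inv)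
  then have "finite (?f ` pset \<Sigma>)" by (rule finite_range_invariant)
  moreover have "finite X" if "X \<in> ?f ` pset \<Sigma>" for X
    using that goodD by (auto simp: good_def pset_def)
  ultimately have "finite (\<Union> (?f ` pset \<Sigma>))" by blast
  moreover have "comps \<subseteq> insert (n0, {}) (\<Union> (?f ` pset \<Sigma>))" by (auto simp: comps_def)
  ultimately show ?thesis by (meson finite_insert finite_subset)
qed

text \<open>Being the identity outside \<open>comps\<close> makes such a function determined by its
  restriction, so there are finitely many although the type \<open>comp\<close> is infinite.\<close>

definition unit_actions :: "(comp \<Rightarrow> comp) set" where
  "unit_actions = {f. (\<forall>c. c \<notin> comps \<longrightarrow> f c = c) \<and> (\<forall>c\<in>comps. f c \<in> comps)}"

lemma finite_unit_actions: "finite unit_actions"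
proof (rule finite_imageD)
  have "(\<lambda>f. restrict f comps) ` unit_actions \<subseteq> comps \<rightarrow>\<^sub>E comps"
    by (auto simp: unit_actions_def)
  then show "finite ((\<lambda>f. restrict f comps) ` unit_actions)"
    using finite_PiE[OF finite_comps, of "\<lambda>_. comps"] finite_comps finite_subset by blast
  show "inj_on (\<lambda>f. restrict f comps) unit_actions"
  proof (rule inj_onI, rule ext)
    fix f g c assume "f \<in> unit_actions" "g \<in> unit_actions" "restrict f comps = restrict g comps"
    then show "f c = g c" unfolding unit_actions_def mem_Collect_eq by (metis restrict_apply')
  qed
qed

lemma tstep_closed:
  assumes "\<Theta> \<in> unit_actions" "inP \<Sigma> a"
  shows "tstep \<Theta> a \<in> unit_actions"
proof (cases "breaks a \<or> skips S a")
  case True then show ?thesis using assms by (auto simp: tstep_def unit_actions_def)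
next
  case False
  have sub: "dom_comps S a \<subseteq> comps" "cod_comps S a \<subseteq> comps" using comps_sub assms False by auto
  have "theta a c \<in> comps" if "c \<in> comps" for c
  proof (cases "c \<in> dom_comps S a")
    case True
    then obtain n' where "trees S a c = Leaf (n', snd c, Map.empty)"
      using False by (auto simp: breaks_def is_unit_def)
    moreover have "leaf_comp ` lvs (trees S a c) \<subseteq> cod_comps S a"
      using goodD[OF assms(2)] False True by (simp add: good_def)
    ultimately show ?thesis using True sub by (auto simp: theta_def)
  qed (use that in \<open>simp add: theta_def\<close>)
  moreover have "theta a c = c" if "c \<notin> comps" for c using that sub by (auto simp: theta_def)
  ultimately show ?thesis using assms(1) False by (auto simp: tstep_def unit_actions_def)
qed

lemma fpath_inv:
  assumes d: "invariant P d" and e: "invariant P' e"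
  shows "invariant (PProd P' (new_poly P)) (fpath d e)"
  unfolding invariant_def
proof (intro allI impI)
  fix \<pi> :: "nat \<Rightarrow> nat" and z assume \<pi>: "bij \<pi>" and "inP (PProd P' (new_poly P)) z"
  then obtain x b where z: "z = Pr x b" "inP P' x" "inP (new_poly P) b" by auto
  then have "breaks (vsnd (act \<pi> b)) = breaks (vsnd b)" using \<pi> by (auto simp: breaks_inv elim!: new_poly_cases)
  then show "fpath d e (act \<pi> z) = fpath d e z"
    using z invariantD[OF e \<pi> z(2)] new_tre_act[OF d z(3) \<pi>]
    by (simp add: fpath_def split: option.split)
qed

lemma ftarget_inv:
  assumes "invariant P d" "invariant P' e"
  shows "invariant (PProd P' (new_poly P)) (ftarget d e c)" "invariant (PProd P' (new_poly P)) (fout d e c)"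
proof -
  have "ftarget d e c (act \<pi> z) = ftarget d e c z \<and> fout d e c (act \<pi> z) = fout d e c z"
    if \<pi>: "bij \<pi>" and z: "inP (PProd P' (new_poly P)) z" for \<pi> z
  proof -
    obtain x b where b: "z = Pr x b" "inP P' x" "inP (new_poly P) b" using z by auto
    then have a: "inP \<Sigma> (vsnd b)" "vsnd (act \<pi> b) = act \<pi> (vsnd b)" by (auto elim!: new_poly_cases)
    show ?thesis using invariantD[OF fpath_inv[OF assms] \<pi> z] \<pi> a b(1)
      by (simp add: ftarget_def fout_def skips_inv trees_act)
  qed
  then show "invariant (PProd P' (new_poly P)) (ftarget d e c)" "invariant (PProd P' (new_poly P)) (fout d e c)"
    by (auto simp: invariant_def)
qed

text \<open>Four computations are composed: the accumulated unit actions (finite-state), the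
  previous breaking letter (one register), the trace of the reduced system (\<open>IH\<close>) and
  its expansion to the trace of \<open>S\<close> (finite-state again).\<close>

lemma computes_info_step:
  assumes IH: "\<And>m' \<Sigma>' S'. m' < m \<Longrightarrow> sys_ok \<Sigma>' m' S' \<Longrightarrow>
      computes_info \<Sigma>' {w. inside S' n0 Map.empty w} (trace S' n0 Map.empty)"
    and m: "{#0#} < m"
  shows "computes_info \<Sigma> {w. inside S n0 Map.empty w} (trace S n0 Map.empty)"
proof -
  let ?dims = "\<lambda>a. if breaks a then dims (img_comps a) else {#0#}"
  \<comment> \<open>\<open>{#0#}\<close> accounts for the initial component. The maximum makes sense
    because the measure of an image depends only on the orbit of the letter, so it takes finitely
    many values, and the multiset order is linear.\<close>
  define m' where "m' = Max (insert {#0#} (?dims ` pset \<Sigma>))"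
  have "invariant \<Sigma> ?dims" by (simp add: invariant_def breaks_inv img_comps_inv)
  then have fin: "finite (?dims ` pset \<Sigma>)" by (rule finite_range_invariant)
  have "m' < m" unfolding m'_def using fin m dims_img_comps_less by (subst Max_less_iff) (auto simp: pset_def)
  have bound: "dims (img_comps a) \<le> m'" if "inP \<Sigma> a" "breaks a" for a
  proof -
    have "dims (img_comps a) \<in> ?dims ` pset \<Sigma>" using that by (auto simp: pset_def intro!: image_eqI[of _ _ a])
    then show ?thesis unfolding m'_def using fin by (intro Max_ge) auto
  qed
  have bound0: "{#0#} \<le> m'" unfolding m'_def using fin by (intro Max_ge) auto

  have "id \<in> unit_actions" by (simp add: unit_actions_def)
  then have "computes_info \<Sigma> UNIV (states tstep id)"
    using tstep_closed tstep_inv by (intro computes_info_states[OF finite_unit_actions]) auto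
  then obtain P d G1 where G1: "cprime \<Sigma> P G1" and d: "invariant P d"
    and G1d: "\<And>w. w \<in> lists (pset \<Sigma>) \<Longrightarrow> map d (G1 w) = states tstep id w"
    by (rule computes_info_UNIV_E) (rule that)
  let ?wr = "\<lambda>a. if breaks a then VL a else Defs.bot"
  have reg: "cprime \<Sigma> (optP \<Sigma>) (reg_run breaks ?wr Defs.bot)"
    by (rule cprime_reg_run) (auto simp: invariant_def equivariant_def breaks_inv inP_optP)
  define G where "G w = map2 Pr (map2 Pr (G1 w) (reg_run breaks ?wr Defs.bot w)) w" for w
  have G: "cprime \<Sigma> (new_poly P) G"
    unfolding new_poly_def G_def by (intro cprime_pair G1 reg cprime_id)
  have annotates: "annotates d id Defs.bot w (G w)" if "w \<in> lists (pset \<Sigma>)" for w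
    unfolding G_def using cprime_preserves[OF G1 that] G1d[OF that] by (intro annotates_build) auto

  have "computes_info (new_poly P) {w. inside (new_sys d) n0 Map.empty w} (trace (new_sys d) n0 Map.empty)"
    using new_sys_ok[OF d bound bound0] by (rule IH[OF \<open>m' < m\<close>])
  then obtain P' e H where H: "cprime (new_poly P) P' H" and e: "invariant P' e"
    and He: "\<And>w. w \<in> lists (pset (new_poly P)) \<Longrightarrow> w \<in> {w. inside (new_sys d) n0 Map.empty w} \<Longrightarrow>
      map e (H w) = trace (new_sys d) n0 Map.empty w"
    by (rule computes_infoE) (rule that)
  define F where "F w = map2 Pr (H (G w)) (G w)" for w
  have F: "cprime \<Sigma> (PProd P' (new_poly P)) F"
    unfolding F_def by (intro cprime_pair cprime_comp[OF G H] G)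
  have st: "invariant (PProd P' (new_poly P)) (fstep comps d e c)" for c
    using ftarget_inv(1)[OF d e, of c] by (auto simp: invariant_def fstep_def)
  have "computes_info (PProd P' (new_poly P)) UNIV (omealy (fstep comps d e) (fout d e) (n0, {}))"
    using finite_comps st ftarget_inv(2)[OF d e]
    by (intro computes_info_omealy[of comps]) (auto simp: comps_def fstep_def)
  from computes_info_after[OF F this] show ?thesis
  proof (rule computes_info_cong)
    fix w assume w: "w \<in> lists (pset \<Sigma>)" "w \<in> {w. inside S n0 Map.empty w}"
    have ins: "inside (new_sys d) n0 Map.empty (G w)"
      using annotates_inside[OF annotates[OF w(1)] w(1) encodes_init] w(2) by simp
    have "omealy (fstep comps d e) (fout d e) (n0, dom (Map.empty :: regs)) (map2 Pr (H (G w)) (G w)) = trace S n0 Map.empty w"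
    proof (rule annotates_trace[OF annotates[OF w(1)] w(1) encodes_init])
      show "inside S n0 Map.empty w" using w by simp
      have Gw: "G w \<in> lists (pset (new_poly P))" using cprime_preserves[OF G w(1)] by simp
      show "length (H (G w)) = length (G w)" using cprime_preserves[OF H Gw] by simp
      show "map e (H (G w)) = trace (new_sys d) n0 Map.empty (G w)" using He[OF Gw] ins by simp
      show "cod_comps S a \<subseteq> comps" if "inP \<Sigma> a" "\<not> skips S a" for a using comps_sub that by blast
    qed
    then show "omealy (fstep comps d e) (fout d e) (n0, {}) (F w) = trace S n0 Map.empty w"
      by (simp add: F_def)
  qed auto
qed

end

text \<open>The base case lies at \<open>{#0#}\<close> and not at the empty multiset, as the bound
  for a reduced system is never smaller than \<open>{#0#}\<close>.\<close>

lemma computes_info_trace: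
  assumes "sys_ok \<Sigma> m S"
  shows "computes_info \<Sigma> {w. inside S n0 Map.empty w} (trace S n0 Map.empty)"
  using assms
proof (induction m arbitrary: \<Sigma> S rule: less_induct)
  case (less m)
  show ?case
  proof (cases "m \<le> {#0#}")
    case True
    then show ?thesis using computes_info_trace_trivial less.prems by blast
  next
    case False
    interpret reduction \<Sigma> m S n0 by unfold_locales (rule less.prems)
    have "{#0#} < m" using False by (rule not_le_imp_less)
    with less.IH show ?thesis by (rule computes_info_step)
  qed
qed

section \<open>Running a single-use machine on one letter\<close>

text \<open>The number is fuel, because a machine may stay on a letter forever; \<open>None\<close>
  means rejection or lack of fuel. The result is taken just before the output is executed, so the
  registers in \<open>rs\<close> are still filled.\<close>

primrec letter_run :: "su_machine \<Rightarrow> aval \<Rightarrow> nat \<Rightarrow> nat \<Rightarrow> regs \<Rightarrow> (nat \<times> regs \<times> nat list \<times> (nat list \<Rightarrow> aval)) option" where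
  "letter_run M a 0 q \<rho> = None"
| "letter_run M a (Suc N) q \<rho> = (case answer (fst (delta M q)) a \<rho> of
     None \<Rightarrow> None
   | Some (b, \<rho>1) \<Rightarrow> (case branch M q b of (q', ac) \<Rightarrow> (case ac of
       Store r g \<Rightarrow> letter_run M a N q' (\<rho>1(r := to_reg (g a)))
     | Output rs f \<Rightarrow> if \<forall>r\<in>set rs. \<rho>1 r \<noteq> None then Some (q', \<rho>1, rs, f) else None)))"

lemma letter_run_mono: "letter_run M a N q \<rho> = Some x \<Longrightarrow> N \<le> N' \<Longrightarrow> letter_run M a N' q \<rho> = Some x"
proof (induction N arbitrary: q \<rho> N')
  case (Suc N)
  then obtain N'' where N': "N' = Suc N''" "N \<le> N''" by (cases N') auto
  show ?case using Suc.prems(1) Suc.IH[OF _ N'(2)] unfolding N'(1)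
    by (auto split: option.splits prod.splits action.splits if_splits)
qed simp

lemma letter_run_unique: "letter_run M a N q \<rho> = Some x \<Longrightarrow> letter_run M a N' q \<rho> = Some y \<Longrightarrow> x = y"
  using letter_run_mono[of M a N q \<rho> x "max N N'"] letter_run_mono[of M a N' q \<rho> y "max N N'"] by simp

lemma letter_run_defined: "letter_run M a N q \<rho> = Some (q', \<rho>1, rs, f) \<Longrightarrow> r \<in> set rs \<Longrightarrow> \<rho>1 r \<noteq> None"
  by (induction N arbitrary: q \<rho>) (auto split: option.splits prod.splits action.splits if_splits)

definition after_out :: "regs \<Rightarrow> nat list \<Rightarrow> regs" where
  "after_out \<rho> rs = (\<lambda>r. if r \<in> set rs then None else \<rho> r)"

lemma su_run_ConsD:
  assumes "su_run M q \<rho> (a # w) out"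
  obtains N q' \<rho>1 rs f out' where "letter_run M a N q \<rho> = Some (q', \<rho>1, rs, f)"
    "out = f (map (\<lambda>r. the (\<rho>1 r)) rs) # out'" "su_run M q' (after_out \<rho>1 rs) w out'"
proof -
  have "\<exists>N q' \<rho>1 rs f out'. letter_run M a N q \<rho> = Some (q', \<rho>1, rs, f) \<and>
    out = f (map (\<lambda>r. the (\<rho>1 r)) rs) # out' \<and> su_run M q' (after_out \<rho>1 rs) w out'"
    using assms
  proof (induction q \<rho> "a # w" out arbitrary: a w rule: su_run.induct)
    case (store q a \<rho> b \<rho>1 q' r g w out)
    then obtain N q2 \<rho>2 rs f out' where h: "letter_run M a N q' (\<rho>1(r := to_reg (g a))) = Some (q2, \<rho>2, rs, f)"
      "out = f (map (\<lambda>r. the (\<rho>2 r)) rs) # out'" "su_run M q2 (after_out \<rho>2 rs) w out'" by blast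
    have "letter_run M a (Suc N) q \<rho> = Some (q2, \<rho>2, rs, f)" using store.hyps h(1) by simp
    then show ?case using h(2,3) by blast
  next
    case (out q a \<rho> b \<rho>1 q' rs f w out)
    have "letter_run M a (Suc 0) q \<rho> = Some (q', \<rho>1, rs, f)" using out.hyps by simp
    then show ?case using out.hyps(4) unfolding after_out_def by blast
  qed
  then show thesis using that by blast
qed

lemma su_run_ConsI:
  "letter_run M a N q \<rho> = Some (q', \<rho>1, rs, f) \<Longrightarrow> su_run M q' (after_out \<rho>1 rs) w out' \<Longrightarrow>
   su_run M q \<rho> (a # w) (f (map (\<lambda>r. the (\<rho>1 r)) rs) # out')"
proof (induction N arbitrary: q \<rho>)
  case (Suc N)
  then show ?case
    by (auto split: option.splits prod.splits action.splits if_splits simp: after_out_def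
        intro: su_run.store su_run.out)
qed simp

lemma su_run_unique: "su_run M q \<rho> w x \<Longrightarrow> su_run M q \<rho> w y \<Longrightarrow> x = y"
proof (induction w arbitrary: q \<rho> x y)
  case Nil
  then show ?case by (auto elim: su_run.cases)
next
  case (Cons a w)
  obtain N q' \<rho>1 rs f x' where 1: "letter_run M a N q \<rho> = Some (q', \<rho>1, rs, f)"
    "x = f (map (\<lambda>r. the (\<rho>1 r)) rs) # x'" "su_run M q' (after_out \<rho>1 rs) w x'"
    using su_run_ConsD[OF Cons.prems(1)] .
  obtain N2 q2 \<rho>2 rs2 f2 y' where 2: "letter_run M a N2 q \<rho> = Some (q2, \<rho>2, rs2, f2)"
    "y = f2 (map (\<lambda>r. the (\<rho>2 r)) rs2) # y'" "su_run M q2 (after_out \<rho>2 rs2) w y'"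
    using su_run_ConsD[OF Cons.prems(2)] .
  from letter_run_unique[OF 1(1) 2(1)] show ?case using 1 2 Cons.IH by auto
qed

lemma su_fun_run: "su_fun M w = Some out \<longleftrightarrow> su_run M (init M) Map.empty w out"
proof -
  have "(THE out. su_run M (init M) Map.empty w out) = x" if "su_run M (init M) Map.empty w x" for x
    using that su_run_unique by blast
  then show ?thesis by (auto simp: su_fun_def)
qed

lemma to_reg_act [simp]: "to_reg (act \<pi> v) = map_option \<pi> (to_reg v)"
  by (auto simp: to_reg_def split: aval.split)

lemma ract_upd: "ract \<pi> (m(r := x)) = (ract \<pi> m)(r := map_option \<pi> x)"
  by (auto simp: ract_def)

lemma ract_None [simp]: "ract \<pi> m r = None \<longleftrightarrow> m r = None"
  by (auto simp: ract_def)

lemma answer_act: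
  assumes "wf_question \<Sigma> n qu" "inP \<Sigma> a" "bij \<pi>"
  shows "answer qu (act \<pi> a) (ract \<pi> \<rho>) = map_option (\<lambda>(b, \<rho>1). (b, ract \<pi> \<rho>1)) (answer qu a \<rho>)"
proof (cases qu)
  case (QLetter f)
  then have "f (act \<pi> a) = act \<pi> (f a)" "inP PBool (f a)" using assms by (auto simp: equivariant_def)
  then show ?thesis using QLetter by (auto simp: PBool_def yes_def)
next
  case (QEq r1 r2)
  have "inj \<pi>" using assms bij_is_inj by blast
  then show ?thesis using QEq
    by (auto simp: ract_upd split: option.splits) (auto simp: ract_def inj_eq)
qed

locale su =
  fixes \<Sigma> \<Gamma> :: poly and M :: su_machine
  assumes su: "su_mealy \<Sigma> \<Gamma> M"
begin

lemma wf_delta: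
  assumes "q < nQ M"
  shows "wf_question \<Sigma> (nR M) (fst (delta M q))"
    and "branch M q b = (q', ac) \<Longrightarrow> q' < nQ M \<and> wf_action \<Sigma> \<Gamma> (nR M) ac"
proof -
  obtain qu q1 a1 q2 a2 where d: "delta M q = (qu, (q1, a1), (q2, a2))" by (metis prod.exhaust)
  then have w: "wf_question \<Sigma> (nR M) qu" "q1 < nQ M" "q2 < nQ M" "wf_action \<Sigma> \<Gamma> (nR M) a1" "wf_action \<Sigma> \<Gamma> (nR M) a2"
    using su assms by (auto simp: su_mealy_def)
  show "wf_question \<Sigma> (nR M) (fst (delta M q))" using d w by simp
  show "q' < nQ M \<and> wf_action \<Sigma> \<Gamma> (nR M) ac" if "branch M q b = (q', ac)"
    using d w that by (auto simp: branch_def split: if_splits)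
qed

lemma init_less: "init M < nQ M"
  using su by (simp add: su_mealy_def)

lemma letter_run_act:
  assumes "q < nQ M" "inP \<Sigma> a" "bij \<pi>"
  shows "letter_run M (act \<pi> a) N q (ract \<pi> \<rho>) = map_option (\<lambda>(q', \<rho>1, rs, f). (q', ract \<pi> \<rho>1, rs, f)) (letter_run M a N q \<rho>)"
  using assms(1)
proof (induction N arbitrary: q \<rho>)
  case (Suc N)
  note an = answer_act[OF wf_delta(1)[OF Suc.prems] assms(2,3), of \<rho>]
  show ?case
  proof (cases "answer (fst (delta M q)) a \<rho>")
    case None then show ?thesis using an by simp
  next
    case (Some x)
    obtain b \<rho>1 where x: "x = (b, \<rho>1)" by (cases x)
    obtain q' ac where br: "branch M q b = (q', ac)" by (cases "branch M q b")
    note wf = wf_delta(2)[OF Suc.prems br]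
    show ?thesis
    proof (cases ac)
      case (Store r g)
      then have "g (act \<pi> a) = act \<pi> (g a)" using wf assms by (auto simp: equivariant_def)
      moreover have "letter_run M (act \<pi> a) N q' (ract \<pi> (\<rho>1(r := to_reg (g a)))) =
          map_option (\<lambda>(q', \<rho>1, rs, f). (q', ract \<pi> \<rho>1, rs, f)) (letter_run M a N q' (\<rho>1(r := to_reg (g a))))"
        using wf by (intro Suc.IH) simp
      ultimately show ?thesis using Some x br Store an by (simp add: ract_upd case_prod_unfold)
    next
      case (Output rs f)
      then show ?thesis using Some x br an by simp
    qed
  qed
qed simp

lemma letter_run_wf:
  "q < nQ M \<Longrightarrow> letter_run M a N q \<rho> = Some (q', \<rho>1, rs, f) \<Longrightarrow>
   q' < nQ M \<and> set rs \<subseteq> {..<nR M} \<and> equivariant_tuple (length rs) \<Gamma> f"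
proof (induction N arbitrary: q \<rho>)
  case (Suc N)
  obtain b \<rho>2 where x: "answer (fst (delta M q)) a \<rho> = Some (b, \<rho>2)"
    using Suc.prems(2) by (auto split: option.splits)
  obtain q2 ac where br: "branch M q b = (q2, ac)" by (cases "branch M q b")
  note wf = wf_delta(2)[OF Suc.prems(1) br]
  show ?case using Suc.IH wf Suc.prems x br by (auto split: action.splits if_splits)
qed simp

lemma letter_run_dom:
  "q < nQ M \<Longrightarrow> letter_run M a N q \<rho> = Some (q', \<rho>1, rs, f) \<Longrightarrow> dom \<rho> \<subseteq> {..<nR M} \<Longrightarrow> dom \<rho>1 \<subseteq> {..<nR M}"
proof (induction N arbitrary: q \<rho>)
  case (Suc N)
  obtain b \<rho>2 where x: "answer (fst (delta M q)) a \<rho> = Some (b, \<rho>2)"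
    using Suc.prems(2) by (auto split: option.splits)
  have "dom \<rho>2 \<subseteq> dom \<rho>" using x by (cases "fst (delta M q)") (auto split: option.splits if_splits)
  then have d: "dom \<rho>2 \<subseteq> {..<nR M}" using Suc.prems(3) by (rule order_trans)
  obtain q2 ac where br: "branch M q b = (q2, ac)" by (cases "branch M q b")
  note wf = wf_delta(2)[OF Suc.prems(1) br]
  show ?case
  proof (cases ac)
    case (Store r g)
    then have "dom (\<rho>2(r := to_reg (g a))) \<subseteq> {..<nR M}" using d wf by (auto split: if_splits)
    moreover have "letter_run M a N q2 (\<rho>2(r := to_reg (g a))) = Some (q', \<rho>1, rs, f)"
      using Store Suc.prems x br by simp
    ultimately show ?thesis using wf Suc.IH by blast
  next
    case (Output rs f)
    then show ?thesis using Suc.prems x br d by (auto split: if_splits)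
  qed
qed simp

text \<open>Register contents and letter together form an element of a polynomial orbit-finite set.
  The least sufficient fuel is invariant under renaming, so it takes finitely many values for each
  state.\<close>

lemma uniform_fuel:
  "\<exists>N. \<forall>q \<rho> a N'. q < nQ M \<longrightarrow> dom \<rho> \<subseteq> {..<nR M} \<longrightarrow> inP \<Sigma> a \<longrightarrow> letter_run M a N' q \<rho> \<noteq> None \<longrightarrow>
     letter_run M a N q \<rho> = letter_run M a N' q \<rho>"
proof -
  define dec where "dec u = (\<lambda>r. if r < nR M then to_reg (proj (nR M) u r) else None)" for u
  \<comment> \<open>Renaming does not affect whether a run with given fuel ends, so
    \<open>L q\<close> is invariant even where no fuel suffices and its value is
    meaningless.\<close>
  define L where "L q v = (LEAST N. letter_run M (vsnd v) N q (dec (vfst v)) \<noteq> None)" for q v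
  let ?P = "PProd (tupP PAtomBot (nR M)) \<Sigma>"
  have dec_act: "dec (act \<pi> u) = ract \<pi> (dec u)" if "inP (tupP PAtomBot (nR M)) u" for u \<pi>
    by (rule ext) (simp add: dec_def proj_act[OF that] ract_def)
  have "invariant ?P (L q)" if "q < nQ M" for q
    using that by (auto simp: invariant_def L_def dec_act letter_run_act simp del: not_None_eq)
  then have "finite (\<Union>q\<in>{..<nQ M}. L q ` pset ?P)" using finite_range_invariant by blast
  then obtain N where N: "\<forall>x\<in>(\<Union>q\<in>{..<nQ M}. L q ` pset ?P). x \<le> N"
    unfolding finite_nat_set_iff_bounded_le by blast
  have "letter_run M a N q \<rho> = letter_run M a N' q \<rho>"
    if h: "q < nQ M" "dom \<rho> \<subseteq> {..<nR M}" "inP \<Sigma> a" "letter_run M a N' q \<rho> \<noteq> None" for q \<rho> a N'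
  proof -
    define f where "f r = (case \<rho> r of Some x \<Rightarrow> VL (Atm x) | None \<Rightarrow> Defs.bot)" for r
    let ?v = "Pr (tup (nR M) f) a"
    have v: "?v \<in> pset ?P"
      using h(3) by (auto simp: pset_def f_def PAtomBot_def bot_def intro!: inP_tup split: option.split)
    have "dec (vfst ?v) = \<rho>"
      using h(2) by (auto simp: dec_def proj_tup f_def to_reg_def bot_def fun_eq_iff split: option.split)
    then have L: "L q ?v = (LEAST N. letter_run M a N q \<rho> \<noteq> None)" by (simp add: L_def)
    have "letter_run M a (L q ?v) q \<rho> \<noteq> None" unfolding L using h(4) by (rule LeastI)
    then obtain x where x: "letter_run M a (L q ?v) q \<rho> = Some x" by auto
    have "L q ?v \<le> N" using N v h(1) by blast
    then have "letter_run M a N q \<rho> = Some x" by (rule letter_run_mono[OF x])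
    moreover obtain y where y: "letter_run M a N' q \<rho> = Some y" using h(4) by auto
    ultimately show ?thesis using letter_run_unique[OF x y] by simp
  qed
  then show ?thesis by blast
qed

end

section \<open>From single-use machines to systems of decision trees\<close>

lemma eval_tree_map_dtree [simp]: "eval_tree (map_dtree f t) \<rho> = f (eval_tree t \<rho>)"
  by (induction t) auto

lemma path_of_map_dtree [simp]: "path_of (map_dtree f t) \<rho> = path_of t \<rho>"
  by (induction t) auto

lemma map_dtree_tact:
  assumes "\<And>l. g (f l) = f' (h l)"
  shows "tact \<pi> g (map_dtree f t) = map_dtree f' (tact \<pi> h t)"
  using assms by (induction t) auto

text \<open>While reading a letter, the registers in \<open>K\<close> still hold the value that they had before
  the letter, and those in \<open>dom m\<close> hold atoms of the letter. A leaf records this together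
  with the output action that ends the processing of the letter.\<close>

type_synonym out_info = "(nat \<times> nat set \<times> regs \<times> nat list \<times> (nat list \<Rightarrow> aval)) option"

text \<open>A comparison enters the tree only if it involves a content older than the letter. Two
  known atoms are compared at once, and a register equals itself.\<close>

definition eq_test_tree :: "nat \<Rightarrow> nat \<Rightarrow> regs \<Rightarrow> 'l dtree \<Rightarrow> 'l dtree \<Rightarrow> 'l dtree" where
  "eq_test_tree r1 r2 m t u = (if r1 = r2 then t else
     (case m r1 of
        None \<Rightarrow> Test r1 (case m r2 of None \<Rightarrow> R r2 | Some c \<Rightarrow> C c) t u
      | Some c \<Rightarrow> (case m r2 of None \<Rightarrow> Test r2 (C c) t u | Some c' \<Rightarrow> if c = c' then t else u)))"

definition action_tree :: "aval \<Rightarrow> (nat \<Rightarrow> nat set \<Rightarrow> regs \<Rightarrow> out_info dtree) \<Rightarrow> nat \<times> action \<Rightarrow> nat set \<Rightarrow> regs \<Rightarrow> out_info dtree" where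
  "action_tree a k x K m = (case snd x of
     Store r g \<Rightarrow> k (fst x) (K - {r}) (m(r := to_reg (g a)))
   | Output rs f \<Rightarrow> Leaf (if set rs \<subseteq> K \<union> dom m then Some (fst x, K, m, rs, f) else None))"

primrec letter_tree :: "su_machine \<Rightarrow> aval \<Rightarrow> nat \<Rightarrow> nat \<Rightarrow> nat set \<Rightarrow> regs \<Rightarrow> out_info dtree" where
  "letter_tree M a 0 q K m = Leaf None"
| "letter_tree M a (Suc N) q K m = (case fst (delta M q) of
     QLetter f \<Rightarrow> action_tree a (letter_tree M a N) (branch M q (f a = yes)) K m
   | QEq r1 r2 \<Rightarrow> (if r1 \<in> K \<union> dom m \<and> r2 \<in> K \<union> dom m
       then eq_test_tree r1 r2 m
         (action_tree a (letter_tree M a N) (branch M q True) (K - {r1, r2}) (m(r1 := None, r2 := None)))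
         (action_tree a (letter_tree M a N) (branch M q False) (K - {r1, r2}) (m(r1 := None, r2 := None)))
       else Leaf None))"

definition concretize :: "regs \<Rightarrow> out_info \<Rightarrow> (nat \<times> regs \<times> nat list \<times> (nat list \<Rightarrow> aval)) option" where
  "concretize \<rho> = map_option (\<lambda>(q', K, m, rs, f). (q', \<rho> |` K ++ m, rs, f))"

lemma upd_config: "(\<rho> |` K ++ m)(r := v) = \<rho> |` (K - {r}) ++ m(r := v)"
  by (rule ext) (auto simp: map_add_def restrict_map_def split: option.splits)

lemma eval_tree_qtest:
  assumes "r1 \<in> K \<union> dom m" "r2 \<in> K \<union> dom m"
  shows "eval_tree (eq_test_tree r1 r2 m t u) \<rho> = (if (\<rho> |` K ++ m) r1 = (\<rho> |` K ++ m) r2 then eval_tree t \<rho> else eval_tree u \<rho>)"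
  using assms by (auto simp: eq_test_tree_def map_add_def restrict_map_def split: option.splits)

lemma letter_tree_correct:
  assumes "K \<subseteq> dom \<rho>"
  shows "letter_run M a N q (\<rho> |` K ++ m) = concretize \<rho> (eval_tree (letter_tree M a N q K m) \<rho>)"
  using assms
proof (induction N arbitrary: q K m)
  case 0 show ?case by (simp add: concretize_def)
next
  case (Suc N)
  have as: "(case x of (q', ac) \<Rightarrow> (case ac of
       Store r g \<Rightarrow> letter_run M a N q' ((\<rho> |` K ++ m)(r := to_reg (g a)))
     | Output rs f \<Rightarrow> if \<forall>r\<in>set rs. (\<rho> |` K ++ m) r \<noteq> None then Some (q', \<rho> |` K ++ m, rs, f) else None))
    = concretize \<rho> (eval_tree (action_tree a (letter_tree M a N) x K m) \<rho>)" if K: "K \<subseteq> dom \<rho>" for x K m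
  proof (cases x)
    case (Pair q' ac)
    show ?thesis
    proof (cases ac)
      case (Store r g)
      have "K - {r} \<subseteq> dom \<rho>" using K by auto
      then have "letter_run M a N q' (\<rho> |` (K - {r}) ++ m(r := to_reg (g a))) =
          concretize \<rho> (eval_tree (letter_tree M a N q' (K - {r}) (m(r := to_reg (g a)))) \<rho>)" by (rule Suc.IH)
      then show ?thesis using Pair Store unfolding upd_config by (simp add: action_tree_def)
    next
      case (Output rs f)
      have "(\<forall>r\<in>set rs. (\<rho> |` K ++ m) r \<noteq> None) \<longleftrightarrow> set rs \<subseteq> K \<union> dom m"
        using K by (auto simp: map_add_def restrict_map_def split: option.splits)
      then show ?thesis using Pair Output by (simp add: action_tree_def concretize_def)
    qed
  qed
  show ?case
  proof (cases "fst (delta M q)")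
    case (QLetter f)
    then show ?thesis
      by (simp only: letter_run.simps answer.simps option.case prod.case letter_tree.simps question.case as[OF Suc.prems])
  next
    case (QEq r1 r2)
    let ?c = "\<rho> |` K ++ m"
    let ?m = "m(r1 := None, r2 := None)"
    have d: "?c r = None \<longleftrightarrow> r \<notin> K \<union> dom m" for r
      using Suc.prems by (auto simp: map_add_def restrict_map_def split: option.splits)
    have K': "K - {r1, r2} \<subseteq> dom \<rho>" using Suc.prems by auto
    have u: "?c(r1 := None, r2 := None) = \<rho> |` (K - {r1, r2}) ++ ?m"
      unfolding upd_config by (simp add: Diff_insert[symmetric] insert_commute)
    show ?thesis
    proof (cases "r1 \<in> K \<union> dom m \<and> r2 \<in> K \<union> dom m")
      case True
      then have "?c r1 \<noteq> None" "?c r2 \<noteq> None" using d[of r1] d[of r2] by simp_all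
      then obtain x y where xy: "?c r1 = Some x" "?c r2 = Some y" unfolding not_None_eq by (elim exE)
      then have an: "answer (fst (delta M q)) a ?c = Some (x = y, \<rho> |` (K - {r1, r2}) ++ ?m)"
        using QEq u by simp
      have "letter_run M a (Suc N) q ?c = concretize \<rho> (eval_tree (action_tree a (letter_tree M a N) (branch M q (x = y)) (K - {r1, r2}) ?m) \<rho>)"
        by (simp only: letter_run.simps an option.case prod.case as[OF K'])
      also have "\<dots> = concretize \<rho> (eval_tree (letter_tree M a (Suc N) q K m) \<rho>)"
        using True QEq xy by (simp add: eval_tree_qtest[of r1 K m r2] del: map_add_Some_iff)
      finally show ?thesis .
    next
      case False
      then have "?c r1 = None \<or> ?c r2 = None" using d[of r1] d[of r2] by simp
      then have "answer (fst (delta M q)) a ?c = None" using QEq by (auto split: option.split)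
      then have "letter_run M a (Suc N) q ?c = None" by (simp only: letter_run.simps option.case)
      moreover have "letter_tree M a (Suc N) q K m = Leaf None"
        using False QEq by (simp only: letter_tree.simps question.case if_False)
      ultimately show ?thesis by (simp add: concretize_def del: letter_run.simps letter_tree.simps)
    qed
  qed
qed

text \<open>Rejection and lack of fuel lead to a sink without registers, whose index
  \<open>nQ M\<close> is one past the states. Otherwise the output consumes the registers in
  \<open>rs\<close>.\<close>

definition to_leaf :: "su_machine \<Rightarrow> out_info \<Rightarrow> leaf" where
  "to_leaf M x = (case x of None \<Rightarrow> (Base (nQ M), {}, Map.empty)
     | Some (q', K, m, rs, f) \<Rightarrow> (Base q', K - set rs, m |` (- set rs)))"

lemma tree_tree_ok_eq_test:
  assumes "tree_ok (K - {r1, r2}) t" "tree_ok (K - {r1, r2}) u" "r1 \<in> K \<union> dom m" "r2 \<in> K \<union> dom m"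
  shows "tree_ok K (eq_test_tree r1 r2 m t u)"
proof -
  have *: "tree_ok K' t \<and> tree_ok K' u" if "K - {r1, r2} \<subseteq> K'" for K' using assms tree_ok_mono that by blast
  show ?thesis using assms(3,4)
    by (auto simp: eq_test_tree_def split: option.split intro!: *[THEN conjunct1] *[THEN conjunct2])
qed

lemma map_dtree_qtest: "map_dtree f (eq_test_tree r1 r2 m t u) = eq_test_tree r1 r2 m (map_dtree f t) (map_dtree f u)"
  by (auto simp: eq_test_tree_def split: option.split)

lemma lvs_qtest: "lvs (eq_test_tree r1 r2 m t u) \<subseteq> lvs t \<union> lvs u"
  by (auto simp: eq_test_tree_def split: option.split)

lemma letter_tree_ok: "finite (dom m) \<Longrightarrow> K \<inter> dom m = {} \<Longrightarrow> tree_ok K (map_dtree (to_leaf M) (letter_tree M a N q K m))"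
proof (induction N arbitrary: q K m)
  case 0 show ?case by (simp add: to_leaf_def)
next
  case (Suc N)
  have as: "tree_ok K (map_dtree (to_leaf M) (action_tree a (letter_tree M a N) x K m))"
    if "finite (dom m)" "K \<inter> dom m = {}" for x K m
  proof (cases "snd x")
    case (Store r g)
    have d: "finite (dom (m(r := to_reg (g a))))" "(K - {r}) \<inter> dom (m(r := to_reg (g a))) = {}"
      using that by auto
    have "tree_ok (K - {r}) (map_dtree (to_leaf M) (letter_tree M a N (fst x) (K - {r}) (m(r := to_reg (g a)))))"
      by (rule Suc.IH[OF d])
    then show ?thesis using Store tree_ok_mono by (fastforce simp: action_tree_def)
  next
    case (Output rs f)
    then show ?thesis using that by (auto simp: action_tree_def to_leaf_def)
  qed
  show ?case
  proof (cases "fst (delta M q)")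
    case (QLetter f) then show ?thesis using as Suc.prems by simp
  next
    case (QEq r1 r2)
    have "finite (dom (m(r1 := None, r2 := None)))" "(K - {r1, r2}) \<inter> dom (m(r1 := None, r2 := None)) = {}"
      using Suc.prems by auto
    note as' = as[OF this]
    show ?thesis
    proof (cases "r1 \<in> K \<union> dom m \<and> r2 \<in> K \<union> dom m")
      case True
      then show ?thesis using QEq tree_tree_ok_eq_test[OF as' as'] by (simp add: map_dtree_qtest)
    next
      case False then show ?thesis using QEq by (auto simp: to_leaf_def)
    qed
  qed
qed

text \<open>Only stored atoms are renamed; \<open>rs\<close> and \<open>f\<close> are part of the
  machine.\<close>

definition iact :: "(nat \<Rightarrow> nat) \<Rightarrow> out_info \<Rightarrow> out_info" where
  "iact \<pi> = map_option (\<lambda>(q', K, m, rs, f). (q', K, ract \<pi> m, rs, f))"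

lemma iact_None [simp]: "iact \<pi> None = None"
  by (simp add: iact_def)

lemma to_leaf_iact: "lact \<pi> (to_leaf M x) = to_leaf M (iact \<pi> x)"
  by (auto simp: to_leaf_def iact_def ract_def restrict_map_def fun_eq_iff split: option.split)

lemma eq_test_tree_tact:
  "inj \<pi> \<Longrightarrow> eq_test_tree r1 r2 (ract \<pi> m) (tact \<pi> f t) (tact \<pi> f u) = tact \<pi> f (eq_test_tree r1 r2 m t u)"
  by (auto simp: eq_test_tree_def ract_def inj_eq split: option.split)

context su
begin

lemma letter_tree_act:
  assumes "q < nQ M" "inP \<Sigma> a" "bij \<pi>"
  shows "letter_tree M (act \<pi> a) N q K (ract \<pi> m) = tact \<pi> (iact \<pi>) (letter_tree M a N q K m)"
  using assms(1)
proof (induction N arbitrary: q K m)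
  case 0 show ?case by (simp add: iact_def)
next
  case (Suc N)
  have as: "action_tree (act \<pi> a) (letter_tree M (act \<pi> a) N) (branch M q b) K (ract \<pi> m) =
      tact \<pi> (iact \<pi>) (action_tree a (letter_tree M a N) (branch M q b) K m)" for b K m
  proof -
    obtain q' ac where br: "branch M q b = (q', ac)" by (cases "branch M q b")
    note wf = wf_delta(2)[OF Suc.prems br]
    show ?thesis
    proof (cases ac)
      case (Store r g)
      then have "g (act \<pi> a) = act \<pi> (g a)" using wf assms by (auto simp: equivariant_def)
      moreover have "letter_tree M (act \<pi> a) N q' (K - {r}) (ract \<pi> (m(r := to_reg (g a)))) =
          tact \<pi> (iact \<pi>) (letter_tree M a N q' (K - {r}) (m(r := to_reg (g a))))"
        using wf by (intro Suc.IH) simp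
      ultimately show ?thesis using br Store by (simp add: action_tree_def ract_upd)
    next
      case (Output rs f)
      then show ?thesis using br by (simp add: action_tree_def iact_def)
    qed
  qed
  show ?case
  proof (cases "fst (delta M q)")
    case (QLetter f)
    then have "f (act \<pi> a) = act \<pi> (f a)" "inP PBool (f a)"
      using wf_delta(1)[OF Suc.prems] assms by (auto simp: equivariant_def)
    then have "f (act \<pi> a) = yes \<longleftrightarrow> f a = yes" by (auto simp: PBool_def yes_def)
    then show ?thesis using QLetter as by simp
  next
    case (QEq r1 r2)
    have "(ract \<pi> m)(r1 := None, r2 := None) = ract \<pi> (m(r1 := None, r2 := None))" by (simp add: ract_upd)
    then show ?thesis using QEq as by (simp add: eq_test_tree_tact[OF bij_is_inj[OF assms(3)]])
  qed
qed

lemma letter_tree_leaf: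
  "q < nQ M \<Longrightarrow> Some (q', K', m', rs, f) \<in> lvs (letter_tree M a N q K m) \<Longrightarrow>
   q' < nQ M \<and> set rs \<subseteq> {..<nR M} \<and> equivariant_tuple (length rs) \<Gamma> f \<and>
   (K \<union> dom m \<subseteq> {..<nR M} \<longrightarrow> K' \<union> dom m' \<subseteq> {..<nR M})"
proof (induction N arbitrary: q K m)
  case (Suc N)
  have as: "q' < nQ M \<and> set rs \<subseteq> {..<nR M} \<and> equivariant_tuple (length rs) \<Gamma> f \<and>
      (K \<union> dom m \<subseteq> {..<nR M} \<longrightarrow> K' \<union> dom m' \<subseteq> {..<nR M})"
    if "Some (q', K', m', rs, f) \<in> lvs (action_tree a (letter_tree M a N) (branch M q b) K m)" for b K m
  proof -
    obtain q2 ac where br: "branch M q b = (q2, ac)" by (cases "branch M q b")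
    note wf = wf_delta(2)[OF Suc.prems(1) br]
    show ?thesis
    proof (cases ac)
      case (Store r g)
      have "K - {r} \<union> dom (m(r := to_reg (g a))) \<subseteq> {..<nR M}" if "K \<union> dom m \<subseteq> {..<nR M}"
        using that wf Store by (auto split: if_splits)
      moreover have "Some (q', K', m', rs, f) \<in> lvs (letter_tree M a N q2 (K - {r}) (m(r := to_reg (g a))))"
        using that Store br by (simp add: action_tree_def)
      ultimately show ?thesis using Suc.IH wf by blast
    next
      case (Output rs f)
      then show ?thesis using that br wf by (auto simp: action_tree_def split: if_splits)
    qed
  qed
  show ?case
  proof (cases "fst (delta M q)")
    case (QLetter f) then show ?thesis using as Suc.prems by simp
  next
    case (QEq r1 r2)
    let ?m = "m(r1 := None, r2 := None)" and ?K = "K - {r1, r2}"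
    have "\<exists>b. Some (q', K', m', rs, f) \<in> lvs (action_tree a (letter_tree M a N) (branch M q b) ?K ?m)"
      using Suc.prems(2) QEq lvs_qtest[of r1 r2 m "action_tree a (letter_tree M a N) (branch M q True) ?K ?m"
        "action_tree a (letter_tree M a N) (branch M q False) ?K ?m"]
      by (auto split: if_splits)
    then obtain b where b: "Some (q', K', m', rs, f) \<in> lvs (action_tree a (letter_tree M a N) (branch M q b) ?K ?m)" ..
    have "?K \<union> dom ?m \<subseteq> K \<union> dom m" by auto
    then show ?thesis using as[OF b] by blast
  qed
qed simp

text \<open>The range \<open>{..nQ M}\<close> includes the index of the sink.\<close>

definition all_comps :: "comp set" where
  "all_comps = (\<lambda>(q, V). (Base q, V)) ` ({..nQ M} \<times> Pow {..<nR M})"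

definition machine_trees :: "nat \<Rightarrow> aval \<Rightarrow> comp \<Rightarrow> leaf dtree" where
  "machine_trees N a c = (case fst c of
     Base q \<Rightarrow> if q < nQ M then map_dtree (to_leaf M) (letter_tree M a N q (snd c) Map.empty) else Leaf (to_leaf M None)
   | Ext _ _ _ \<Rightarrow> Leaf (to_leaf M None))"

definition machine_sys :: "nat \<Rightarrow> sys" where
  "machine_sys N = \<lparr> skips = \<lambda>_. False, dom_comps = \<lambda>_. all_comps, cod_comps = \<lambda>_. all_comps, trees = machine_trees N \<rparr>"

lemma all_comps_iff: "(n, V) \<in> all_comps \<longleftrightarrow> (\<exists>q \<le> nQ M. n = Base q) \<and> V \<subseteq> {..<nR M}"
  by (auto simp: all_comps_def image_iff)

lemma finite_all_comps: "finite all_comps"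
  by (simp add: all_comps_def)

lemma machine_sys_ok: "sys_ok \<Sigma> (dims all_comps) (machine_sys N)"
proof -
  have d: "leaf_comp (to_leaf M None) \<in> all_comps"
    by (simp add: to_leaf_def all_comps_iff)
  have eq: "machine_trees N (act \<pi> a) c = tact \<pi> (lact \<pi>) (machine_trees N a c)" if "inP \<Sigma> a" "bij \<pi>" for a \<pi> c
  proof -
    have "letter_tree M (act \<pi> a) N q K Map.empty = tact \<pi> (iact \<pi>) (letter_tree M a N q K Map.empty)" if "q < nQ M" for q K
      using letter_tree_act[OF that \<open>inP \<Sigma> a\<close> \<open>bij \<pi>\<close>, of N K Map.empty] by simp
    moreover have "lact \<pi> (to_leaf M None) = to_leaf M None" by (simp add: to_leaf_def)
    ultimately show ?thesis
      by (simp add: machine_trees_def map_dtree_tact[of "lact \<pi>" "to_leaf M" "to_leaf M" "iact \<pi>", OF to_leaf_iact] split: name.split)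
  qed
  have "finite (snd c) \<and> tree_ok (snd c) (machine_trees N a c) \<and> leaf_comp ` lvs (machine_trees N a c) \<subseteq> all_comps"
    if c: "c \<in> all_comps" for a c
  proof -
    obtain q V where cq: "c = (Base q, V)" "q \<le> nQ M" "V \<subseteq> {..<nR M}"
      using c by (auto simp: all_comps_def)
    have f: "finite V" using cq finite_subset by blast
    show ?thesis
    proof (cases "q < nQ M")
      case True
      have "leaf_comp (to_leaf M x) \<in> all_comps" if x: "x \<in> lvs (letter_tree M a N q V Map.empty)" for x
      proof (cases x)
        case None then show ?thesis using d by simp
      next
        case (Some y)
        obtain q' K' m' rs g where y: "y = (q', K', m', rs, g)" by (cases y)
        have "q' < nQ M" "K' \<union> dom m' \<subseteq> {..<nR M}" using letter_tree_leaf[OF True, of q' K' m' rs g] x Some y cq(3) by auto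
        then show ?thesis using Some y by (auto simp: to_leaf_def all_comps_iff)
      qed
      then show ?thesis using f cq True letter_tree_ok[of Map.empty V M a N q]
        by (auto simp: machine_trees_def dtree.set_map)
    next
      case False
      then show ?thesis using f cq d by (auto simp: machine_trees_def to_leaf_def)
    qed
  qed
  then show ?thesis unfolding sys_ok_def good_def
    using eq finite_all_comps by (simp add: machine_sys_def invariant_def)
qed

lemma machine_sys_inside: "(n, dom \<rho>) \<in> all_comps \<Longrightarrow> w \<in> lists (pset \<Sigma>) \<Longrightarrow> inside (machine_sys N) n \<rho> w"
proof (induction w arbitrary: n \<rho>)
  case (Cons a w)
  interpret reduction \<Sigma> "dims all_comps" "machine_sys N" n by unfold_locales (rule machine_sys_ok)
  obtain n2 K m where e: "eval_tree (trees (machine_sys N) a (n, dom \<rho>)) \<rho> = (n2, K, m)" by (metis prod_cases3)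
  have a: "inP \<Sigma> a" "\<not> skips (machine_sys N) a" "(n, dom \<rho>) \<in> dom_comps (machine_sys N) a"
    using Cons.prems by (auto simp: pset_def machine_sys_def)
  have "(n2, dom (\<rho> |` K ++ m)) \<in> all_comps"
    using next_dom[OF a e] by (simp add: machine_sys_def del: dom_map_add)
  then show ?case using Cons a e by simp
qed simp

end

section \<open>Producing the output\<close>

context su
begin

text \<open>\<open>to_leaf\<close> relabels leaves without changing the shape of the tree, so a path
  recorded in the trace is valid in \<open>letter_tree\<close>, whose leaf still has the output
  action.\<close>

definition info :: "nat \<Rightarrow> (aval \<Rightarrow> (name \<times> nat set \<times> bool list) option) \<Rightarrow> aval \<Rightarrow> out_info" where
  "info N d v = (case d (vfst v) of
     Some (Base q, V, p) \<Rightarrow> if q < nQ M then leaf_at (letter_tree M (vsnd v) N q V Map.empty) p else None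
   | _ \<Rightarrow> None)"

text \<open>Tests read nothing here, as the path gives their outcomes. Only outputs use contents,
  and contents that are atoms of the current letter come from \<open>m\<close>.\<close>

definition reads :: "nat \<Rightarrow> (aval \<Rightarrow> (name \<times> nat set \<times> bool list) option) \<Rightarrow> nat \<Rightarrow> aval \<Rightarrow> bool" where
  "reads N d r v = (case info N d v of Some (q', K, m, rs, f) \<Rightarrow> r \<in> set rs \<and> r \<in> K | None \<Rightarrow> False)"

definition writes :: "nat \<Rightarrow> (aval \<Rightarrow> (name \<times> nat set \<times> bool list) option) \<Rightarrow> nat \<Rightarrow> aval \<Rightarrow> aval" where
  "writes N d r v = (case info N d v of
     Some (q', K, m, rs, f) \<Rightarrow> (case m r of Some c \<Rightarrow> if r \<in> set rs then Defs.bot else VL (Atm c) | None \<Rightarrow> Defs.bot)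
   | None \<Rightarrow> Defs.bot)"

definition rval :: "regs \<Rightarrow> (nat \<Rightarrow> aval) \<Rightarrow> regs" where
  "rval m g r = (case m r of Some c \<Rightarrow> Some c | None \<Rightarrow> to_reg (g r))"

text \<open>Fallback for letters that carry inconsistent annotations: the output of the machine on the
  one-letter word. An arbitrary constant would not do, since \<open>\<Gamma>\<close> may have no equivariant element.\<close>

definition default_output :: "aval \<Rightarrow> aval" where
  "default_output a = hd (the (su_fun M [a]))"

definition output_of :: "nat \<Rightarrow> (aval \<Rightarrow> (name \<times> nat set \<times> bool list) option) \<Rightarrow> aval \<Rightarrow> (nat \<Rightarrow> aval) \<Rightarrow> aval" where
  "output_of N d v g = (case info N d v of
     Some (q', K, m, rs, f) \<Rightarrow> if \<forall>r\<in>set rs. rval m g r \<noteq> None then f (map (\<lambda>r. the (rval m g r)) rs) else default_output (vsnd v)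
   | None \<Rightarrow> default_output (vsnd v))"

lemma info_cases:
  assumes "info N d v = Some (q', K, m, rs, f)"
  shows "set rs \<subseteq> {..<nR M} \<and> equivariant_tuple (length rs) \<Gamma> f"
proof -
  obtain q V p where "q < nQ M" "leaf_at (letter_tree M (vsnd v) N q V Map.empty) p = Some (q', K, m, rs, f)"
    using assms by (auto simp: info_def split: option.splits name.splits if_splits)
  then show ?thesis using letter_tree_leaf leaf_at_in_lvs by metis
qed

lemma info_act:
  assumes "invariant P d" "inP (PProd P \<Sigma>) v" "bij \<pi>"
  shows "info N d (act \<pi> v) = iact \<pi> (info N d v)"
proof -
  obtain x a where v: "v = Pr x a" "inP P x" "inP \<Sigma> a" using assms(2) by auto
  have "letter_tree M (act \<pi> a) N q K Map.empty = tact \<pi> (iact \<pi>) (letter_tree M a N q K Map.empty)" if "q < nQ M" for q K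
    using letter_tree_act[OF that v(3) assms(3), of N K Map.empty] by simp
  then show ?thesis using v invariantD[OF assms(1,3) v(2)]
    by (auto simp: info_def split: option.split name.split)
qed

lemma reads_inv:
  assumes "invariant P d"
  shows "invariant (PProd P \<Sigma>) (reads N d r)"
  unfolding invariant_def
proof (intro allI impI)
  fix \<pi> :: "nat \<Rightarrow> nat" and v assume "bij \<pi>" "inP (PProd P \<Sigma>) v"
  then show "reads N d r (act \<pi> v) = reads N d r v" unfolding reads_def
    by (subst info_act[OF assms]) (auto simp: iact_def split: option.split)
qed

lemma writes_equivariant:
  assumes "invariant P d"
  shows "equivariant (PProd P \<Sigma>) PAtomBot (writes N d r)"
proof -
  have "writes N d r (act \<pi> v) = act \<pi> (writes N d r v)" if "bij \<pi>" "inP (PProd P \<Sigma>) v" for \<pi> v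
    unfolding writes_def
    by (subst info_act[OF assms that(2,1)]) (auto simp: iact_def ract_def split: option.split)
  moreover have "inP PAtomBot (writes N d r v)" for v
    by (auto simp: writes_def PAtomBot_def bot_def split: option.split)
  ultimately show ?thesis by (auto simp: equivariant_def)
qed

text \<open>Totality on one-letter words provides the value, and the equivariance of runs on one
  letter carries over to it.\<close>

lemma default_output_props:
  assumes "\<forall>w \<in> lists (pset \<Sigma>). su_fun M w \<noteq> None" "inP \<Sigma> a" "bij \<pi>"
  shows "inP \<Gamma> (default_output a)" "default_output (act \<pi> a) = act \<pi> (default_output a)"
proof -
  have "su_fun M [a] \<noteq> None" using assms by (auto simp: pset_def)
  then obtain out where "su_run M (init M) Map.empty [a] out" using su_fun_run by auto
  then obtain N q' \<rho>1 rs f where l: "letter_run M a N (init M) Map.empty = Some (q', \<rho>1, rs, f)"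
    by (rule su_run_ConsD)
  have run: "su_fun M [b] = Some [f (map (\<lambda>r. the (\<rho> r)) rs)]"
    if "letter_run M b N (init M) Map.empty = Some (q', \<rho>, rs, f)" for b \<rho>
    unfolding su_fun_run using su_run_ConsI[OF that su_run.finish] .
  have wf: "equivariant_tuple (length rs) \<Gamma> f" using letter_run_wf[OF init_less l] by simp
  have da: "default_output a = f (map (\<lambda>r. the (\<rho>1 r)) rs)" using run[OF l] by (simp add: default_output_def)
  then show "inP \<Gamma> (default_output a)" using wf by (simp add: equivariant_tuple_def)
  have "letter_run M (act \<pi> a) N (init M) Map.empty = Some (q', ract \<pi> \<rho>1, rs, f)"
    using letter_run_act[OF init_less assms(2,3), of N Map.empty] l by simp
  then have "default_output (act \<pi> a) = f (map (\<lambda>r. the (ract \<pi> \<rho>1 r)) rs)" using run by (simp add: default_output_def)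
  also have "map (\<lambda>r. the (ract \<pi> \<rho>1 r)) rs = map \<pi> (map (\<lambda>r. the (\<rho>1 r)) rs)"
    using letter_run_defined[OF l] by (auto simp: ract_def option.map_sel simp del: not_None_eq)
  also have "f \<dots> = act \<pi> (default_output a)"
    using wf assms(3) da by (simp add: equivariant_tuple_def del: map_map)
  finally show "default_output (act \<pi> a) = act \<pi> (default_output a)" .
qed

lemma output_of_equivariant:
  assumes tot: "\<forall>w \<in> lists (pset \<Sigma>). su_fun M w \<noteq> None" and d: "invariant P d"
  shows "equivariant (PProd (tupP PAtomBot (nR M)) (PProd P \<Sigma>)) \<Gamma> (\<lambda>v. output_of N d (vsnd v) (proj (nR M) (vfst v)))"
proof -
  have main: "inP \<Gamma> (output_of N d v (proj (nR M) u)) \<and>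
      output_of N d (act \<pi> v) (proj (nR M) (act \<pi> u)) = act \<pi> (output_of N d v (proj (nR M) u))"
    if u: "inP (tupP PAtomBot (nR M)) u" and v: "inP (PProd P \<Sigma>) v" and \<pi>: "bij \<pi>" for u v \<pi>
  proof -
    let ?g = "proj (nR M) u" and ?g' = "proj (nR M) (act \<pi> u)"
    obtain x a where xa: "v = Pr x a" "inP \<Sigma> a" using v by auto
    note df = default_output_props[OF tot xa(2) \<pi>]
    have rv: "rval (ract \<pi> m) ?g' r = map_option \<pi> (rval m ?g r)" for m r
      by (auto simp: rval_def ract_def proj_act[OF u] split: option.split)
    note ia = info_act[OF d v \<pi>, of N]
    show ?thesis
    proof (cases "info N d v")
      case None
      then show ?thesis using ia df xa by (simp add: output_of_def)
    next
      case (Some y)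
      obtain q' K m rs f where y: "y = (q', K, m, rs, f)" by (cases y)
      have wf: "equivariant_tuple (length rs) \<Gamma> f" using info_cases Some y by blast
      have i: "info N d (act \<pi> v) = Some (q', K, ract \<pi> m, rs, f)" using ia Some y by (simp add: iact_def)
      show ?thesis
      proof (cases "\<forall>r\<in>set rs. rval m ?g r \<noteq> None")
        case True
        have "output_of N d (act \<pi> v) ?g' = f (map (\<lambda>r. the (map_option \<pi> (rval m ?g r))) rs)"
          using True i by (simp add: output_of_def rv)
        also have "map (\<lambda>r. the (map_option \<pi> (rval m ?g r))) rs = map \<pi> (map (\<lambda>r. the (rval m ?g r)) rs)"
          using True by (auto simp: option.map_sel)
        also have "f \<dots> = act \<pi> (f (map (\<lambda>r. the (rval m ?g r)) rs))"
          using wf \<pi> by (simp add: equivariant_tuple_def del: map_map)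
        finally show ?thesis using True Some y wf by (simp add: output_of_def equivariant_tuple_def)
      next
        case False
        then have "output_of N d v ?g = default_output a" using Some y xa by (auto simp: output_of_def)
        moreover have "output_of N d (act \<pi> v) ?g' = default_output (act \<pi> a)" using False i xa by (auto simp: output_of_def rv)
        ultimately show ?thesis using df by simp
      qed
    qed
  qed
  then have "inP \<Gamma> (output_of N d v (proj (nR M) u))"
    if "inP (tupP PAtomBot (nR M)) u" "inP (PProd P \<Sigma>) v" for u v
    using that bij_id by blast
  note pos = this
  show ?thesis
    unfolding equivariant_def inP.simps(3)[of "tupP PAtomBot (nR M)"]
  proof (intro conjI allI impI; elim exE conjE)
    fix z u v assume z: "z = Pr u v" "inP (tupP PAtomBot (nR M)) u" "inP (PProd P \<Sigma>) v"
    show "inP \<Gamma> (output_of N d (vsnd z) (proj (nR M) (vfst z)))"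
      unfolding z(1) vfst.simps vsnd.simps using z(2,3) by (rule pos)
    fix \<pi> :: "nat \<Rightarrow> nat" assume "bij \<pi>"
    then show "output_of N d (vsnd (act \<pi> z)) (proj (nR M) (vfst (act \<pi> z))) = act \<pi> (output_of N d (vsnd z) (proj (nR M) (vfst z)))"
      unfolding z(1) act.simps vfst.simps vsnd.simps using main[OF z(2,3)] by blast
  qed
qed

lemma output_of_cong:
  assumes "\<And>r. r < nR M \<Longrightarrow> g r = h r"
  shows "output_of N d v g = output_of N d v h"
proof (cases "info N d v")
  case (Some y)
  obtain q' K m rs f where y: "y = (q', K, m, rs, f)" by (cases y)
  have "set rs \<subseteq> {..<nR M}" using info_cases Some y by blast
  then have "g r = h r" if "r \<in> set rs" for r using that assms by auto
  then have "rval m g r = rval m h r" if "r \<in> set rs" for r using that by (simp add: rval_def split: option.split)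
  then have "map (\<lambda>r. the (rval m g r)) rs = map (\<lambda>r. the (rval m h r)) rs"
    "(\<forall>r\<in>set rs. rval m g r \<noteq> None) = (\<forall>r\<in>set rs. rval m h r \<noteq> None)" by auto
  then show ?thesis unfolding output_of_def Some y by (simp only: option.case prod.case)
qed (simp add: output_of_def)

text \<open>\<open>st\<close> has to agree with \<open>\<rho>\<close> only on filled registers. A
  register emptied by a test may keep a stale atom in \<open>st\<close>; it does no harm, because
  only registers in \<open>K\<close> are read, and these are filled.\<close>

lemma regs_run_correct:
  assumes fuel: "\<And>q \<rho> a N'. q < nQ M \<Longrightarrow> dom \<rho> \<subseteq> {..<nR M} \<Longrightarrow> inP \<Sigma> a \<Longrightarrow> letter_run M a N' q \<rho> \<noteq> None \<Longrightarrow>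
     letter_run M a N q \<rho> = letter_run M a N' q \<rho>"
    and "w \<in> lists (pset \<Sigma>)" "su_run M q \<rho> w out" "q < nQ M" "dom \<rho> \<subseteq> {..<nR M}"
    and "length es = length w" "map d es = trace (machine_sys N) (Base q) \<rho> w"
    and "\<And>r x. \<rho> r = Some x \<Longrightarrow> st r = VL (Atm x)"
  shows "regs_run (reads N d) (writes N d) (output_of N d) st (map2 Pr es w) = out"
  using assms(3,2,4-8)
proof (induction w arbitrary: q \<rho> out es st)
  case Nil
  then show ?case by (auto elim: su_run.cases)
next
  case (Cons a w)
  obtain N' q' \<rho>1 rs f out' where l': "letter_run M a N' q \<rho> = Some (q', \<rho>1, rs, f)"
    and out: "out = f (map (\<lambda>r. the (\<rho>1 r)) rs) # out'" and run: "su_run M q' (after_out \<rho>1 rs) w out'"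
    using su_run_ConsD[OF Cons.prems(1)] .
  have a: "inP \<Sigma> a" "w \<in> lists (pset \<Sigma>)" using Cons.prems by (auto simp: pset_def)
  have l: "letter_run M a N q \<rho> = Some (q', \<rho>1, rs, f)" using fuel[OF Cons.prems(3,4) a(1), of N'] l' by simp
  obtain x es' where es: "es = x # es'" "length es' = length w" using Cons.prems(5) by (cases es) auto
  let ?t = "letter_tree M a N q (dom \<rho>) Map.empty"
  have "letter_run M a N q \<rho> = concretize \<rho> (eval_tree ?t \<rho>)" using letter_tree_correct[of "dom \<rho>" \<rho> M a N q Map.empty] by simp
  then obtain K m where e: "eval_tree ?t \<rho> = Some (q', K, m, rs, f)" and \<rho>1: "\<rho>1 = \<rho> |` K ++ m"
    using l by (cases "eval_tree ?t \<rho>") (auto simp: concretize_def)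
  have trees: "trees (machine_sys N) a (Base q, dom \<rho>) = map_dtree (to_leaf M) ?t"
    using Cons.prems(3) by (simp add: machine_sys_def machine_trees_def)
  have dx: "d x = Some (Base q, dom \<rho>, path_of ?t \<rho>)"
    using Cons.prems(6) es trees by (simp add: machine_sys_def)
  have cfg: "\<rho> |` (K - set rs) ++ m |` (- set rs) = after_out \<rho>1 rs"
    unfolding \<rho>1 after_out_def by (rule ext) (auto simp: map_add_def restrict_map_def split: option.split)
  have tr: "map d es' = trace (machine_sys N) (Base q') (after_out \<rho>1 rs) w"
    using Cons.prems(6) es trees e by (simp add: machine_sys_def to_leaf_def cfg)
  let ?v = "Pr x a"
  have i: "info N d ?v = Some (q', K, m, rs, f)"
    using dx e Cons.prems(3) by (simp add: info_def)
  have rv: "rval m (reg_read (reads N d) ?v st) r = \<rho>1 r" if r: "r \<in> set rs" for r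
  proof (cases "m r")
    case None
    obtain y where y: "\<rho>1 r = Some y" using letter_run_defined[OF l r] by auto
    then have "r \<in> K" "\<rho> r = Some y" using None \<rho>1 by (auto simp: map_add_def restrict_map_def split: if_splits)
    then show ?thesis using None y r i Cons.prems(7)
      by (simp add: rval_def reg_read_def reads_def to_reg_def)
  next
    case (Some c) then show ?thesis using \<rho>1 by (simp add: rval_def)
  qed
  have "output_of N d ?v (reg_read (reads N d) ?v st) = f (map (\<lambda>r. the (\<rho>1 r)) rs)"
  proof -
    have eq: "map (\<lambda>r. the (rval m (reg_read (reads N d) ?v st) r)) rs = map (\<lambda>r. the (\<rho>1 r)) rs"
      using rv by simp
    have "\<forall>r\<in>set rs. rval m (reg_read (reads N d) ?v st) r \<noteq> None"
      using rv letter_run_defined[OF l] by simp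
    then have "output_of N d ?v (reg_read (reads N d) ?v st) = f (map (\<lambda>r. the (rval m (reg_read (reads N d) ?v st) r)) rs)"
      using i by (simp add: output_of_def)
    then show ?thesis by (simp only: eq)
  qed
  moreover have "regs_run (reads N d) (writes N d) (output_of N d) (reg_next (reads N d) (writes N d) ?v st) (map2 Pr es' w) = out'"
  proof (rule Cons.IH[OF run a(2)])
    show "q' < nQ M" using letter_run_wf[OF Cons.prems(3) l] by simp
    show "dom (after_out \<rho>1 rs) \<subseteq> {..<nR M}"
      using letter_run_dom[OF Cons.prems(3) l Cons.prems(4)] by (auto simp: after_out_def subset_iff domIff)
    show "length es' = length w" by (rule es(2))
    show "map d es' = trace (machine_sys N) (Base q') (after_out \<rho>1 rs) w" by (rule tr)
    fix r y assume "after_out \<rho>1 rs r = Some y"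
    then have r: "r \<notin> set rs" "\<rho>1 r = Some y" by (auto simp: after_out_def split: if_splits)
    show "reg_next (reads N d) (writes N d) ?v st r = VL (Atm y)"
    proof (cases "m r")
      case None
      then have "\<rho> r = Some y" using r \<rho>1 by (auto simp: map_add_def restrict_map_def split: if_splits)
      then show ?thesis using None r i Cons.prems(7) by (simp add: reg_next_def writes_def reads_def)
    next
      case (Some c)
      then show ?thesis using r \<rho>1 i by (simp add: reg_next_def writes_def)
    qed
  qed
  ultimately show ?case using es out by simp
qed

end

theorem theorem2:
  assumes "su_mealy \<Sigma> \<Gamma> M"
    and "\<forall>w \<in> lists (pset \<Sigma>). su_fun M w \<noteq> None"
  shows "\<exists>g. comp_primes \<Sigma> \<Gamma> g \<and> (\<forall>w \<in> lists (pset \<Sigma>). Some (g w) = su_fun M w)"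
proof -
  interpret su \<Sigma> \<Gamma> M by unfold_locales (rule assms(1))
  \<comment> \<open>One fuel for all configurations and letters turns the machine into a system of
    finite decision trees.\<close>
  obtain N where fuel: "\<And>q \<rho> a N'. q < nQ M \<Longrightarrow> dom \<rho> \<subseteq> {..<nR M} \<Longrightarrow> inP \<Sigma> a \<Longrightarrow> letter_run M a N' q \<rho> \<noteq> None \<Longrightarrow>
     letter_run M a N q \<rho> = letter_run M a N' q \<rho>"
    using uniform_fuel by metis
  let ?n0 = "Base (init M)"
  from computes_info_trace[OF machine_sys_ok, of N ?n0]
  obtain P d G where G: "cprime \<Sigma> P G" and d: "invariant P d"
    and Gd: "\<And>w. w \<in> lists (pset \<Sigma>) \<Longrightarrow> w \<in> {w. inside (machine_sys N) ?n0 Map.empty w} \<Longrightarrow>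
      map d (G w) = trace (machine_sys N) ?n0 Map.empty w"
    by (rule computes_infoE) (rule that)
  have "cprime (PProd P \<Sigma>) \<Gamma> (regs_run (reads N d) (writes N d) (output_of N d) (\<lambda>_. Defs.bot))"
    using reads_inv[OF d] writes_equivariant[OF d] output_of_equivariant[OF assms(2) d] output_of_cong
    by (rule cprime_regs_run)
  then obtain g where g: "comp_primes \<Sigma> \<Gamma> g" and geq: "\<And>w. w \<in> lists (pset \<Sigma>) \<Longrightarrow>
      g w = regs_run (reads N d) (writes N d) (output_of N d) (\<lambda>_. Defs.bot) (map2 Pr (G w) w)"
    using cprime_comp[OF cprime_pair[OF G cprime_id]] unfolding cprime_def by blast
  have "Some (g w) = su_fun M w" if w: "w \<in> lists (pset \<Sigma>)" for w
  proof -
    obtain out where out: "su_fun M w = Some out" using assms(2) w by blast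
    have "inside (machine_sys N) ?n0 Map.empty w"
      using w init_less by (intro machine_sys_inside) (auto simp: all_comps_iff)
    then have "map d (G w) = trace (machine_sys N) ?n0 Map.empty w" using Gd w by blast
    then have "regs_run (reads N d) (writes N d) (output_of N d) (\<lambda>_. Defs.bot) (map2 Pr (G w) w) = out"
      using cprime_preserves[OF G w] out init_less
      by (intro regs_run_correct[OF fuel w, of "init M" Map.empty]) (auto simp: su_fun_run)
    then show ?thesis using geq[OF w] out by simp
  qed
  then show ?thesis using g by blast
qed

end
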